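(* Assume $\phi'(y)\ne0$ for all $y\in\mathbb{R}$, and let $\omega>0$. The time-optimal particle relocation problem for the double-forced multiparticle system $\dot x=f(x)+g^u(x)u+g^v(x)v$, $g^u=\frac{\partial}{\partial p_1}$, $g^v=\frac{\partial}{\partial p_n}$, with controls satisfying $u(t)\in[-\omega,\omega]$, $v(t)\in[-\omega,0]$, possesses the strong bang-bang property with bounds on the number of switchings: for every compact set $K\subset\mathbb{R}^{2n}$ and every $T>0$ there exists an integer $N(K,T)$ such that any time-optimal trajectory of time duration $T$ which connects two points $\tilde x,\hat x$ and is contained in $K$ is a bang-bang trajectory with at most $N(K,T)$ switchings.
   Context: Let $n\ge 2$. $\Phi:\mathbb{R}\to\mathbb{R}$ is a real analytic, bounded below function with $\lim_{y\to+\infty}\Phi(y)=+\infty$, and $\phi=\Phi'$. The state is $x=(q,p)=(q_1,\dots,q_n,p_1,\dots,p_n)\in\mathbb{R}^{2n}$. The drift is the vector field $$f=\sum_{k=1}^{n}p_k\frac{\partial}{\partial q_k}-\phi(q_1-q_2)\frac{\partial}{\partial p_1}+\sum_{k=2}^{n-1}\bigl(\phi(q_{k-1}-q_k)-\phi(q_k-q_{k+1})\bigr)\frac{\partial}{\partial p_k}+\phi(q_{n-1}-q_n)\frac{\partial}{\partial p_n}.$$ Admissible controls are measurable functions $t\mapsto(u(t),v(t))$ with values in the rectangle $[-\omega,\omega]\times[-\omega,0]$. A trajectory $x:[0,T]\to\mathbb{R}^{2n}$ driven by an admissible control is time-optimal if no admissible control steers the system from $x(0)=\tilde x$ to $x(T)=\hat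 x$ in time smaller than $T$. A trajectory is bang-bang if for almost every $t\in[0,T]$ the value of its control is a vertex of the rectangle. A switching is a change of the value of the control from one vertex to another. "At most $N$ switchings" means that, up to modification on a null set, the control is piecewise constant with vertex values and changes value at most $N$ times. *)

theory Defs
  imports "HOL-Analysis.Analysis"
begin

definition real_analytic :: "(real \<Rightarrow> real) \<Rightarrow> bool" where
  "real_analytic F \<longleftrightarrow>
     (\<forall>a. \<exists>r>0. \<exists>c. \<forall>y. \<bar>y - a\<bar> < r \<longrightarrow> (\<lambda>k. c k * (y - a) ^ k) sums F y)"

text \<open>
  A state is a pair \<open>(q, p)\<close> of vectors indexed by the finite type \<open>'n\<close>, where \<open>n = CARD('n)\<close> is the
  number of particles. The particles are ordered by an enumeration \<open>e\<close>, a bijection from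
  \<open>{1..n}\<close> onto \<open>'n\<close>: the mathematical coordinates \<open>q\<^sub>k\<close> and \<open>p\<^sub>k\<close> are \<open>q $ e k\<close> and \<open>p $ e k\<close>.
\<close>

type_synonym 'n state = "(real ^ 'n) \<times> (real ^ 'n)"

definition dq :: "(nat \<Rightarrow> 'n::finite) \<Rightarrow> nat \<Rightarrow> 'n state" where
  "dq e k = (axis (e k) 1, 0)"

definition dp :: "(nat \<Rightarrow> 'n::finite) \<Rightarrow> nat \<Rightarrow> 'n state" where
  "dp e k = (0, axis (e k) 1)"

definition drift :: "(nat \<Rightarrow> 'n::finite) \<Rightarrow> (real \<Rightarrow> real) \<Rightarrow> 'n state \<Rightarrow> 'n state" where
  "drift e \<phi> = (\<lambda>(q, p). let n = CARD('n) in
      (\<Sum>k=1..n. (p $ e k) *\<^sub>R dq e k)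
      - \<phi> (q $ e 1 - q $ e 2) *\<^sub>R dp e 1
      + (\<Sum>k=2..n-1. (\<phi> (q $ e (k-1) - q $ e k) - \<phi> (q $ e k - q $ e (k+1))) *\<^sub>R dp e k)
      + \<phi> (q $ e (n-1) - q $ e n) *\<^sub>R dp e n)"

text \<open>A control is a single function \<open>w\<close> with \<open>w t = (u t, v t)\<close>.\<close>

definition admissible_control :: "real \<Rightarrow> real \<Rightarrow> (real \<Rightarrow> real \<times> real) \<Rightarrow> bool" where
  "admissible_control \<omega> T w \<longleftrightarrow>
     w \<in> borel_measurable (lebesgue_on {0..T}) \<and> (\<forall>t\<in>{0..T}. w t \<in> {-\<omega>..\<omega>} \<times> {-\<omega>..0})"

definition vertices :: "real \<Rightarrow> (real \<times> real) set" where
  "vertices \<omega> = {-\<omega>, \<omega>} \<times> {-\<omega>, 0}"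

text \<open>
  Trajectories are Caratheodory solutions, in integral form. The integral equation makes \<open>x\<close>
  continuous on \<open>[0, T]\<close>, so for a continuous \<open>\<phi>\<close> the integrand is bounded and measurable, the
  gauge integral is the Lebesgue integral, and the equation says precisely that \<open>x\<close> is absolutely
  continuous and satisfies the differential equation almost everywhere.
\<close>

definition trajectory ::
  "(nat \<Rightarrow> 'n::finite) \<Rightarrow> (real \<Rightarrow> real) \<Rightarrow> real \<Rightarrow> real \<Rightarrow>
   (real \<Rightarrow> 'n state) \<Rightarrow> (real \<Rightarrow> real \<times> real) \<Rightarrow> bool" where
  "trajectory e \<phi> \<omega> T x w \<longleftrightarrow>
     admissible_control \<omega> T w \<and>
     (\<forall>t\<in>{0..T}.
        ((\<lambda>s. drift e \<phi> (x s) + fst (w s) *\<^sub>R dp e 1 + snd (w s) *\<^sub>R dp e CARD('n))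
           has_integral (x t - x 0)) {0..t})"

text \<open>Time \<open>0\<close> steers a point to itself.\<close>

definition time_optimal ::
  "(nat \<Rightarrow> 'n::finite) \<Rightarrow> (real \<Rightarrow> real) \<Rightarrow> real \<Rightarrow> real \<Rightarrow>
   (real \<Rightarrow> 'n state) \<Rightarrow> (real \<Rightarrow> real \<times> real) \<Rightarrow> bool" where
  "time_optimal e \<phi> \<omega> T x w \<longleftrightarrow>
     trajectory e \<phi> \<omega> T x w \<and>
     \<not> (\<exists>T' y w'. 0 \<le> T' \<and> T' < T \<and> trajectory e \<phi> \<omega> T' y w' \<and> y 0 = x 0 \<and> y T' = x T)"

definition bang_bang :: "real \<Rightarrow> real \<Rightarrow> (real \<Rightarrow> real \<times> real) \<Rightarrow> bool" where
  "bang_bang \<omega> T w \<longleftrightarrow> (AE t in lebesgue_on {0..T}. w t \<in> vertices \<omega>)"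

text \<open>Piecewise constant with vertex values \<open>c 0, \<dots>, c m\<close>, and switchings exactly at
  \<open>\<tau> 1, \<dots>, \<tau> m\<close>.\<close>

definition piecewise_vertex ::
  "real \<Rightarrow> real \<Rightarrow> nat \<Rightarrow> (real \<Rightarrow> real \<times> real) \<Rightarrow> bool" where
  "piecewise_vertex \<omega> T m w \<longleftrightarrow>
     (\<exists>\<tau> :: nat \<Rightarrow> real. \<exists>c :: nat \<Rightarrow> real \<times> real.
        \<tau> 0 = 0 \<and> \<tau> (Suc m) = T \<and>
        (\<forall>i\<le>m. \<tau> i < \<tau> (Suc i)) \<and>
        (\<forall>i\<le>m. c i \<in> vertices \<omega>) \<and>
        (\<forall>i<m. c i \<noteq> c (Suc i)) \<and>
        (\<forall>i\<le>m. \<forall>t\<in>{\<tau> i..<\<tau> (Suc i)}. w t = c i) \<and> w T = c m)"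

definition at_most_switchings ::
  "real \<Rightarrow> real \<Rightarrow> nat \<Rightarrow> (real \<Rightarrow> real \<times> real) \<Rightarrow> bool" where
  "at_most_switchings \<omega> T N w \<longleftrightarrow>
     (\<exists>w'. (AE t in lebesgue_on {0..T}. w' t = w t) \<and> (\<exists>m\<le>N. piecewise_vertex \<omega> T m w'))"

end

theory Submission
  imports Defs
begin

text \<open>
  Pontryagin's maximum principle supplies a nontrivial adjoint curve \<open>(\<xi>, \<eta>)\<close> such that \<open>u\<close> and \<open>v\<close>
  are dictated by the signs of \<open>\<eta>\<^sub>1\<close> and \<open>\<eta>\<^sub>n\<close> wherever these do not vanish, so it remains to bound the
  number of their zeros. The adjoint equations \<open>\<eta>\<^sub>k' = - \<xi>\<^sub>k\<close>,
  \<open>\<xi>\<^sub>k' = a\<^sub>k (\<eta>\<^sub>k - \<eta>\<^sub>k\<^sub>+\<^sub>1) - a\<^sub>k\<^sub>-\<^sub>1 (\<eta>\<^sub>k\<^sub>-\<^sub>1 - \<eta>\<^sub>k)\<close> with \<open>a\<^sub>k = \<phi>' (q\<^sub>k - q\<^sub>k\<^sub>+\<^sub>1)\<close>, ordered as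
  \<open>\<eta>\<^sub>1, \<xi>\<^sub>1, \<eta>\<^sub>2, \<xi>\<^sub>2, \<dots>\<close>, form a lower Hessenberg system whose superdiagonal never vanishes because
  \<open>\<phi>'\<close> does not. On a time interval of length at most \<open>\<delta>\<close>, where \<open>\<delta>\<close> depends only on a bound for the
  coefficients and hence only on \<open>K\<close>, the first component of a nontrivial solution has fewer than \<open>2 n\<close>
  zeros: this follows from Rolle's theorem by reduction of order, which preserves the Hessenberg shape
  and needs no smoothness of the coefficients. Reversing the chain gives the same bound for \<open>\<eta>\<^sub>n\<close>.
\<close>

section \<open>Real analytic functions\<close>

text \<open>The bound has to be uniform over all optimal trajectories in \<open>K\<close>, and a
  priori nothing prevents \<open>\<eta> 1\<close> from vanishing on an interval, where the maximum
  condition leaves \<open>u\<close> undetermined. The Hessenberg shape excludes this: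
  \<open>\<eta> 1 = 0\<close> on an interval would force \<open>\<xi> 1\<close>, then
  \<open>\<eta> 2\<close> and so on to vanish, each step using one nonzero superdiagonal entry.
  Reduction of order is the quantitative form of this propagation. Differentiating
  \<open>\<eta> 1\<close> repeatedly is no alternative: the state is driven by a merely measurable
  control, so \<open>p\<close> is only Lipschitz and the coefficients \<open>a k\<close> have few
  derivatives.

  The maximum principle comes from comparing \<open>w\<close> with controls whose responses reach
  the end point slightly too early. Optimality is tested only against responses within distance
  \<open>1\<close> of the trajectory, so the drift may be modified far away to become globally
  Lipschitz, and every control then has a response on all of \<open>{0..T}\<close>.\<close>

lemma real_analytic_power_series_deriv:
  fixes F :: "real \<Rightarrow> real"
  assumes F: "\<And>y. \<bar>y - a\<bar> < r \<Longrightarrow> (\<lambda>k. c k * (y - a) ^ k) sums F y" and y: "\<bar>y - a\<bar> < r"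
  shows "(F has_real_derivative deriv F y) (at y)"
    and "(\<lambda>k. diffs c k * (y - a) ^ k) sums deriv F y"
proof -
  have summ: "summable (\<lambda>k. c k * z ^ k)" if "norm z < r" for z
    using F[of "z + a"] that by (auto simp: sums_iff)
  define g where "g z = (\<Sum>k. c k * z ^ k)" for z
  have g: "(g has_real_derivative (\<Sum>k. diffs c k * (y - a) ^ k)) (at (y - a))"
    unfolding g_def using termdiffs_strong'[OF summ, of r] y by simp
  have "((\<lambda>y. g (y - a)) has_real_derivative (\<Sum>k. diffs c k * (y - a) ^ k) * 1) (at y)"
    by (rule DERIV_chain2[where f = g and g = "\<lambda>y. y - a", OF g]) (auto intro!: derivative_eq_intros)
  then have g': "((\<lambda>y. g (y - a)) has_real_derivative (\<Sum>k. diffs c k * (y - a) ^ k)) (at y)"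
    by simp
  have D: "(F has_real_derivative (\<Sum>k. diffs c k * (y - a) ^ k)) (at y)"
  proof (rule has_field_derivative_transform_within_open[OF g', of "ball a r"])
    show "g (z - a) = F z" if "z \<in> ball a r" for z
      using F[of z] that by (auto simp: g_def sums_iff dist_real_def abs_minus_commute)
  qed (use y in \<open>auto simp: dist_real_def abs_minus_commute\<close>)
  show "(F has_real_derivative deriv F y) (at y)"
    using D DERIV_imp_deriv by fastforce
  have "summable (\<lambda>k. diffs c k * (y - a) ^ k)"
    by (rule termdiff_converges[where K = r]) (use summ y in auto)
  then show "(\<lambda>k. diffs c k * (y - a) ^ k) sums deriv F y"
    using DERIV_imp_deriv[OF D] by (simp add: sums_iff)
qed

lemma real_analytic_has_deriv:
  assumes "real_analytic F"
  shows "(F has_real_derivative deriv F y) (at y)"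
proof -
  obtain r c where "r > 0" "\<And>z. \<bar>z - y\<bar> < r \<Longrightarrow> (\<lambda>k. c k * (z - y) ^ k) sums F z"
    using assms unfolding real_analytic_def by blast
  then show ?thesis
    using real_analytic_power_series_deriv(1)[of y r c F y] by simp
qed

text \<open>Termwise differentiation keeps the centre and the radius. Used three times, it makes
  \<open>\<phi>\<close>, \<open>\<phi>'\<close> and \<open>\<phi>''\<close> analytic, hence bounded
  on compact intervals.\<close>

lemma real_analytic_deriv:
  assumes "real_analytic F"
  shows "real_analytic (deriv F)"
  unfolding real_analytic_def
proof
  fix a
  obtain r c where r: "r > 0" and F: "\<And>y. \<bar>y - a\<bar> < r \<Longrightarrow> (\<lambda>k. c k * (y - a) ^ k) sums F y"
    using assms unfolding real_analytic_def by blast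
  show "\<exists>r>0. \<exists>c. \<forall>y. \<bar>y - a\<bar> < r \<longrightarrow> (\<lambda>k. c k * (y - a) ^ k) sums deriv F y"
    using real_analytic_power_series_deriv(2)[OF F] r
    by (intro exI[of _ r] conjI exI[of _ "diffs c"] allI impI) auto
qed

lemma real_analytic_continuous:
  assumes "real_analytic F"
  shows "continuous_on S F"
  using real_analytic_has_deriv[OF assms]
  by (meson DERIV_isCont continuous_at_imp_continuous_on)

section \<open>Integral equations\<close>

text \<open>The right-hand side of \<open>le\<close>, multiplied by
  \<open>exp (- L * (s - a))\<close>, is nonincreasing by \<open>le\<close> itself. With
  \<open>c = 0\<close> this is the uniqueness argument for adjoint curves.\<close>

lemma gronwall:
  fixes u :: "real \<Rightarrow> real"
  assumes cont: "continuous_on {a..b} u"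
    and le: "\<And>t. t \<in> {a..b} \<Longrightarrow> u t \<le> c + L * integral {a..t} u"
    and L: "0 \<le> L" and t: "t \<in> {a..b}"
  shows "u t \<le> c * exp (L * (t - a))"
proof -
  define V where "V s = (c + L * integral {a..s} u) * exp (- L * (s - a))" for s
  have V': "(V has_real_derivative (L * u s - L * (c + L * integral {a..s} u)) * exp (- L * (s - a)))
      (at s within {a..b})" if "s \<in> {a..b}" for s
    unfolding V_def using that
    by (auto intro!: derivative_eq_intros integral_has_real_derivative[OF cont] simp: algebra_simps)
  have "V t \<le> V a"
  proof (rule DERIV_nonpos_imp_decreasing_open[where f = V])
    fix s assume s: "a < s" "s < t"
    then have "(V has_real_derivative (L * u s - L * (c + L * integral {a..s} u)) * exp (- L * (s - a))) (at s)"
      using V'[of s] t at_within_Icc_at[of a s b] by auto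
    moreover have "L * u s \<le> L * (c + L * integral {a..s} u)"
      using le[of s] s t L by (intro mult_left_mono) auto
    ultimately show "\<exists>y. (V has_real_derivative y) (at s) \<and> y \<le> 0"
      by (intro exI conjI) (assumption, simp add: mult_nonpos_nonneg)
  next
    have "continuous_on {a..b} V"
      using V' by (rule DERIV_continuous_on)
    then show "continuous_on {a..t} V"
      by (rule continuous_on_subset) (use t in auto)
  qed (use t in auto)
  then have "(c + L * integral {a..t} u) * exp (- (L * (t - a))) \<le> c"
    by (simp add: V_def)
  from mult_right_mono[OF this, of "exp (L * (t - a))"]
  have "c + L * integral {a..t} u \<le> c * exp (L * (t - a))"
    by (simp add: mult.assoc flip: exp_add)
  with le[OF t] show ?thesis by linarith
qed

text \<open>The term \<open>W\<close> absorbs the integral of a merely measurable control, so that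
  \<open>G\<close> only has to send continuous curves to continuous curves. With constant
  \<open>W\<close> the lemma solves the linear and adjoint equations.\<close>

lemma integral_equation_solution:
  fixes G :: "real \<Rightarrow> 'a::banach \<Rightarrow> 'a" and W :: "real \<Rightarrow> 'a"
  assumes ab: "a \<le> b" and W: "continuous_on {a..b} W"
    and G: "\<And>u. continuous_on {a..b} u \<Longrightarrow> continuous_on {a..b} (\<lambda>s. G s (u s))"
    and L: "0 \<le> L" and Lip: "\<And>s y z. s \<in> {a..b} \<Longrightarrow> norm (G s y - G s z) \<le> L * norm (y - z)"
  obtains u where "continuous_on {a..b} u"
    "\<And>t. t \<in> {a..b} \<Longrightarrow> u t = W t + integral {a..t} (\<lambda>s. G s (u s))"
proof -
  \<comment> \<open>The contraction factor is \<open>L / K\<close>: integrating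
    \<open>exp (K * s)\<close> gains \<open>1 / K\<close>, and the outer factor
    \<open>exp (- K * t)\<close> cancels the rest. Any \<open>K > L\<close> would do.\<close>
  define K where "K = L + 1"
  have K: "K > 0" using L by (simp add: K_def)
  \<comment> \<open>The unknown is rescaled by \<open>exp (- K * t)\<close>, which makes the Picard operator a contraction
    on the whole interval.\<close>
  define S where "S v t = exp (- K * t) *\<^sub>R (W t + integral {a..t} (\<lambda>s. G s (exp (K * s) *\<^sub>R v s)))"
    for v :: "real \<Rightarrow> 'a" and t
  \<comment> \<open>Curves on \<open>{a..b}\<close> are continued by their end values, which turns
    them into elements of the complete space of bounded continuous functions on the line.\<close>
  define J where "J v = Bcontfun (\<lambda>t. S v (max a (min b t)))" for v :: "real \<Rightarrow> 'a"
  have Gv: "continuous_on {a..b} (\<lambda>s. G s (exp (K * s) *\<^sub>R v s))" if "continuous_on {a..b} v" for v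
    by (rule G) (intro continuous_intros that)
  have contS: "continuous_on {a..b} (S v)" if "continuous_on {a..b} v" for v
    unfolding S_def
    by (intro continuous_intros W indefinite_integral_continuous_1 integrable_continuous_interval Gv that)
  have J_eq: "J v t = S v (max a (min b t))" if "continuous_on {a..b} v" for v t
  proof -
    have "(\<lambda>t. S v (max a (min b t))) \<in> bcontfun"
      unfolding bcontfun_def mem_Collect_eq
    proof
      show "continuous_on UNIV (\<lambda>t. S v (max a (min b t)))"
        by (rule continuous_on_compose2[OF contS[OF that]]) (use ab in \<open>auto intro!: continuous_intros\<close>)
      have "range (\<lambda>t. S v (max a (min b t))) \<subseteq> S v ` {a..b}"
        using ab by auto
      then show "bounded (range (\<lambda>t. S v (max a (min b t))))"
        by (meson bounded_subset compact_imp_bounded compact_continuous_image contS that compact_Icc)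
    qed
    then show ?thesis
      unfolding J_def by (simp add: Bcontfun_inverse)
  qed
  have diff: "norm (S v t - S v' t) \<le> L / K * dist v v'" if t: "t \<in> {a..b}" for v v' :: "real \<Rightarrow>\<^sub>C 'a" and t
  proof -
    let ?g = "\<lambda>v s. G s (exp (K * s) *\<^sub>R apply_bcontfun v s)"
    have int: "?g v integrable_on {a..t}" for v
      by (rule integrable_continuous_interval, rule continuous_on_subset[OF Gv]) (use t in auto)
    have hi: "((\<lambda>s. L * dist v v' * exp (K * s)) has_integral (L * dist v v' / K * exp (K * t) - L * dist v v' / K * exp (K * a))) {a..t}"
      using t K by (intro fundamental_theorem_of_calculus)
        (auto intro!: derivative_eq_intros simp flip: has_real_derivative_iff_has_vector_derivative)
    have "norm (integral {a..t} (?g v) - integral {a..t} (?g v')) = norm (integral {a..t} (\<lambda>s. ?g v s - ?g v' s))"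
      by (simp add: integral_diff int)
    also have "\<dots> \<le> integral {a..t} (\<lambda>s. L * dist v v' * exp (K * s))"
    proof (rule integral_norm_bound_integral)
      fix s assume s: "s \<in> {a..t}"
      then have "norm (?g v s - ?g v' s) \<le> L * norm (exp (K * s) *\<^sub>R v s - exp (K * s) *\<^sub>R v' s)"
        using t by (intro Lip) auto
      also have "\<dots> = L * (exp (K * s) * dist (v s) (v' s))"
        by (simp add: dist_norm flip: scaleR_diff_right)
      also have "\<dots> \<le> L * (exp (K * s) * dist v v')"
        by (intro mult_left_mono dist_bounded L) auto
      finally show "norm (?g v s - ?g v' s) \<le> L * dist v v' * exp (K * s)"
        by (simp add: mult_ac)
    qed (use int hi in \<open>auto intro!: integrable_diff\<close>)
    also have "\<dots> = L * dist v v' / K * exp (K * t) - L * dist v v' / K * exp (K * a)"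
      using hi by (rule integral_unique)
    also have "\<dots> \<le> L * dist v v' / K * exp (K * t)"
      using L K by simp
    finally have "exp (- K * t) * norm (integral {a..t} (?g v) - integral {a..t} (?g v')) \<le> exp (- K * t) * (L * dist v v' / K * exp (K * t))"
      by (intro mult_left_mono) auto
    also have "\<dots> = L / K * dist v v'"
      by (simp add: exp_minus field_simps)
    finally show ?thesis
      by (simp add: S_def flip: scaleR_diff_right)
  qed
  have "\<exists>!v. J (apply_bcontfun v) = v"
  proof (rule banach_fix_type)
    show "0 \<le> L / K" "L / K < 1"
      using L K by (auto simp: K_def)
    show "\<forall>v v'. dist (J (apply_bcontfun v)) (J (apply_bcontfun v')) \<le> L / K * dist v v'"
    proof (intro allI dist_bound)
      fix v v' :: "real \<Rightarrow>\<^sub>C 'a" and t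
      show "dist (J v t) (J v' t) \<le> L / K * dist v v'"
        using ab diff[of "max a (min b t)" v v'] by (simp add: J_eq dist_norm)
    qed
  qed
  then obtain v where v: "J (apply_bcontfun v) = v" by blast
  have vS: "v t = S v t" if "t \<in> {a..b}" for t
    using J_eq[of v t] that by (simp add: v)
  show ?thesis
  proof
    show "continuous_on {a..b} (\<lambda>t. exp (K * t) *\<^sub>R v t)"
      by (intro continuous_intros) auto
    show "exp (K * t) *\<^sub>R v t = W t + integral {a..t} (\<lambda>s. G s (exp (K * s) *\<^sub>R v s))" if "t \<in> {a..b}" for t
      by (subst vS[OF that]) (simp add: S_def flip: exp_add)
  qed
qed

section \<open>Zeros of solutions of lower Hessenberg systems\<close>

definition solves :: "nat \<Rightarrow> real set \<Rightarrow> (nat \<Rightarrow> nat \<Rightarrow> real \<Rightarrow> real) \<Rightarrow> (nat \<Rightarrow> real \<Rightarrow> real) \<Rightarrow> bool" where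
  "solves N S M Y \<longleftrightarrow>
     (\<forall>i<N. \<forall>t\<in>S. (Y i has_real_derivative (\<Sum>j<N. M i j t * Y j t)) (at t within S))"

text \<open>The superdiagonal has no lower bound, only nonvanishing: it serves to transfer zeros
  from one function to another. Thus \<open>C\<close> is the only quantity, besides the size
  \<open>N\<close>, on which the length \<open>\<delta>\<close> below depends.\<close>

definition hessenberg :: "nat \<Rightarrow> real \<Rightarrow> real set \<Rightarrow> (nat \<Rightarrow> nat \<Rightarrow> real \<Rightarrow> real) \<Rightarrow> bool" where
  "hessenberg N C S M \<longleftrightarrow>
     (\<forall>i<N. \<forall>j<N. continuous_on S (M i j) \<and>
        (\<forall>t\<in>S. \<bar>M i j t\<bar> \<le> C \<and> (Suc i < j \<longrightarrow> M i j t = 0) \<and> (j = Suc i \<longrightarrow> M i j t \<noteq> 0)))"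

text \<open>On so short an interval the solution starting at the first unit vector moves by at most
  \<open>1/2\<close>. Hence \<open>P 0\<close> stays away from zero and can be used as a
  divisor.\<close>

lemma linear_system_solution:
  fixes C a b :: real and M :: "nat \<Rightarrow> nat \<Rightarrow> real \<Rightarrow> real"
  assumes N: "0 < N" "N \<le> CARD('m::finite)" and C: "0 \<le> C" and ab: "a \<le> b" "C * N\<^sup>2 * (b - a) \<le> 1/4"
    and cont: "\<And>i j. i < N \<Longrightarrow> j < N \<Longrightarrow> continuous_on {a..b} (M i j)"
    and bound: "\<And>i j t. i < N \<Longrightarrow> j < N \<Longrightarrow> t \<in> {a..b} \<Longrightarrow> \<bar>M i j t\<bar> \<le> C"
  obtains P :: "nat \<Rightarrow> real \<Rightarrow> real" where "solves N {a..b} M P"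
    "\<And>t. t \<in> {a..b} \<Longrightarrow> P 0 t \<ge> 1/2" "\<And>i t. i < N \<Longrightarrow> t \<in> {a..b} \<Longrightarrow> \<bar>P i t\<bar> \<le> 2"
proof -
  \<comment> \<open>The \<open>N\<close> unknowns are placed in distinct coordinates of
    \<open>real ^ 'm\<close>; the right-hand side \<open>G\<close> vanishes in all other
    coordinates.\<close>
  obtain g :: "nat \<Rightarrow> 'm" where g: "bij_betw g {0..<CARD('m)} UNIV"
    using ex_bij_betw_nat_finite[OF finite_class.finite_UNIV] by blast
  have inj: "g i = g j \<longleftrightarrow> i = j" if "i < N" "j < N" for i j
    using g that N by (auto simp: bij_betw_def inj_on_def)
  define G :: "real \<Rightarrow> real ^ 'm \<Rightarrow> real ^ 'm"
    where "G t y = (\<Sum>i<N. (\<Sum>j<N. M i j t * y $ g j) *\<^sub>R axis (g i) 1)" for t y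
  \<comment> \<open>A crude bound: there are \<open>N\<close> rows, each a sum of \<open>N\<close>
    terms of size at most \<open>C * norm y\<close>.\<close>
  define L where "L = C * N\<^sup>2"
  have L: "0 \<le> L" using C by (simp add: L_def)
  have G_nth: "G t y $ g i = (\<Sum>j<N. M i j t * y $ g j)" if "i < N" for t y i
  proof -
    have "G t y $ g i = (\<Sum>k<N. if k = i then \<Sum>j<N. M k j t * y $ g j else 0)"
      unfolding G_def sum_component
      by (rule sum.cong) (use that in \<open>auto simp: axis_def inj\<close>)
    then show ?thesis using that by simp
  qed
  have norm_G: "norm (G t y) \<le> L * norm y" if t: "t \<in> {a..b}" for t y
  proof -
    have "norm (G t y) \<le> (\<Sum>i<N. \<Sum>j<N. C * norm y)"
      unfolding G_def
    proof (rule order_trans[OF norm_sum], rule sum_mono)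
      fix i assume i: "i \<in> {..<N}"
      have "norm ((\<Sum>j<N. M i j t * y $ g j) *\<^sub>R axis (g i) (1::real)) = \<bar>\<Sum>j<N. M i j t * y $ g j\<bar>"
        by simp
      also have "\<dots> \<le> (\<Sum>j<N. \<bar>M i j t * y $ g j\<bar>)"
        by (rule sum_abs)
      also have "\<dots> \<le> (\<Sum>j<N. C * norm y)"
        unfolding abs_mult
        by (intro sum_mono mult_mono bound component_le_norm_cart) (use i t C in auto)
      finally show "norm ((\<Sum>j<N. M i j t * y $ g j) *\<^sub>R axis (g i) (1::real)) \<le> (\<Sum>j<N. C * norm y)" .
    qed
    then show ?thesis by (simp add: L_def power2_eq_square mult_ac)
  qed
  have G_diff: "G t y - G t z = G t (y - z)" for t y z
    unfolding G_def by (simp add: right_diff_distrib sum_subtractf scaleR_diff_left)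
  have contG: "continuous_on {a..b} (\<lambda>s. G s (u s))" if "continuous_on {a..b} u" for u
    unfolding G_def by (intro continuous_intros cont that) auto
  obtain u where u: "continuous_on {a..b} u"
    and ueq: "\<And>t. t \<in> {a..b} \<Longrightarrow> u t = axis (g 0) 1 + integral {a..t} (\<lambda>s. G s (u s))"
    using integral_equation_solution[of a b "\<lambda>_. axis (g 0) 1" G L] ab contG L norm_G
    by (auto simp: G_diff continuous_intros)
  have int: "(\<lambda>s. G s (u s)) integrable_on {a..t}" "u integrable_on {a..t}" "(\<lambda>s. norm (u s)) integrable_on {a..t}"
    if "t \<in> {a..b}" for t
    using that by (auto intro!: integrable_continuous_interval continuous_on_norm intro: continuous_on_subset[OF contG[OF u]] continuous_on_subset[OF u])
  have normint: "norm (integral {a..t} (\<lambda>s. G s (u s))) \<le> L * integral {a..t} (\<lambda>s. norm (u s))" if t: "t \<in> {a..b}" for t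
  proof -
    have "norm (integral {a..t} (\<lambda>s. G s (u s))) \<le> integral {a..t} (\<lambda>s. L * norm (u s))"
      using t by (intro integral_norm_bound_integral int integrable_on_mult_right norm_G) auto
    then show ?thesis by simp
  qed
  have small: "L * (t - a) \<le> 1/4" if "t \<in> {a..b}" for t
    using ab(2) that mult_left_mono[of "t - a" "b - a" L] L by (simp add: L_def)
  have norm_u: "norm (u t) \<le> 2" if t: "t \<in> {a..b}" for t
  proof -
    have "norm (u t) \<le> 1 * exp (L * (t - a))"
    proof (rule gronwall)
      show "continuous_on {a..b} (\<lambda>t. norm (u t))" by (intro continuous_intros u)
      show "norm (u s) \<le> 1 + L * integral {a..s} (\<lambda>s. norm (u s))" if "s \<in> {a..b}" for s
        using normint[OF that] norm_triangle_ineq[of "axis (g 0) 1" "integral {a..s} (\<lambda>s. G s (u s))"]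
        by (simp add: ueq[OF that])
    qed (use L t in auto)
    also have "exp (L * (t - a)) \<le> exp (1/4)"
      using small[OF t] by simp
    also have "exp (1/4::real) \<le> 2"
      using exp_bound[of "1/4"] by (simp add: power2_eq_square)
    finally show ?thesis by simp
  qed
  \<comment> \<open>Since \<open>norm (u s) \<le> 2\<close>, the displacement is at most
    \<open>2 * L * (t - a)\<close>; the \<open>1/4\<close> in the hypothesis makes this
    \<open>1/2\<close>.\<close>
  have close: "norm (u t - axis (g 0) 1) \<le> 1/2" if t: "t \<in> {a..b}" for t
  proof -
    have "integral {a..t} (\<lambda>s. norm (u s)) \<le> integral {a..t} (\<lambda>s. 2)"
      using t by (intro integral_le int norm_u) auto
    then have "L * integral {a..t} (\<lambda>s. norm (u s)) \<le> L * (2 * (t - a))"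
      using t L by (intro mult_left_mono) auto
    also have "\<dots> \<le> 1/2" using small[OF t] by (simp add: algebra_simps)
    finally show ?thesis
      using normint[OF t] by (simp add: ueq[OF t])
  qed
  show ?thesis
  proof
    show "solves N {a..b} M (\<lambda>i t. u t $ g i)"
      unfolding solves_def
    proof (intro allI impI ballI)
      fix i t assume i: "i < N" and t: "t \<in> {a..b}"
      have "((\<lambda>t. axis (g 0) 1 + integral {a..t} (\<lambda>s. G s (u s))) has_vector_derivative G t (u t)) (at t within {a..b})"
        using integral_has_vector_derivative[OF contG[OF u] t] by (auto intro!: derivative_eq_intros)
      then have "(u has_vector_derivative G t (u t)) (at t within {a..b})"
        by (rule has_vector_derivative_transform[rotated 2]) (use t ueq in auto)
      from bounded_linear.has_vector_derivative[OF bounded_linear_vec_nth this, of "g i"]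
      show "((\<lambda>t. u t $ g i) has_real_derivative (\<Sum>j<N. M i j t * u t $ g j)) (at t within {a..b})"
        by (simp add: has_real_derivative_iff_has_vector_derivative G_nth[OF i])
    qed
    show "u t $ g 0 \<ge> 1/2" if "t \<in> {a..b}" for t
      using order_trans[OF component_le_norm_cart close[OF that], of "g 0"] by (simp add: axis_def abs_if split: if_splits)
    show "\<bar>u t $ g i\<bar> \<le> 2" if "t \<in> {a..b}" for i t
      using order_trans[OF component_le_norm_cart norm_u[OF that]] .
  qed
qed

text \<open>The last conjunct carries the induction, which adds zeros of \<open>f\<close> from left
  to right: the zeros of \<open>f'\<close> found so far lie left of the old maximum and the new one
  lies right of it, so they are distinct.\<close>

lemma Rolle_zeros:
  fixes f f' :: "real \<Rightarrow> real"
  assumes f': "\<And>t. t \<in> {a..b} \<Longrightarrow> (f has_real_derivative f' t) (at t within {a..b})"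
    and S: "finite S" "S \<noteq> {}" "S \<subseteq> {t\<in>{a..b}. f t = 0}"
  shows "\<exists>S'. finite S' \<and> S' \<subseteq> {t\<in>{a..b}. f' t = 0} \<and> card S = Suc (card S') \<and> (\<forall>s\<in>S'. s < Max S)"
  using S
proof (induction S rule: finite_linorder_max_induct)
  case empty
  then show ?case by simp
next
  case (insert s A)
  show ?case
  proof (cases "A = {}")
    case True
    then show ?thesis by (intro exI[of _ "{}"]) auto
  next
    case False
    let ?m = "Max A"
    have m: "?m \<in> A" using insert False by simp
    obtain A' where A': "finite A'" "A' \<subseteq> {t\<in>{a..b}. f' t = 0}" "card A = Suc (card A')" "\<forall>s\<in>A'. s < ?m"
      using insert False by auto
    have ms: "?m < s" "?m \<in> {a..b}" "s \<in> {a..b}" "f ?m = 0" "f s = 0"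
      using insert m by auto
    have "\<exists>z\<in>{?m<..<s}. f s - f ?m = f' z * (s - ?m)"
    proof (rule mvt_simple)
      fix x assume "?m \<le> x" "x \<le> s"
      then have "x \<in> {a..b}" "{?m..s} \<subseteq> {a..b}" using ms by auto
      then show "(f has_derivative (*) (f' x)) (at x within {?m..s})"
        using has_field_derivative_subset[OF f'] by (auto simp: has_field_derivative_def)
    qed (use ms in auto)
    then obtain z where z: "?m < z" "z < s" "f' z = 0" using ms by auto
    have "Max (insert s A) = s"
      using insert.hyps False by (intro Max_eqI) (auto intro: less_imp_le)
    moreover have "z \<notin> A'" "s \<notin> A" using A' z insert by force+
    ultimately show ?thesis
      using A' z ms insert.hyps by (intro exI[of _ "insert z A'"]) force
  qed
qed

text \<open>
  Reduction of order: if \<open>P\<close> is the solution starting at the first unit vector and \<open>c = Y\<^sub>0 / P\<^sub>0\<close>, then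
  the components \<open>1, \<dots>, N\<close> of \<open>Y - c P\<close> solve a Hessenberg system of size \<open>N\<close> with the same
  superdiagonal, and \<open>c'\<close> is a nonvanishing multiple of the first of them.
  The type \<open>'m\<close> only provides a space in which to solve for \<open>P\<close>.
\<close>

lemma hessenberg_zeros:
  assumes "0 \<le> C" "N \<le> CARD('m::finite)"
  shows "\<exists>\<delta>>0. \<forall>a b M Y S. a < b \<and> b - a \<le> \<delta> \<and> hessenberg N C {a..b} M \<and> solves N {a..b} M Y \<and>
      (\<exists>i<N. \<exists>t\<in>{a..b}. Y i t \<noteq> 0) \<and> finite S \<and> S \<subseteq> {t\<in>{a..b}. Y 0 t = 0} \<longrightarrow> card S < N"
  using assms
proof (induction N arbitrary: C)
  case 0
  show ?case by (intro exI[of _ 1]) auto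
next
  case (Suc N)
  \<comment> \<open>One reduction replaces the bound \<open>C\<close> by \<open>5 * C\<close>: the
    correction \<open>M 0 1 t * P (Suc i) t / P 0 t\<close> is at most
    \<open>C * 2 / (1/2) = 4 * C\<close>, and the old entry adds \<open>C\<close>.\<close>
  obtain \<delta>' where \<delta>': "\<delta>' > 0" and IH: "\<And>a b M Y S. a < b \<Longrightarrow> b - a \<le> \<delta>' \<Longrightarrow> hessenberg N (5 * C) {a..b} M \<Longrightarrow>
      solves N {a..b} M Y \<Longrightarrow> (\<exists>i<N. \<exists>t\<in>{a..b}. Y i t \<noteq> 0) \<Longrightarrow> finite S \<Longrightarrow> S \<subseteq> {t\<in>{a..b}. Y 0 t = 0} \<Longrightarrow> card S < N"
    using Suc.IH[of "5 * C"] Suc.prems by (auto simp: Suc_le_eq)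
  \<comment> \<open>The second term yields the smallness condition for solving for \<open>P\<close>;
    the summand \<open>1\<close> in the denominator covers \<open>C = 0\<close>.\<close>
  define \<delta> where "\<delta> = min \<delta>' (1 / (4 * (C * (Suc N)\<^sup>2 + 1)))"
  have \<delta>0: "\<delta> > 0" using \<delta>' Suc.prems by (auto simp: \<delta>_def intro!: add_nonneg_pos)
  have main: "card S < Suc N"
    if ab: "a < b" "b - a \<le> \<delta>" and hess: "hessenberg (Suc N) C {a..b} M" and sol: "solves (Suc N) {a..b} M Y"
      and nz: "\<exists>i<Suc N. \<exists>t\<in>{a..b}. Y i t \<noteq> 0" and S: "finite S" "S \<subseteq> {t\<in>{a..b}. Y 0 t = 0}" for a b M Y S
  proof -
    have M: "continuous_on {a..b} (M i j)" "\<And>t. t \<in> {a..b} \<Longrightarrow> \<bar>M i j t\<bar> \<le> C"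
      "\<And>t. t \<in> {a..b} \<Longrightarrow> Suc i < j \<Longrightarrow> M i j t = 0" "\<And>t. t \<in> {a..b} \<Longrightarrow> j = Suc i \<Longrightarrow> M i j t \<noteq> 0"
      if "i < Suc N" "j < Suc N" for i j
      using hess that unfolding hessenberg_def by blast+
    have "C * (Suc N)\<^sup>2 * (b - a) \<le> (C * (Suc N)\<^sup>2 + 1) * (1 / (4 * (C * (Suc N)\<^sup>2 + 1)))"
      using ab Suc.prems by (intro mult_mono) (auto simp: \<delta>_def)
    also have "\<dots> = 1/4"
    proof -
      have "C * (Suc N)\<^sup>2 + 1 \<noteq> 0" using Suc.prems by (intro less_imp_neq[symmetric] add_nonneg_pos) auto
      then show ?thesis by (simp add: field_simps)
    qed
    finally obtain P where P: "solves (Suc N) {a..b} M P" "\<And>t. t \<in> {a..b} \<Longrightarrow> P 0 t \<ge> 1/2"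
      "\<And>i t. i < Suc N \<Longrightarrow> t \<in> {a..b} \<Longrightarrow> \<bar>P i t\<bar> \<le> 2"
      using linear_system_solution[where 'm = 'm and N = "Suc N" and C = C and a = a and b = b and M = M] Suc.prems ab M(1,2) by auto
    have P0: "P 0 t \<noteq> 0" if "t \<in> {a..b}" for t using P(2)[OF that] by auto
    define c where "c t = Y 0 t / P 0 t" for t
    define Z where "Z i t = Y (Suc i) t - P (Suc i) t * c t" for i t
    \<comment> \<open>Differentiating \<open>Z\<close> leaves the lower right block of
      \<open>M\<close> minus \<open>c' t * P (Suc i) t\<close>. As \<open>c'\<close> is a multiple
      of \<open>Z 0\<close>, the correction only affects column \<open>0\<close>, which never meets
      the superdiagonal.\<close>
    define M' where "M' i j t = M (Suc i) (Suc j) t - (if j = 0 then M 0 1 t * P (Suc i) t / P 0 t else 0)" for i j t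
    \<comment> \<open>In row \<open>0\<close> of a Hessenberg matrix only the entry in column
      \<open>1\<close> remains once the component \<open>0\<close> has been eliminated. For
      \<open>N = 0\<close> there is no \<open>Z 0\<close>, and \<open>c\<close> is constant.\<close>
    define c' where "c' t = (if N = 0 then 0 else M 0 1 t * Z 0 t / P 0 t)" for t
    have row: "(\<Sum>j<Suc N. M i j t * (Y j t - P j t * c t)) = (\<Sum>j<N. M i (Suc j) t * Z j t)" if "t \<in> {a..b}" for i t
      using P0[OF that] by (simp add: sum.lessThan_Suc_shift c_def Z_def del: sum.lessThan_Suc)
    have DY: "(Y i has_real_derivative (\<Sum>j<Suc N. M i j t * Y j t)) (at t within {a..b})"
      and DP: "(P i has_real_derivative (\<Sum>j<Suc N. M i j t * P j t)) (at t within {a..b})"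
      if "i < Suc N" "t \<in> {a..b}" for i t
      using sol P(1) that unfolding solves_def by auto
    have row': "(\<Sum>j<Suc N. M i j t * Y j t) - (\<Sum>j<Suc N. M i j t * P j t) * c t = (\<Sum>j<N. M i (Suc j) t * Z j t)"
      if "t \<in> {a..b}" for i t
      by (subst row[OF that, symmetric])
         (simp add: sum_distrib_left sum_distrib_right right_diff_distrib sum_subtractf mult_ac del: sum.lessThan_Suc)
    have Dc: "(c has_real_derivative c' t) (at t within {a..b})" if t: "t \<in> {a..b}" for t
    proof -
      have "(\<Sum>j<N. M 0 (Suc j) t * Z j t) = c' t * P 0 t"
      proof (cases N)
        case (Suc N')
        have "(\<Sum>j<N. M 0 (Suc j) t * Z j t) = M 0 1 t * Z 0 t"
          unfolding Suc sum.lessThan_Suc_shift using M(3)[of 0 _ t] t Suc by simp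
        then show ?thesis using P0[OF t] Suc by (simp add: c'_def)
      qed (simp add: c'_def)
      with row'[OF t, of 0] have eq: "(\<Sum>j<Suc N. M 0 j t * Y j t) = (\<Sum>j<Suc N. M 0 j t * P j t) * c t + c' t * P 0 t"
        by linarith
      show ?thesis
        using DERIV_divide[OF DY[of 0, OF _ t] DP[of 0, OF _ t] P0[OF t]] P0[OF t]
        unfolding c_def eq by (simp add: c_def field_simps del: sum.lessThan_Suc)
    qed
    have solZ: "solves N {a..b} M' Z"
      unfolding solves_def
    proof (intro allI impI ballI)
      fix i t assume i: "i < N" and t: "t \<in> {a..b}"
      obtain N' where N': "N = Suc N'" using i by (cases N) auto
      have "(Z i has_real_derivative (\<Sum>j<Suc N. M (Suc i) j t * Y j t)
          - ((\<Sum>j<Suc N. M (Suc i) j t * P j t) * c t + c' t * P (Suc i) t)) (at t within {a..b})"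
        unfolding Z_def using i
        by (intro DERIV_diff DERIV_mult DY DP Dc t) auto
      also have "(\<Sum>j<Suc N. M (Suc i) j t * Y j t)
          - ((\<Sum>j<Suc N. M (Suc i) j t * P j t) * c t + c' t * P (Suc i) t)
        = (\<Sum>j<N. M (Suc i) (Suc j) t * Z j t) - c' t * P (Suc i) t"
        using row'[OF t, of "Suc i"] by linarith
      also have "\<dots> = (\<Sum>j<N. M' i j t * Z j t)"
        by (simp add: N' M'_def c'_def sum.lessThan_Suc_shift algebra_simps del: sum.lessThan_Suc)
      finally show "(Z i has_real_derivative (\<Sum>j<N. M' i j t * Z j t)) (at t within {a..b})" .
    qed
    have bnd: "\<bar>x - (if Q then y else 0)\<bar> \<le> 5 * C" if "\<bar>y\<bar> \<le> 4 * C" "\<bar>x\<bar> \<le> C" for x y :: real and Q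
      using that by (cases Q) auto
    have hessZ: "hessenberg N (5 * C) {a..b} M'"
      unfolding hessenberg_def
    proof (intro allI impI ballI conjI)
      fix i j assume ij: "i < N" "j < N"
      have contP: "continuous_on {a..b} (P k)" if "k < Suc N" for k
        using DP[OF that] by (rule DERIV_continuous_on)
      show "continuous_on {a..b} (M' i j)"
        unfolding M'_def using ij P0
        by (cases "j = 0") (auto intro!: continuous_intros M(1) contP)
      fix t assume t: "t \<in> {a..b}"
      have "\<bar>M 0 1 t\<bar> * \<bar>P (Suc i) t\<bar> \<le> C * 2"
        using ij t Suc.prems by (intro mult_mono M(2) P(3)) auto
      also have "\<dots> \<le> 4 * C * \<bar>P 0 t\<bar>"
        using P(2)[OF t] Suc.prems mult_left_mono[of "1/2" "\<bar>P 0 t\<bar>" "4 * C"] by auto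
      finally have "\<bar>M 0 1 t * P (Suc i) t / P 0 t\<bar> \<le> 4 * C"
        using P0[OF t] by (simp add: abs_mult field_simps)
      moreover have "\<bar>M (Suc i) (Suc j) t\<bar> \<le> C"
        using ij t by (intro M(2)) auto
      ultimately show "\<bar>M' i j t\<bar> \<le> 5 * C"
        unfolding M'_def by (rule bnd)
      show "M' i j t = 0" if "Suc i < j"
        using that ij t M(3)[of "Suc i" "Suc j"] by (auto simp: M'_def)
      show "M' i j t \<noteq> 0" if "j = Suc i"
        using that ij t M(4)[of "Suc i" "Suc j"] by (auto simp: M'_def)
    qed
    have Sc: "S \<subseteq> {t\<in>{a..b}. c t = 0}" using S by (auto simp: c_def)
    show ?thesis
    proof (cases "\<exists>i<N. \<exists>t\<in>{a..b}. Z i t \<noteq> 0")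
      case True
      show ?thesis
      proof (cases "S = {}")
        case False
        have "\<exists>S'. finite S' \<and> S' \<subseteq> {t\<in>{a..b}. c' t = 0} \<and> card S = Suc (card S') \<and> (\<forall>s\<in>S'. s < Max S)"
          using Dc S(1) False Sc by (rule Rolle_zeros[where f = c and f' = c' and a = a and b = b and S = S])
        then obtain S' where S': "finite S'" "S' \<subseteq> {t\<in>{a..b}. c' t = 0}" "card S = Suc (card S')"
          by (elim exE conjE) (rule that)
        have N0: "N \<noteq> 0" using True by auto
        have "Z 0 t = 0" if "t \<in> {a..b}" "c' t = 0" for t
        proof -
          have "M 0 1 t \<noteq> 0" by (rule M(4)[of 0 1 t]) (use N0 that in auto)
          then show ?thesis using that(2) P0[OF that(1)] N0 unfolding c'_def by simp
        qed
        then have "S' \<subseteq> {t\<in>{a..b}. Z 0 t = 0}"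
          using S'(2) by blast
        moreover have "b - a \<le> \<delta>'" using ab(2) by (simp add: \<delta>_def)
        ultimately have "card S' < N"
          by (rule IH[OF ab(1) _ hessZ solZ True S'(1), rotated])
        with S' show ?thesis by simp
      qed simp
    next
      \<comment> \<open>If \<open>Z\<close> vanishes identically, then \<open>Y\<close> is a
        constant nonzero multiple of \<open>P\<close>, so \<open>Y 0\<close> has no zero at
        all.\<close>
      case False
      then have c'0: "c' t = 0" if "t \<in> {a..b}" for t
        using that by (cases "N = 0") (simp_all add: c'_def)
      have "\<exists>k. \<forall>t\<in>{a..b}. c t = k"
      proof (rule has_field_derivative_zero_constant)
        show "(c has_real_derivative 0) (at t within {a..b})" if "t \<in> {a..b}" for t
          using Dc[OF that] by (simp add: c'0[OF that])
      qed simp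
      then obtain k where k: "\<And>t. t \<in> {a..b} \<Longrightarrow> c t = k" by blast
      have Yk: "Y i t = P i t * k" if "i < Suc N" "t \<in> {a..b}" for i t
      proof (cases i)
        case 0
        have "Y 0 t = P 0 t * c t" using P0[OF that(2)] by (simp add: c_def)
        then show ?thesis using k[OF that(2)] 0 by simp
      next
        case (Suc i')
        then have "Z i' t = 0" using False that by simp
        then show ?thesis using k[OF that(2)] Suc by (simp add: Z_def)
      qed
      obtain i t where "i < Suc N" "t \<in> {a..b}" "Y i t \<noteq> 0"
        using nz by blast
      with Yk[of i t] have "k \<noteq> 0" by auto
      have "S = {}"
      proof (rule equals0I)
        fix t assume "t \<in> S"
        then have "t \<in> {a..b}" "c t = 0" using Sc by auto
        with k[of t] \<open>k \<noteq> 0\<close> show False by simp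
      qed
      then show ?thesis by simp
    qed
  qed
  show ?case
    by (intro exI[of _ \<delta>] conjI \<delta>0 allI impI) (elim conjE, rule main)
qed

text \<open>Nontriviality is required at every time, so that each short piece of
  \<open>{0..T}\<close> inherits it and has fewer than \<open>N\<close> zeros. Zeros shared by
  adjacent pieces are counted twice, which is harmless for an upper bound.\<close>

lemma hessenberg_zeros_interval:
  assumes "0 \<le> C" "N \<le> CARD('m::finite)" "T > 0"
  shows "\<exists>Z::nat. \<forall>M Y. hessenberg N C {0..T} M \<and> solves N {0..T} M Y \<and> (\<forall>t\<in>{0..T}. \<exists>i<N. Y i t \<noteq> 0) \<longrightarrow>
      finite {t\<in>{0..T}. Y 0 t = 0} \<and> card {t\<in>{0..T}. Y 0 t = 0} \<le> Z"
proof -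
  obtain \<delta> where \<delta>: "\<delta> > 0" and few: "\<And>a b M Y S. a < b \<Longrightarrow> b - a \<le> \<delta> \<Longrightarrow> hessenberg N C {a..b} M \<Longrightarrow>
      solves N {a..b} M Y \<Longrightarrow> (\<exists>i<N. \<exists>t\<in>{a..b}. Y i t \<noteq> 0) \<Longrightarrow> finite S \<Longrightarrow> S \<subseteq> {t\<in>{a..b}. Y 0 t = 0} \<Longrightarrow> card S < N"
    using hessenberg_zeros[OF assms(1,2)] by blast
  \<comment> \<open>The number of pieces is fixed before \<open>M\<close> and \<open>Y\<close>; this
    makes the final bound \<open>m * N\<close> uniform.\<close>
  obtain m where m: "T / \<delta> < real m" using reals_Archimedean2 by blast
  have m0: "m > 0" using m \<delta> assms(3) by (cases m) (auto simp: field_simps)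
  define I where "I k = {real k * T / m..real (Suc k) * T / m}" for k
  have cover: "{0..T} \<subseteq> (\<Union>k<m. I k)"
  proof
    fix t assume t: "t \<in> {0..T}"
    show "t \<in> (\<Union>k<m. I k)"
    proof (cases "t = T")
      case True
      then have "t \<in> I (m - 1)" using m0 assms(3) by (auto simp: I_def field_simps of_nat_diff)
      then show ?thesis using m0 by auto
    next
      case False
      define k where "k = nat \<lfloor>t * m / T\<rfloor>"
      have k: "real k \<le> t * m / T" "t * m / T < real (Suc k)"
        using t assms(3) by (auto simp: k_def) linarith
      have "t * m / T < m" using False t assms(3) m0 by (auto simp: field_simps)
      with k have "k < m" by linarith
      moreover have "t \<in> I k" using k assms(3) m0 by (auto simp: I_def field_simps)
      ultimately show ?thesis by blast
    qed
  qed
  have "finite {t\<in>{0..T}. Y 0 t = 0} \<and> card {t\<in>{0..T}. Y 0 t = 0} \<le> m * N"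
    if hess: "hessenberg N C {0..T} M" and sol: "solves N {0..T} M Y" and nz: "\<forall>t\<in>{0..T}. \<exists>i<N. Y i t \<noteq> 0" for M Y
  proof -
    have piece: "finite {t\<in>I k. Y 0 t = 0} \<and> card {t\<in>I k. Y 0 t = 0} \<le> N" if k: "k < m" for k
    proof -
      have lt: "real k * T / m < real (Suc k) * T / m"
        using m0 assms(3) by (simp add: divide_strict_right_mono)
      have sub: "I k \<subseteq> {0..T}"
      proof -
        have "real (Suc k) * T \<le> real m * T" using k assms(3) by (intro mult_right_mono) auto
        then show ?thesis using m0 assms(3) unfolding I_def by (auto simp: field_simps)
      qed
      have len: "real (Suc k) * T / m - real k * T / m \<le> \<delta>"
        using m m0 \<delta> by (simp add: field_simps)
      have h: "hessenberg N C (I k) M"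
        using hess sub unfolding hessenberg_def by (meson continuous_on_subset subset_eq)
      have s: "solves N (I k) M Y"
        using sol sub unfolding solves_def by (meson has_field_derivative_subset subset_eq)
      have n: "\<exists>i<N. \<exists>t\<in>I k. Y i t \<noteq> 0"
      proof -
        have "real k * T / m \<in> I k" using lt by (simp add: I_def)
        then show ?thesis using nz sub by blast
      qed
      \<comment> \<open>The short-interval bound speaks of finite sets of zeros. A uniform bound on
        all finite subsets makes the whole zero set finite.\<close>
      have "card S < N" if "finite S" "S \<subseteq> {t\<in>I k. Y 0 t = 0}" for S
        using few[OF lt len, of M Y S] h s n that unfolding I_def by blast
      then show ?thesis
        using finite_if_finite_subsets_card_bdd[of "{t\<in>I k. Y 0 t = 0}" N] by (meson less_imp_le)
    qed
    have sub: "{t\<in>{0..T}. Y 0 t = 0} \<subseteq> (\<Union>k<m. {t\<in>I k. Y 0 t = 0})" using cover by blast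
    have fin: "finite (\<Union>k<m. {t\<in>I k. Y 0 t = 0})" using piece by simp
    have "card (\<Union>k<m. {t\<in>I k. Y 0 t = 0}) \<le> (\<Sum>k<m. card {t\<in>I k. Y 0 t = 0})"
      by (rule card_UN_le) simp
    also have "\<dots> \<le> m * N" using sum_bounded_above[of "{..<m}" "\<lambda>k. card {t\<in>I k. Y 0 t = 0}" N] piece by simp
    finally show ?thesis
      using card_mono[OF fin sub] finite_subset[OF sub fin] by linarith
  qed
  then show ?thesis by blast
qed

section \<open>The adjoint equations of the chain as a Hessenberg system\<close>

definition adjoint_chain ::
  "nat \<Rightarrow> real set \<Rightarrow> (nat \<Rightarrow> real \<Rightarrow> real) \<Rightarrow> (nat \<Rightarrow> real \<Rightarrow> real) \<Rightarrow> (nat \<Rightarrow> real \<Rightarrow> real) \<Rightarrow> bool" where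
  "adjoint_chain n S a \<eta> \<xi> \<longleftrightarrow> (\<forall>k\<in>{1..n}. \<forall>t\<in>S.
     (\<eta> k has_real_derivative - \<xi> k t) (at t within S) \<and>
     (\<xi> k has_real_derivative (if k < n then a k t * (\<eta> k t - \<eta> (k + 1) t) else 0)
        - (if 1 < k then a (k - 1) t * (\<eta> (k - 1) t - \<eta> k t) else 0)) (at t within S))"

text \<open>Index \<open>2 * m\<close> carries \<open>\<eta> (m + 1)\<close> and index
  \<open>2 * m + 1\<close> carries \<open>\<xi> (m + 1)\<close>. The superdiagonal then alternates
  between \<open>-1\<close> and \<open>- a (m + 1)\<close>. The bound \<open>2 * C + 1\<close>
  covers both the entry \<open>-1\<close> and the sum of two neighbouring coefficients.\<close>

lemma adjoint_chain_zeros: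
  assumes "0 \<le> C" "2 * n \<le> CARD('m::finite)" "T > 0" "n > 0"
  shows "\<exists>Z::nat. \<forall>a \<eta> \<xi>. adjoint_chain n {0..T} a \<eta> \<xi> \<and>
      (\<forall>k\<in>{1..<n}. continuous_on {0..T} (a k) \<and> (\<forall>t\<in>{0..T}. a k t \<noteq> 0 \<and> \<bar>a k t\<bar> \<le> C)) \<and>
      (\<forall>t\<in>{0..T}. \<exists>k\<in>{1..n}. \<eta> k t \<noteq> 0 \<or> \<xi> k t \<noteq> 0) \<longrightarrow>
      finite {t\<in>{0..T}. \<eta> 1 t = 0} \<and> card {t\<in>{0..T}. \<eta> 1 t = 0} \<le> Z"
proof -
  obtain Z :: nat where Z: "\<And>M Y. hessenberg (2 * n) (2 * C + 1) {0..T} M \<Longrightarrow> solves (2 * n) {0..T} M Y \<Longrightarrow>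
      (\<forall>t\<in>{0..T}. \<exists>i<2 * n. Y i t \<noteq> 0) \<Longrightarrow>
      finite {t\<in>{0..T}. Y 0 t = 0} \<and> card {t\<in>{0..T}. Y 0 t = 0} \<le> Z"
    using hessenberg_zeros_interval[of "2 * C + 1" "2 * n" T, where 'm = 'm] assms by auto
  have "finite {t\<in>{0..T}. \<eta> 1 t = 0} \<and> card {t\<in>{0..T}. \<eta> 1 t = 0} \<le> Z"
    if chain: "adjoint_chain n {0..T} a \<eta> \<xi>"
      and a: "\<And>k. 1 \<le> k \<Longrightarrow> k < n \<Longrightarrow> continuous_on {0..T} (a k)"
        "\<And>k t. 1 \<le> k \<Longrightarrow> k < n \<Longrightarrow> t \<in> {0..T} \<Longrightarrow> a k t \<noteq> 0"
        "\<And>k t. 1 \<le> k \<Longrightarrow> k < n \<Longrightarrow> t \<in> {0..T} \<Longrightarrow> \<bar>a k t\<bar> \<le> C"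
      and nz: "\<And>t. t \<in> {0..T} \<Longrightarrow> \<exists>k\<in>{1..n}. \<eta> k t \<noteq> 0 \<or> \<xi> k t \<noteq> 0" for a \<eta> \<xi>
  proof -
    \<comment> \<open>Setting the coefficients of the absent bonds \<open>0\<close> and
      \<open>n\<close> to zero lets the two ends of the chain follow the same formula as its
      interior.\<close>
    define b where "b k t = (if 1 \<le> k \<and> k < n then a k t else 0)" for k t
    define Y where "Y i = (if even i then \<eta> (i div 2 + 1) else \<xi> (i div 2 + 1))" for i
    define M where "M i j t = (let m = i div 2 in
        if even i then (if j = 2 * m + 1 then -1 else 0)
        else (if j = 2 * m + 2 then - b (m + 1) t else 0) + (if j = 2 * m then b (m + 1) t + b m t else 0)
          + (if j + 2 = 2 * m then - b m t else 0))" for i j t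
    have b_bound: "\<bar>b k t\<bar> \<le> C" if "t \<in> {0..T}" for k t
      using a(3) that assms(1) by (auto simp: b_def)
    have contb: "continuous_on {0..T} (b k)" for k
      unfolding b_def using a(1) by (cases "1 \<le> k \<and> k < n") auto
    have hess: "hessenberg (2 * n) (2 * C + 1) {0..T} M"
      unfolding hessenberg_def
    proof (intro allI impI ballI conjI)
      fix i j assume ij: "i < 2 * n" "j < 2 * n"
      show "continuous_on {0..T} (M i j)"
        unfolding M_def Let_def
        by (cases "even i"; cases "j = 2 * (i div 2) + 2"; cases "j = 2 * (i div 2)"; cases "j + 2 = 2 * (i div 2)")
           (auto intro!: continuous_intros contb)
      fix t assume t: "t \<in> {0..T}"
      show "\<bar>M i j t\<bar> \<le> 2 * C + 1"
        using b_bound[OF t, of "i div 2 + 1"] b_bound[OF t, of "i div 2"] assms(1)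
        unfolding M_def Let_def by auto
      show "M i j t = 0" if "Suc i < j"
        using that unfolding M_def Let_def by (cases "even i") (auto elim!: evenE oddE)
      show "M i j t \<noteq> 0" if "j = Suc i"
        using that ij a(2)[OF _ _ t] unfolding M_def Let_def b_def by (cases "even i") (auto elim!: evenE oddE)
    qed
    have sol: "solves (2 * n) {0..T} M Y"
      unfolding solves_def
    proof (intro allI impI ballI)
      fix i t assume i: "i < 2 * n" and t: "t \<in> {0..T}"
      define m where "m = i div 2"
      have m: "m < n" using i by (auto simp: m_def)
      have D: "(\<eta> (m + 1) has_real_derivative - \<xi> (m + 1) t) (at t within {0..T})"
        "(\<xi> (m + 1) has_real_derivative (if m + 1 < n then a (m + 1) t * (\<eta> (m + 1) t - \<eta> (m + 1 + 1) t) else 0)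
        - (if 1 < m + 1 then a (m + 1 - 1) t * (\<eta> (m + 1 - 1) t - \<eta> (m + 1) t) else 0)) (at t within {0..T})"
        using chain m t unfolding adjoint_chain_def
        by (metis Suc_eq_plus1 Suc_leI atLeastAtMost_iff le_add2)+
      show "(Y i has_real_derivative (\<Sum>j<2 * n. M i j t * Y j t)) (at t within {0..T})"
      proof (cases "even i")
        case True
        then have i2: "i = 2 * m" by (simp add: m_def)
        have "(\<Sum>j<2 * n. M i j t * Y j t) = (\<Sum>j<2 * n. if j = 2 * m + 1 then - \<xi> (m + 1) t else 0)"
          by (rule sum.cong) (auto simp: M_def Y_def i2)
        also have "\<dots> = - \<xi> (m + 1) t" using m by simp
        finally show ?thesis using D(1) by (simp add: Y_def i2)
      next
        case False
        then have i2: "i = 2 * m + 1" by (simp add: m_def)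
        have key: "even j" "Suc (j div 2) = m" if "Suc (Suc j) = 2 * m" for j
          using that by presburger+
        have "(\<Sum>j<2 * n. M i j t * Y j t) = (\<Sum>j<2 * n. (if j = 2 * m + 2 then - b (m + 1) t * \<eta> (m + 2) t else 0)
            + (if j = 2 * m then (b (m + 1) t + b m t) * \<eta> (m + 1) t else 0) + (if j + 2 = 2 * m then - b m t * \<eta> m t else 0))"
          by (rule sum.cong) (use key in \<open>auto simp: M_def Y_def i2\<close>)
        also have "\<dots> = - b (m + 1) t * \<eta> (m + 2) t + (b (m + 1) t + b m t) * \<eta> (m + 1) t - b m t * \<eta> m t"
        proof -
          have "(\<Sum>j<2 * n. if j = 2 * m + 2 then - b (m + 1) t * \<eta> (m + 2) t else 0) = - b (m + 1) t * \<eta> (m + 2) t"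
            using m by (auto simp: b_def)
          moreover have "(\<Sum>j<2 * n. if j + 2 = 2 * m then - b m t * \<eta> m t else 0) = - b m t * \<eta> m t"
          proof (cases m)
            case (Suc m')
            have "(\<Sum>j<2 * n. if j + 2 = 2 * m then - b m t * \<eta> m t else 0) = (\<Sum>j<2 * n. if j = 2 * m' then - b m t * \<eta> m t else 0)"
              by (rule sum.cong) (auto simp: Suc)
            then show ?thesis using m Suc by simp
          qed (simp add: b_def)
          ultimately show ?thesis using m by (simp add: sum.distrib)
        qed
        also have "\<dots> = (if m + 1 < n then a (m + 1) t * (\<eta> (m + 1) t - \<eta> (m + 1 + 1) t) else 0)
          - (if 1 < m + 1 then a (m + 1 - 1) t * (\<eta> (m + 1 - 1) t - \<eta> (m + 1) t) else 0)"
          using m by (auto simp: b_def algebra_simps)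
        finally show ?thesis using D(2) by (simp add: Y_def i2)
      qed
    qed
    have "\<exists>i<2 * n. Y i t \<noteq> 0" if t: "t \<in> {0..T}" for t
    proof -
      obtain k where k: "k \<in> {1..n}" "\<eta> k t \<noteq> 0 \<or> \<xi> k t \<noteq> 0" using nz[OF t] by blast
      then show ?thesis
      proof (elim disjE)
        assume "\<eta> k t \<noteq> 0"
        then show ?thesis using k(1) by (intro exI[of _ "2 * (k - 1)"]) (auto simp: Y_def)
      next
        assume "\<xi> k t \<noteq> 0"
        then show ?thesis using k(1) by (intro exI[of _ "2 * (k - 1) + 1"]) (auto simp: Y_def)
      qed
    qed
    then have "finite {t\<in>{0..T}. Y 0 t = 0} \<and> card {t\<in>{0..T}. Y 0 t = 0} \<le> Z"
      using Z[OF hess sol] by blast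
    then show ?thesis by (simp add: Y_def)
  qed
  then show ?thesis by (intro exI[of _ Z] allI impI) (elim conjE, simp)
qed

section \<open>The maximum principle for fixed initial point\<close>

lemma integrable_on_Icc_bounded:
  fixes g :: "real \<Rightarrow> 'a::euclidean_space"
  assumes "g \<in> borel_measurable (lebesgue_on {a..b})" "\<And>t. t \<in> {a..b} \<Longrightarrow> norm (g t) \<le> C"
  shows "g integrable_on {a..b}"
  by (rule measurable_bounded_by_integrable_imp_integrable[where g = "\<lambda>_. C"]) (use assms in auto)

lemma continuous_on_Icc_norm_bound:
  fixes g :: "real \<Rightarrow> 'a::real_normed_vector"
  assumes "continuous_on {a..b} g"
  obtains P where "0 \<le> P" "\<And>t. t \<in> {a..b} \<Longrightarrow> norm (g t) \<le> P"
proof -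
  obtain P where "\<forall>t\<in>{a..b}. norm (g t) \<le> P"
    using compact_imp_bounded[OF compact_continuous_image[OF assms compact_Icc]]
    by (auto simp: bounded_iff)
  then show ?thesis using that[of "max 0 P"] by (simp add: le_max_iff_disj)
qed

text \<open>The difference quotient at \<open>s\<close> is bounded by
  \<open>\<bar>K\<bar> * \<bar>t - s\<bar>\<close>, so the derivative is zero everywhere. This
  treats functions whose differentiability is not known beforehand.\<close>

lemma quadratic_increments_imp_constant:
  fixes D :: "real \<Rightarrow> real"
  assumes D: "\<And>s t. s \<in> {a..b} \<Longrightarrow> t \<in> {a..b} \<Longrightarrow> s \<le> t \<Longrightarrow> \<bar>D t - D s\<bar> \<le> K * (t - s)\<^sup>2" and ab: "a \<le> b"
  shows "D b = D a"
proof -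
  have "\<exists>c. \<forall>t\<in>{a..b}. D t = c"
  proof (rule has_field_derivative_zero_constant)
    fix s assume s: "s \<in> {a..b}"
    have D': "\<bar>D t - D s\<bar> \<le> K * (t - s)\<^sup>2" if "t \<in> {a..b}" for t
      using D[OF s that] D[OF that s] by (cases "s \<le> t") (auto simp: abs_minus_commute power2_commute)
    have "((\<lambda>t. (D t - D s) / (t - s)) \<longlongrightarrow> 0) (at s within {a..b})"
    proof (rule Lim_null_comparison)
      show "\<forall>\<^sub>F t in at s within {a..b}. norm ((D t - D s) / (t - s)) \<le> \<bar>K\<bar> * \<bar>t - s\<bar>"
        unfolding eventually_at_filter
      proof (intro always_eventually allI impI)
        fix t assume t: "t \<noteq> s" "t \<in> {a..b}"
        have "\<bar>D t - D s\<bar> \<le> \<bar>K\<bar> * (t - s)\<^sup>2"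
          using D'[OF t(2)] mult_right_mono[OF abs_ge_self[of K] zero_le_power2[of "t - s"]] by linarith
        also have "\<dots> = \<bar>K\<bar> * \<bar>t - s\<bar> * \<bar>t - s\<bar>" by (simp add: power2_eq_square mult.assoc)
        finally show "norm ((D t - D s) / (t - s)) \<le> \<bar>K\<bar> * \<bar>t - s\<bar>"
          using t by (simp add: divide_le_eq)
      qed
      have "((\<lambda>t. \<bar>K\<bar> * \<bar>t - s\<bar>) \<longlongrightarrow> \<bar>K\<bar> * \<bar>s - s\<bar>) (at s within {a..b})"
        by (intro tendsto_intros)
      then show "((\<lambda>t. \<bar>K\<bar> * \<bar>t - s\<bar>) \<longlongrightarrow> 0) (at s within {a..b})" by simp
    qed
    then show "(D has_real_derivative 0) (at s within {a..b})"
      by (simp add: has_field_derivative_iff)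
  qed simp
  then show ?thesis using ab by auto
qed

text \<open>
  Here \<open>h\<close> is only Lipschitz. The difference of the two sides, as a function of the upper end
  point, has increments of second order and is therefore constant.
\<close>

lemma integration_by_parts_indefinite:
  fixes \<psi> \<psi>' \<beta> h :: "real \<Rightarrow> 'a::euclidean_space"
  assumes T: "0 \<le> T"
    and \<psi>: "\<And>t. t \<in> {0..T} \<Longrightarrow> (\<psi> has_vector_derivative \<psi>' t) (at t within {0..T})"
    and cont\<psi>': "continuous_on {0..T} \<psi>'"
    and h: "\<And>t. t \<in> {0..T} \<Longrightarrow> (\<beta> has_integral h t) {0..t}"
    and \<beta>: "\<And>t. t \<in> {0..T} \<Longrightarrow> norm (\<beta> t) \<le> C"
  shows "((\<lambda>s. \<psi>' s \<bullet> h s + \<psi> s \<bullet> \<beta> s) has_integral (\<psi> T \<bullet> h T)) {0..T}"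
proof -
  have C: "0 \<le> C" using order_trans[OF norm_ge_zero \<beta>[of 0]] T by simp
  have cont\<psi>: "continuous_on {0..T} \<psi>"
    using \<psi> by (rule continuous_on_vector_derivative)
  obtain P where P0: "0 \<le> P" and P: "\<And>t. t \<in> {0..T} \<Longrightarrow> norm (\<psi> t) \<le> P"
    using continuous_on_Icc_norm_bound[OF cont\<psi>] by metis
  obtain Q where Q0: "0 \<le> Q" and Q: "\<And>t. t \<in> {0..T} \<Longrightarrow> norm (\<psi>' t) \<le> Q"
    using continuous_on_Icc_norm_bound[OF cont\<psi>'] by metis
  have \<beta>_int: "\<beta> integrable_on {0..T}" using h[of T] T by auto
  have \<beta>_meas: "\<beta> \<in> borel_measurable (lebesgue_on {0..T})"
    using \<beta>_int by (rule integrable_imp_measurable)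
  have h_diff: "(\<beta> has_integral (h t - h s)) {s..t}" if "s \<in> {0..T}" "t \<in> {0..T}" "s \<le> t" for s t
  proof -
    have "\<beta> integrable_on {s..t}" by (rule integrable_subinterval_real[OF \<beta>_int]) (use that in auto)
    then obtain i where i: "(\<beta> has_integral i) {s..t}" by blast
    then have "i = h t - h s"
      using has_integral_unique[OF has_integral_combine[OF _ that(3) h[OF that(1)] i] h[OF that(2)]] that
      by (simp add: eq_diff_eq add.commute)
    then show ?thesis using i by simp
  qed
  have h_lip: "norm (h t - h s) \<le> C * (t - s)" if "s \<in> {0..T}" "t \<in> {0..T}" "s \<le> t" for s t
    using has_integral_bound_real[OF C, of "{}" \<beta> "h t - h s" s t] h_diff[OF that] \<beta> that by auto
  have \<psi>_diff: "(\<psi>' has_integral (\<psi> t - \<psi> s)) {s..t}" if "s \<in> {0..T}" "t \<in> {0..T}" "s \<le> t" for s t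
    using that by (intro fundamental_theorem_of_calculus has_vector_derivative_within_subset[OF \<psi>]) auto
  have \<psi>_lip: "norm (\<psi> t - \<psi> s) \<le> Q * (t - s)" if "s \<in> {0..T}" "t \<in> {0..T}" "s \<le> t" for s t
    using has_integral_bound_real[OF Q0, of "{}" \<psi>' "\<psi> t - \<psi> s" s t] \<psi>_diff[OF that] Q that by auto
  have cont_h: "continuous_on {0..T} h"
  proof (rule continuous_on_eq)
    show "continuous_on {0..T} (\<lambda>t. integral {0..t} \<beta>)"
      using \<beta>_int by (rule indefinite_integral_continuous_1)
  qed (rule integral_unique[OF h])
  define g where "g s = \<psi>' s \<bullet> h s + \<psi> s \<bullet> \<beta> s" for s
  have int1: "(\<lambda>s. \<psi> s \<bullet> \<beta> s) integrable_on {0..T}"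
  proof (rule integrable_on_Icc_bounded)
    show "(\<lambda>s. \<psi> s \<bullet> \<beta> s) \<in> borel_measurable (lebesgue_on {0..T})"
      by (intro borel_measurable_inner \<beta>_meas continuous_imp_measurable_on_sets_lebesgue cont\<psi>) auto
    fix t assume t: "t \<in> {0..T}"
    have "norm (\<psi> t) * norm (\<beta> t) \<le> P * C"
      using P[OF t] \<beta>[OF t] P0 by (intro mult_mono) auto
    then show "norm (\<psi> t \<bullet> \<beta> t) \<le> P * C"
      using Cauchy_Schwarz_ineq2[of "\<psi> t" "\<beta> t"] by simp
  qed
  have g_int: "g integrable_on {0..T}"
    unfolding g_def by (intro integrable_add int1 integrable_continuous_interval continuous_intros cont\<psi>' cont_h)
  define D where "D t = \<psi> t \<bullet> h t - integral {0..t} g" for t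
  have "D T = D 0"
  proof (rule quadratic_increments_imp_constant[OF _ T])
    fix s t assume st: "s \<in> {0..T}" "t \<in> {0..T}" "s \<le> t"
    have gst: "(g has_integral (integral {0..t} g - integral {0..s} g)) {s..t}"
    proof -
      have i: "g integrable_on {0..t}" using integrable_subinterval_real[OF g_int, of 0 t] st by auto
      have "integral {0..s} g + integral {s..t} g = integral {0..t} g"
        by (rule Henstock_Kurzweil_Integration.integral_combine) (use st i in auto)
      moreover have "g integrable_on {s..t}" using integrable_subinterval_real[OF g_int, of s t] st by auto
      ultimately show ?thesis by (metis add_diff_cancel_left' integrable_integral)
    qed
    \<comment> \<open>The increment of \<open>\<psi> \<bullet> h\<close> is split with
      \<open>h\<close> frozen at \<open>t\<close> and \<open>\<psi>\<close> frozen at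
      \<open>s\<close>. After subtracting \<open>g\<close>, each remaining term is a bounded factor
      times an increment of \<open>h\<close> or \<open>\<psi>\<close>, so the integrand is at most
      \<open>2 * Q * C * (t - s)\<close>.\<close>
    have i1: "((\<lambda>r. \<psi>' r \<bullet> h t) has_integral ((\<psi> t - \<psi> s) \<bullet> h t)) {s..t}"
      using has_integral_linear[OF \<psi>_diff[OF st] bounded_linear_inner_left[of "h t"]] by (simp add: o_def)
    have i2: "((\<lambda>r. \<psi> s \<bullet> \<beta> r) has_integral (\<psi> s \<bullet> (h t - h s))) {s..t}"
      using has_integral_linear[OF h_diff[OF st] bounded_linear_inner_right[of "\<psi> s"]] by (simp add: o_def)
    have "((\<lambda>r. \<psi>' r \<bullet> h t + \<psi> s \<bullet> \<beta> r - g r) has_integral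
        ((\<psi> t - \<psi> s) \<bullet> h t + \<psi> s \<bullet> (h t - h s) - (integral {0..t} g - integral {0..s} g))) {s..t}"
      by (intro has_integral_diff has_integral_add i1 i2 gst)
    also have "(\<psi> t - \<psi> s) \<bullet> h t + \<psi> s \<bullet> (h t - h s) - (integral {0..t} g - integral {0..s} g) = D t - D s"
      by (simp add: D_def algebra_simps)
    finally have I: "((\<lambda>r. \<psi>' r \<bullet> h t + \<psi> s \<bullet> \<beta> r - g r) has_integral (D t - D s)) {s..t}" .
    have "norm (D t - D s) \<le> 2 * Q * C * (t - s) * measure lborel {s..t}"
    proof (rule has_integral_bound_real[OF _ _ I, of _ "{}"])
      show "norm (\<psi>' r \<bullet> h t + \<psi> s \<bullet> \<beta> r - g r) \<le> 2 * Q * C * (t - s)" if r: "r \<in> {s..t} - {}" for r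
      proof -
        have r': "r \<in> {0..T}" "s \<le> r" "r \<le> t" using r st by auto
        have "\<psi>' r \<bullet> h t + \<psi> s \<bullet> \<beta> r - g r = \<psi>' r \<bullet> (h t - h r) - (\<psi> r - \<psi> s) \<bullet> \<beta> r"
          by (simp add: g_def algebra_simps)
        also have "norm \<dots> \<le> norm (\<psi>' r) * norm (h t - h r) + norm (\<psi> r - \<psi> s) * norm (\<beta> r)"
          by (rule order_trans[OF norm_triangle_ineq4]) (intro add_mono; simp add: Cauchy_Schwarz_ineq2)
        also have "\<dots> \<le> Q * (C * (t - s)) + (Q * (t - s)) * C"
        proof (intro add_mono mult_mono)
          show "norm (h t - h r) \<le> C * (t - s)"
            by (rule order_trans[OF h_lip[OF r'(1) st(2) r'(3)]]) (use r' C in \<open>auto intro!: mult_left_mono\<close>)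
          show "norm (\<psi> r - \<psi> s) \<le> Q * (t - s)"
            by (rule order_trans[OF \<psi>_lip[OF st(1) r'(1) r'(2)]]) (use r' Q0 in \<open>auto intro!: mult_left_mono\<close>)
        qed (use Q \<beta> r' Q0 st in auto)
        finally show ?thesis by (simp add: algebra_simps)
      qed
    qed (use Q0 C st in auto)
    then show "\<bar>D t - D s\<bar> \<le> (2 * Q * C) * (t - s)\<^sup>2"
      using st by (simp add: power2_eq_square mult_ac)
  qed
  moreover have "h 0 = 0"
    using h[of 0] T has_integral_unique[OF _ has_integral_refl(2)[of \<beta> 0]] by simp
  ultimately have "integral {0..T} g = \<psi> T \<bullet> h T" by (simp add: D_def)
  then show ?thesis using g_int unfolding g_def[symmetric] by (simp add: has_integral_integral)
qed

text \<open>As \<open>0\<close> lies in \<open>S\<close>, it is separated from the interior only,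
  and the inequality passes to \<open>S\<close> through the closure. If the interior is empty,
  \<open>S\<close> lies in a hyperplane, which must contain \<open>0\<close>.\<close>

lemma convex_zero_interior_or_supported:
  fixes S :: "'a::euclidean_space set"
  assumes S: "convex S" "0 \<in> S"
  obtains r where "r > 0" "cball 0 r \<subseteq> S" | a where "a \<noteq> 0" "\<And>x. x \<in> S \<Longrightarrow> a \<bullet> x \<le> 0"
proof (cases "0 \<in> interior S")
  case True
  then show ?thesis using that(1) by (meson mem_interior_cball)
next
  case out: False
  show ?thesis
  proof (cases "interior S = {}")
    case True
    then obtain a b where ab: "a \<noteq> 0" "S \<subseteq> {x. a \<bullet> x = b}"
      using empty_interior_subset_hyperplane[OF S(1)] by metis
    then have "b = 0" using S(2) by auto
    then show ?thesis using that(2)[of a] ab by fastforce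
  next
    case False
    have "\<exists>a b. a \<noteq> 0 \<and> (\<forall>x\<in>{0}. a \<bullet> x \<le> b) \<and> (\<forall>x\<in>interior S. b \<le> a \<bullet> x)"
      by (rule separating_hyperplane_sets) (use out False S in auto)
    then obtain a b where ab: "a \<noteq> 0" "0 \<le> b" "\<And>x. x \<in> interior S \<Longrightarrow> b \<le> a \<bullet> x" by auto
    have "closure (interior S) \<subseteq> {x. 0 \<le> a \<bullet> x}"
    proof (rule closure_minimal)
      show "closed {x. 0 \<le> a \<bullet> x}" by (intro closed_Collect_le continuous_intros)
    qed (use ab in force)
    then have "S \<subseteq> {x. 0 \<le> a \<bullet> x}"
      using convex_closure_interior[OF S(1) False] closure_subset by blast
    then show ?thesis using that(2)[of "- a"] ab by auto
  qed
qed

text \<open>The point is a convex combination of \<open>x\<close>, with weight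
  \<open>1 - sum c J\<close>, and the \<open>y j\<close>. The form with differences is the one in
  which the first variation is linear in the weights.\<close>

lemma convex_perturbation:
  assumes U: "convex U" "x \<in> U" "\<And>j. j \<in> J \<Longrightarrow> y j \<in> U"
    and J: "finite J" and c: "\<And>j. j \<in> J \<Longrightarrow> 0 \<le> c j" "sum c J \<le> 1"
  shows "x + (\<Sum>j\<in>J. c j *\<^sub>R (y j - x)) \<in> U"
proof (cases "sum c J = 0")
  case True
  then have "\<And>j. j \<in> J \<Longrightarrow> c j = 0" using J c by (simp add: sum_nonneg_eq_0_iff)
  then show ?thesis using U by simp
next
  case False
  let ?s = "sum c J"
  have s: "?s > 0" using False c sum_nonneg[of J c] by fastforce
  have "(\<Sum>j\<in>J. (c j / ?s) *\<^sub>R y j) \<in> U"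
    using s c by (intro convex_sum[OF J U(1)] U(3)) (auto simp flip: sum_divide_distrib)
  then have "(1 - ?s) *\<^sub>R x + ?s *\<^sub>R (\<Sum>j\<in>J. (c j / ?s) *\<^sub>R y j) \<in> U"
    using U s c by (intro convexD) auto
  also have "(1 - ?s) *\<^sub>R x + ?s *\<^sub>R (\<Sum>j\<in>J. (c j / ?s) *\<^sub>R y j) = x + (\<Sum>j\<in>J. c j *\<^sub>R (y j - x))"
    using s by (simp add: scaleR_sum_right algebra_simps sum_subtractf scaleR_sum_left)
  finally show ?thesis .
qed

lemma primitive_continuous:
  fixes y :: "real \<Rightarrow> 'a::banach"
  assumes y: "\<And>t. t \<in> {0..T} \<Longrightarrow> (g has_integral (y t - c)) {0..t}"
  shows "continuous_on {0..T} y"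
proof (cases "0 \<le> T")
  case True
  show ?thesis
  proof (rule continuous_on_eq)
    have "g integrable_on {0..T}" using y[of T] True by auto
    then show "continuous_on {0..T} (\<lambda>t. c + integral {0..t} g)"
      by (intro continuous_intros indefinite_integral_continuous_1)
    show "c + integral {0..t} g = y t" if "t \<in> {0..T}" for t
      using integral_unique[OF y[OF that]] by simp
  qed
qed simp

text \<open>
  The map \<open>A t\<close> is the adjoint of the derivative of \<open>f\<close> at \<open>x t\<close>; the last assumption expresses this
  together with a quadratic bound on the remainder, within distance \<open>1\<close> of the trajectory.
\<close>

locale controlled_tube =
  fixes f :: "'a::euclidean_space \<Rightarrow> 'a" and B :: "'b::euclidean_space \<Rightarrow> 'a" and U :: "'b set"
    and T L M C :: real and x :: "real \<Rightarrow> 'a" and w :: "real \<Rightarrow> 'b" and A :: "real \<Rightarrow> 'a \<Rightarrow> 'a"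
  assumes T: "0 < T"
    and L: "0 \<le> L" and f_lip: "\<And>y z. norm (f y - f z) \<le> L * norm (y - z)"
    and B: "bounded_linear B"
    and U: "convex U" "bounded U"
    and w: "w \<in> borel_measurable (lebesgue_on {0..T})" "\<And>t. t \<in> {0..T} \<Longrightarrow> w t \<in> U"
    and x: "\<And>t. t \<in> {0..T} \<Longrightarrow> ((\<lambda>s. f (x s) + B (w s)) has_integral (x t - x 0)) {0..t}"
    and A: "\<And>t. linear (A t)" "continuous_on ({0..T} \<times> UNIV) (\<lambda>(t, z). A t z)"
    and M: "0 \<le> M" "\<And>t z. t \<in> {0..T} \<Longrightarrow> norm (A t z) \<le> M * norm z"
    and C: "0 \<le> C" "\<And>t y z. t \<in> {0..T} \<Longrightarrow> norm (y - x t) \<le> 1 \<Longrightarrow>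
        \<bar>z \<bullet> (f y - f (x t)) - A t z \<bullet> (y - x t)\<bar> \<le> C * norm z * (norm (y - x t))\<^sup>2"
begin

section \<open>Controls, responses and adjoint curves\<close>

definition control :: "(real \<Rightarrow> 'b) \<Rightarrow> bool" where
  "control v \<longleftrightarrow> v \<in> borel_measurable (lebesgue_on {0..T}) \<and> (\<forall>t\<in>{0..T}. v t \<in> U)"

text \<open>The common initial point \<open>x 0\<close> is built into the equation: at
  \<open>t = 0\<close> it forces \<open>y 0 = x 0\<close>.\<close>

definition response :: "(real \<Rightarrow> 'b) \<Rightarrow> (real \<Rightarrow> 'a) \<Rightarrow> bool" where
  "response v y \<longleftrightarrow> (\<forall>t\<in>{0..T}. ((\<lambda>s. f (y s) + B (v s)) has_integral (y t - x 0)) {0..t})"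

definition adjoint_solution :: "(real \<Rightarrow> 'a) \<Rightarrow> bool" where
  "adjoint_solution \<psi> \<longleftrightarrow> (\<forall>t\<in>{0..T}. (\<psi> has_vector_derivative - A t (\<psi> t)) (at t within {0..T}))"

text \<open>The first variation of \<open>\<psi> T \<bullet> y T\<close> when the control
  \<open>w\<close> is replaced by \<open>v\<close>, provided that \<open>\<psi>\<close> is an
  adjoint curve.\<close>

definition gain :: "(real \<Rightarrow> 'a) \<Rightarrow> (real \<Rightarrow> 'b) \<Rightarrow> real" where
  "gain \<psi> v = integral {0..T} (\<lambda>s. \<psi> s \<bullet> B (v s - w s))"

lemma control_w: "control w"
  using w by (simp add: control_def)

lemma response_x: "response w x"
  using x by (simp add: response_def)

lemma B_bound: obtains b where "0 \<le> b" "\<And>u. norm (B u) \<le> b * norm u"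
  using bounded_linear.nonneg_bounded[OF B] by (metis mult.commute)

lemma U_bound: obtains d where "0 \<le> d" "\<And>u. u \<in> U \<Longrightarrow> norm u \<le> d"
  using U(2) by (metis bounded_pos less_imp_le)

lemma B_measurable:
  assumes "v \<in> borel_measurable (lebesgue_on {0..T})"
  shows "(\<lambda>s. B (v s)) \<in> borel_measurable (lebesgue_on {0..T})"
proof -
  have "B \<in> borel_measurable borel"
    by (intro borel_measurable_continuous_onI linear_continuous_on B)
  from measurable_compose[OF assms this] show ?thesis .
qed

lemma B_integrable:
  assumes "control v"
  shows "(\<lambda>s. B (v s)) integrable_on {0..T}"
proof -
  obtain b where b: "0 \<le> b" "\<And>u. norm (B u) \<le> b * norm u" using B_bound by blast
  obtain d where d: "\<And>u. u \<in> U \<Longrightarrow> norm u \<le> d" using U_bound by blast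
  show ?thesis
  proof (rule integrable_on_Icc_bounded)
    show "(\<lambda>s. B (v s)) \<in> borel_measurable (lebesgue_on {0..T})"
      using assms by (intro B_measurable) (simp add: control_def)
    show "norm (B (v t)) \<le> b * d" if "t \<in> {0..T}" for t
      using b d assms that unfolding control_def by (meson mult_left_mono order_trans)
  qed
qed

lemma f_continuous: "continuous_on S f"
proof (rule continuous_on_subset[OF _ subset_UNIV], rule lipschitz_on_continuous_on)
  show "L-lipschitz_on UNIV f"
    using f_lip L by (intro lipschitz_onI) (auto simp: dist_norm)
qed

lemma response_0:
  assumes "response v y"
  shows "y 0 = x 0"
proof -
  have "((\<lambda>s. f (y s) + B (v s)) has_integral (y 0 - x 0)) {0}"
    using assms T unfolding response_def by (auto dest: bspec[of _ _ 0])
  from has_integral_unique[OF this has_integral_refl(2)] show ?thesis by simp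
qed

lemma response_continuous:
  assumes "response v y"
  shows "continuous_on {0..T} y"
proof (rule primitive_continuous)
  show "((\<lambda>s. f (y s) + B (v s)) has_integral (y t - x 0)) {0..t}" if "t \<in> {0..T}" for t
    using assms that by (simp add: response_def)
qed

lemma response_exists:
  assumes v: "control v"
  obtains y where "response v y"
proof -
  have Bi: "(\<lambda>s. B (v s)) integrable_on {0..T}" by (rule B_integrable[OF v])
  obtain y where y: "continuous_on {0..T} y"
    and yeq: "\<And>t. t \<in> {0..T} \<Longrightarrow> y t = x 0 + integral {0..t} (\<lambda>s. B (v s)) + integral {0..t} (\<lambda>s. f (y s))"
  proof (rule integral_equation_solution[of 0 T "\<lambda>t. x 0 + integral {0..t} (\<lambda>s. B (v s))" "\<lambda>_. f" L])
    show "continuous_on {0..T} (\<lambda>t. x 0 + integral {0..t} (\<lambda>s. B (v s)))"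
      by (intro continuous_intros indefinite_integral_continuous_1 Bi)
    show "continuous_on {0..T} (\<lambda>s. f (u s))" if "continuous_on {0..T} u" for u
      using continuous_on_compose2[OF f_continuous[of UNIV] that] by auto
  qed (use T L f_lip in auto)
  have "response v y"
    unfolding response_def
  proof
    fix t assume t: "t \<in> {0..T}"
    have "(\<lambda>s. f (y s)) integrable_on {0..t}"
      by (rule integrable_continuous_interval, rule continuous_on_compose2[OF f_continuous[of UNIV]])
         (use t in \<open>auto intro: continuous_on_subset[OF y]\<close>)
    moreover have "(\<lambda>s. B (v s)) integrable_on {0..t}"
      by (rule integrable_subinterval_real[OF Bi]) (use t in auto)
    ultimately have "((\<lambda>s. f (y s) + B (v s)) has_integral integral {0..t} (\<lambda>s. f (y s)) + integral {0..t} (\<lambda>s. B (v s))) {0..t}"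
      by (intro has_integral_add integrable_integral)
    then show "((\<lambda>s. f (y s) + B (v s)) has_integral (y t - x 0)) {0..t}"
      by (simp add: yeq[OF t] add.commute)
  qed
  then show ?thesis by (rule that)
qed

text \<open>Gronwall's inequality for the difference of two responses. The constant precedes the
  controls because it is applied to a whole family of them; \<open>\<epsilon> = 0\<close> gives
  uniqueness of responses.\<close>

lemma response_lipschitz:
  obtains K where "0 \<le> K"
    "\<And>v1 v2 y1 y2 \<epsilon> t. response v1 y1 \<Longrightarrow> response v2 y2 \<Longrightarrow> (\<And>s. s \<in> {0..T} \<Longrightarrow> norm (v1 s - v2 s) \<le> \<epsilon>) \<Longrightarrow>
       t \<in> {0..T} \<Longrightarrow> norm (y1 t - y2 t) \<le> K * \<epsilon>"
proof -
  obtain b where b: "0 \<le> b" "\<And>u. norm (B u) \<le> b * norm u" using B_bound by blast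
  show ?thesis
  proof
    show "0 \<le> T * b * exp (L * T)" using T b by simp
    fix v1 v2 y1 y2 \<epsilon> t
    assume r: "response v1 y1" "response v2 y2" and \<epsilon>: "\<And>s. s \<in> {0..T} \<Longrightarrow> norm (v1 s - v2 s) \<le> \<epsilon>" and t: "t \<in> {0..T}"
    have \<epsilon>0: "0 \<le> \<epsilon>" using order_trans[OF norm_ge_zero \<epsilon>[OF t]] .
    have cont: "continuous_on {0..T} (\<lambda>t. norm (y1 t - y2 t))"
      by (intro continuous_intros response_continuous[OF r(1)] response_continuous[OF r(2)])
    have "norm (y1 t - y2 t) \<le> T * (b * \<epsilon>) * exp (L * (t - 0))"
    proof (rule gronwall[OF cont _ L t])
      fix s assume s: "s \<in> {0..T}"
      have "((\<lambda>s. (f (y1 s) + B (v1 s)) - (f (y2 s) + B (v2 s))) has_integral ((y1 s - x 0) - (y2 s - x 0))) {0..s}"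
        using r s unfolding response_def by (intro has_integral_diff) auto
      then have I: "((\<lambda>s. (f (y1 s) + B (v1 s)) - (f (y2 s) + B (v2 s))) has_integral (y1 s - y2 s)) {0..s}"
        by simp
      have J: "(\<lambda>s. norm (y1 s - y2 s)) integrable_on {0..s}"
        by (rule integrable_continuous_interval, rule continuous_on_subset[OF cont]) (use s in auto)
      have "norm (y1 s - y2 s) \<le> integral {0..s} (\<lambda>r. L * norm (y1 r - y2 r) + b * \<epsilon>)"
        unfolding integral_unique[OF I, symmetric]
      proof (rule integral_norm_bound_integral)
        fix r assume "r \<in> {0..s}"
        then have r: "r \<in> {0..T}" using s by auto
        have "(f (y1 r) + B (v1 r)) - (f (y2 r) + B (v2 r)) = (f (y1 r) - f (y2 r)) + B (v1 r - v2 r)"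
          by (simp add: bounded_linear.linear[OF B] linear_diff)
        also have "norm \<dots> \<le> L * norm (y1 r - y2 r) + b * norm (v1 r - v2 r)"
          by (rule order_trans[OF norm_triangle_ineq add_mono[OF f_lip b(2)]])
        also have "\<dots> \<le> L * norm (y1 r - y2 r) + b * \<epsilon>"
          using \<epsilon>[OF r] b(1) by (intro add_left_mono mult_left_mono)
        finally show "norm ((f (y1 r) + B (v1 r)) - (f (y2 r) + B (v2 r))) \<le> L * norm (y1 r - y2 r) + b * \<epsilon>" .
      qed (use I integrable_on_mult_right[OF J, of L] in \<open>auto intro!: integrable_add\<close>)
      also have "\<dots> = L * integral {0..s} (\<lambda>r. norm (y1 r - y2 r)) + s * (b * \<epsilon>)"
        using s J integrable_on_mult_right[OF J, of L] by (subst integral_add) auto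
      also have "\<dots> \<le> T * (b * \<epsilon>) + L * integral {0..s} (\<lambda>r. norm (y1 r - y2 r))"
        using s b \<epsilon>0 by (auto intro!: mult_right_mono)
      finally show "norm (y1 s - y2 s) \<le> T * (b * \<epsilon>) + L * integral {0..s} (\<lambda>r. norm (y1 r - y2 r))" .
    qed
    also have "\<dots> \<le> T * (b * \<epsilon>) * exp (L * T)"
      using t T b \<epsilon>0 L by (auto intro!: mult_left_mono)
    finally show "norm (y1 t - y2 t) \<le> T * b * exp (L * T) * \<epsilon>" by (simp add: mult_ac)
  qed
qed

lemma A_continuous:
  assumes "continuous_on S g" "continuous_on S h" "g ` S \<subseteq> {0..T}"
  shows "continuous_on S (\<lambda>s. A (g s) (h s))"
proof -
  have "continuous_on S (\<lambda>s. (\<lambda>(t, z). A t z) (g s, h s))"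
    by (rule continuous_on_compose2[OF A(2)]) (use assms in \<open>auto intro!: continuous_intros\<close>)
  then show ?thesis by simp
qed

text \<open>The value is prescribed at the right end, so the equation is solved in the reversed time
  \<open>T - t\<close>.\<close>

lemma adjoint_solution_exists:
  obtains \<psi> where "adjoint_solution \<psi>" "\<psi> T = l"
proof -
  obtain \<zeta> where \<zeta>: "continuous_on {0..T} \<zeta>"
    and \<zeta>eq: "\<And>r. r \<in> {0..T} \<Longrightarrow> \<zeta> r = l + integral {0..r} (\<lambda>s. A (T - s) (\<zeta> s))"
  proof (rule integral_equation_solution[of 0 T "\<lambda>_. l" "\<lambda>s. A (T - s)" M])
    show "continuous_on {0..T} (\<lambda>s. A (T - s) (u s))" if "continuous_on {0..T} u" for u
      by (rule A_continuous) (use that in \<open>auto intro!: continuous_intros\<close>)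
    show "norm (A (T - s) y - A (T - s) z) \<le> M * norm (y - z)" if "s \<in> {0..T}" for s y z
      using M(2)[of "T - s" "y - z"] that by (simp add: linear_diff[OF A(1)])
  qed (use T M in auto)
  have contA: "continuous_on {0..T} (\<lambda>s. A (T - s) (\<zeta> s))"
    by (rule A_continuous) (use \<zeta> in \<open>auto intro!: continuous_intros\<close>)
  have D: "(\<zeta> has_vector_derivative A (T - r) (\<zeta> r)) (at r within {0..T})" if r: "r \<in> {0..T}" for r
  proof -
    have "((\<lambda>r. l + integral {0..r} (\<lambda>s. A (T - s) (\<zeta> s))) has_vector_derivative A (T - r) (\<zeta> r)) (at r within {0..T})"
      using integral_has_vector_derivative[OF contA r] by (auto intro!: derivative_eq_intros)
    then show ?thesis
      by (rule has_vector_derivative_transform[rotated 2]) (use r \<zeta>eq in auto)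
  qed
  show ?thesis
  proof
    show "adjoint_solution (\<lambda>t. \<zeta> (T - t))"
      unfolding adjoint_solution_def
    proof
      fix t assume t: "t \<in> {0..T}"
      have img: "(\<lambda>t. T - t) ` {0..T} \<subseteq> {0..T}" by auto
      have d: "(\<zeta> has_vector_derivative A (T - (T - t)) (\<zeta> (T - t))) (at (T - t) within (\<lambda>t. T - t) ` {0..T})"
        by (rule has_vector_derivative_within_subset[OF D img]) (use t in auto)
      have e: "((\<lambda>t. T - t) has_vector_derivative -1) (at t within {0..T})"
        by (auto intro!: derivative_eq_intros)
      show "((\<lambda>t. \<zeta> (T - t)) has_vector_derivative - A t (\<zeta> (T - t))) (at t within {0..T})"
        using vector_diff_chain_within[OF e d] by (simp add: o_def)
    qed
    show "\<zeta> (T - T) = l" using \<zeta>eq[of 0] T by simp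
  qed
qed

lemma adjoint_continuous:
  assumes "adjoint_solution \<psi>"
  shows "continuous_on {0..T} \<psi>"
proof (rule continuous_on_vector_derivative)
  show "(\<psi> has_vector_derivative - A t (\<psi> t)) (at t within {0..T})" if "t \<in> {0..T}" for t
    using assms that by (simp add: adjoint_solution_def)
qed

text \<open>A zero at time \<open>s\<close> would persist up to \<open>T\<close> by Gronwall's
  inequality with constant \<open>0\<close>. This provides the nontriviality at every time that the
  zero count asks for.\<close>

lemma adjoint_nonzero:
  assumes \<psi>: "adjoint_solution \<psi>" and nz: "\<psi> T \<noteq> 0" and s: "s \<in> {0..T}"
  shows "\<psi> s \<noteq> 0"
proof
  assume 0: "\<psi> s = 0"
  have cont: "continuous_on {s..T} (\<lambda>t. norm (\<psi> t))"
    by (intro continuous_on_norm continuous_on_subset[OF adjoint_continuous[OF \<psi>]]) (use s in auto)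
  have "norm (\<psi> T) \<le> 0 * exp (M * (T - s))"
  proof (rule gronwall[OF cont _ M(1)])
    fix t assume t: "t \<in> {s..T}"
    have "((\<lambda>r. - A r (\<psi> r)) has_integral (\<psi> t - \<psi> s)) {s..t}"
    proof (rule fundamental_theorem_of_calculus)
      fix r assume "r \<in> {s..t}"
      then have "(\<psi> has_vector_derivative - A r (\<psi> r)) (at r within {0..T})"
        using \<psi> s t unfolding adjoint_solution_def by auto
      then show "(\<psi> has_vector_derivative - A r (\<psi> r)) (at r within {s..t})"
        by (rule has_vector_derivative_within_subset) (use s t in auto)
    qed (use t in simp)
    then have I: "((\<lambda>r. - A r (\<psi> r)) has_integral \<psi> t) {s..t}" by (simp add: 0)
    have J: "(\<lambda>r. norm (\<psi> r)) integrable_on {s..t}"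
      by (rule integrable_continuous_interval, rule continuous_on_subset[OF cont]) (use t in auto)
    have "norm (\<psi> t) \<le> integral {s..t} (\<lambda>r. M * norm (\<psi> r))"
      unfolding integral_unique[OF I, symmetric]
      by (rule integral_norm_bound_integral)
         (use I M s t integrable_on_mult_right[OF J, of M] in auto)
    then show "norm (\<psi> t) \<le> 0 + M * integral {s..t} (\<lambda>r. norm (\<psi> r))" by simp
  qed (use s in auto)
  with nz show False by simp
qed

lemma gain_integrable:
  assumes \<psi>: "adjoint_solution \<psi>" and v: "control v"
  shows "(\<lambda>s. \<psi> s \<bullet> B (v s - w s)) integrable_on {0..T}"
proof -
  obtain P where P: "0 \<le> P" "\<And>t. t \<in> {0..T} \<Longrightarrow> norm (\<psi> t) \<le> P"
    using continuous_on_Icc_norm_bound[OF adjoint_continuous[OF \<psi>]] by metis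
  obtain b where b: "0 \<le> b" "\<And>u. norm (B u) \<le> b * norm u" using B_bound by blast
  obtain d where d: "\<And>u. u \<in> U \<Longrightarrow> norm u \<le> d" using U_bound by blast
  show ?thesis
  proof (rule integrable_on_Icc_bounded)
    have "(\<lambda>s. v s - w s) \<in> borel_measurable (lebesgue_on {0..T})"
      using v w(1) unfolding control_def by (intro borel_measurable_diff) auto
    then have "(\<lambda>s. B (v s - w s)) \<in> borel_measurable (lebesgue_on {0..T})"
      by (rule B_measurable)
    moreover have "\<psi> \<in> borel_measurable (lebesgue_on {0..T})"
      using adjoint_continuous[OF \<psi>] by (rule continuous_imp_measurable_on_sets_lebesgue) simp
    ultimately show "(\<lambda>s. \<psi> s \<bullet> B (v s - w s)) \<in> borel_measurable (lebesgue_on {0..T})"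
      by (intro borel_measurable_inner)
    fix t assume t: "t \<in> {0..T}"
    have "norm (v t - w t) \<le> d + d"
      using d v w t unfolding control_def by (meson add_mono norm_triangle_ineq4 order_trans)
    then have "norm (B (v t - w t)) \<le> b * (d + d)"
      using b by (meson mult_left_mono order_trans)
    then have "norm (\<psi> t) * norm (B (v t - w t)) \<le> P * (b * (d + d))"
      using P t by (intro mult_mono) auto
    then show "norm (\<psi> t \<bullet> B (v t - w t)) \<le> P * (b * (d + d))"
      using Cauchy_Schwarz_ineq2[of "\<psi> t" "B (v t - w t)"] by simp
  qed
qed

text \<open>When \<open>\<psi> \<bullet> (y - x)\<close> is integrated by parts, the adjoint
  equation cancels the linear part of \<open>f y - f x\<close>. What is left is the gain and a
  remainder quadratic in the distance of the two responses.\<close>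

lemma gain_expansion:
  assumes \<psi>: "adjoint_solution \<psi>" and P: "\<And>t. t \<in> {0..T} \<Longrightarrow> norm (\<psi> t) \<le> P"
    and v: "control v" and y: "response v y"
    and near: "\<And>t. t \<in> {0..T} \<Longrightarrow> norm (y t - x t) \<le> r" and r: "r \<le> 1"
  shows "\<bar>\<psi> T \<bullet> (y T - x T) - gain \<psi> v\<bar> \<le> C * P * r\<^sup>2 * T"
proof -
  have r0: "0 \<le> r" using order_trans[OF norm_ge_zero near[of 0]] T by simp
  have P0: "0 \<le> P" using order_trans[OF norm_ge_zero P[of 0]] T by simp
  obtain b where b: "0 \<le> b" "\<And>u. norm (B u) \<le> b * norm u" using B_bound by blast
  obtain d where d: "\<And>u. u \<in> U \<Longrightarrow> norm u \<le> d" using U_bound by blast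
  have contx: "continuous_on {0..T} x" and conty: "continuous_on {0..T} y"
    using response_continuous[OF response_x] response_continuous[OF y] by simp_all
  have linB: "B (p - q) = B p - B q" for p q
    by (simp add: bounded_linear.linear[OF B] linear_diff)
  have contfy: "continuous_on {0..T} (\<lambda>s. f (y s))" and contfx: "continuous_on {0..T} (\<lambda>s. f (x s))"
    using continuous_on_compose2[OF f_continuous[of UNIV] conty] continuous_on_compose2[OF f_continuous[of UNIV] contx]
    by simp_all
  have contA: "continuous_on {0..T} (\<lambda>s. A s (\<psi> s))"
    by (rule A_continuous) (use adjoint_continuous[OF \<psi>] in \<open>auto intro!: continuous_intros\<close>)
  have parts: "((\<lambda>s. - A s (\<psi> s) \<bullet> (y s - x s) + \<psi> s \<bullet> (f (y s) - f (x s) + B (v s - w s))) has_integral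
      (\<psi> T \<bullet> (y T - x T))) {0..T}"
  proof (rule integration_by_parts_indefinite)
    show "((\<lambda>s. f (y s) - f (x s) + B (v s - w s)) has_integral (y t - x t)) {0..t}" if "t \<in> {0..T}" for t
    proof -
      have "((\<lambda>s. (f (y s) + B (v s)) - (f (x s) + B (w s))) has_integral ((y t - x 0) - (x t - x 0))) {0..t}"
        using y response_x that unfolding response_def by (intro has_integral_diff) auto
      then show ?thesis by (simp add: linB algebra_simps)
    qed
    show "norm (f (y t) - f (x t) + B (v t - w t)) \<le> L * r + b * (d + d)" if t: "t \<in> {0..T}" for t
    proof (rule order_trans[OF norm_triangle_ineq add_mono])
      show "norm (f (y t) - f (x t)) \<le> L * r"
        using f_lip near[OF t] L by (meson mult_left_mono order_trans)
      have "norm (v t - w t) \<le> d + d"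
        using d v w t unfolding control_def by (meson add_mono norm_triangle_ineq4 order_trans)
      then show "norm (B (v t - w t)) \<le> b * (d + d)"
        using b by (meson mult_left_mono order_trans)
    qed
  qed (use T \<psi> contA in \<open>auto simp: adjoint_solution_def intro!: continuous_intros\<close>)
  have "((\<lambda>s. - A s (\<psi> s) \<bullet> (y s - x s) + \<psi> s \<bullet> (f (y s) - f (x s) + B (v s - w s)) - \<psi> s \<bullet> B (v s - w s)) has_integral
      (\<psi> T \<bullet> (y T - x T) - gain \<psi> v)) {0..T}"
    unfolding gain_def
    by (intro has_integral_diff parts integrable_integral gain_integrable \<psi> v)
  then have I: "((\<lambda>s. \<psi> s \<bullet> (f (y s) - f (x s)) - A s (\<psi> s) \<bullet> (y s - x s)) has_integral
      (\<psi> T \<bullet> (y T - x T) - gain \<psi> v)) {0..T}"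
    by (simp add: algebra_simps)
  have "norm (\<psi> T \<bullet> (y T - x T) - gain \<psi> v) \<le> C * P * r\<^sup>2 * measure lborel {0..T}"
  proof (rule has_integral_bound_real[OF _ _ I, of _ "{}"])
    fix t assume "t \<in> {0..T} - {}"
    then have t: "t \<in> {0..T}" by simp
    have "\<bar>\<psi> t \<bullet> (f (y t) - f (x t)) - A t (\<psi> t) \<bullet> (y t - x t)\<bar> \<le> C * norm (\<psi> t) * (norm (y t - x t))\<^sup>2"
      using near[OF t] r by (intro C t) auto
    also have "\<dots> \<le> C * P * r\<^sup>2"
      using C P[OF t] P0 near[OF t] by (intro mult_mono power_mono mult_nonneg_nonneg) auto
    finally show "norm (\<psi> t \<bullet> (f (y t) - f (x t)) - A t (\<psi> t) \<bullet> (y t - x t)) \<le> C * P * r\<^sup>2" by simp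
  qed (use C P0 in auto)
  then show ?thesis using T by simp
qed

text \<open>
  To first order a control \<open>v\<close> moves the end point by \<open>V v\<close>, whose coordinates are the gains along the
  adjoint curves ending at the basis vectors. If \<open>0\<close> were interior to the convex set of all \<open>V v\<close>,
  there would be controls \<open>W z\<close>, depending continuously on small \<open>z\<close>, with \<open>V (W z) = z\<close>, and
  Brouwer's theorem would produce one that reaches \<open>x T\<close> already at some time \<open>T' < T\<close>.
\<close>

theorem maximum_principle:
  assumes optimal: "\<And>T' v y. 0 \<le> T' \<Longrightarrow> T' < T \<Longrightarrow> control v \<Longrightarrow> response v y \<Longrightarrow>
      (\<And>t. t \<in> {0..T} \<Longrightarrow> norm (y t - x t) \<le> 1) \<Longrightarrow> y T' \<noteq> x T"
  obtains \<psi> where "adjoint_solution \<psi>" "\<psi> T \<noteq> 0" "\<And>v. control v \<Longrightarrow> gain \<psi> v \<le> 0"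
proof -
  have "\<forall>i. \<exists>\<psi>. adjoint_solution \<psi> \<and> \<psi> T = i"
    using adjoint_solution_exists by metis
  then obtain \<Psi> where \<Psi>: "\<And>i. adjoint_solution (\<Psi> i)" "\<And>i. \<Psi> i T = i"
    by metis
  define V where "V v = (\<Sum>i\<in>Basis. gain (\<Psi> i) v *\<^sub>R i)" for v
  have gain_comb: "gain \<psi> v = (\<Sum>j\<in>J. c j * gain \<psi> (u j))"
    if \<psi>: "adjoint_solution \<psi>" and J: "finite J" and u: "\<And>j. j \<in> J \<Longrightarrow> control (u j)"
      and v: "\<And>t. v t = w t + (\<Sum>j\<in>J. c j *\<^sub>R (u j t - w t))" for \<psi> J u v and c :: "real \<times> 'a \<Rightarrow> real"
  proof -
    have "B (v s - w s) = (\<Sum>j\<in>J. c j *\<^sub>R B (u j s - w s))" for s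
      using bounded_linear.linear[OF B] by (simp add: v linear_sum linear_cmul)
    then have "gain \<psi> v = integral {0..T} (\<lambda>s. \<Sum>j\<in>J. c j * (\<psi> s \<bullet> B (u j s - w s)))"
      by (simp add: gain_def inner_sum_right)
    also have "\<dots> = (\<Sum>j\<in>J. c j * gain \<psi> (u j))"
      unfolding gain_def
      by (subst integral_sum) (use J u gain_integrable[OF \<psi>] in \<open>auto intro!: integrable_on_mult_right\<close>)
    finally show ?thesis .
  qed
  have V_comb: "V v = (\<Sum>j\<in>J. c j *\<^sub>R V (u j))"
    if "finite J" "\<And>j. j \<in> J \<Longrightarrow> control (u j)" "\<And>t. v t = w t + (\<Sum>j\<in>J. c j *\<^sub>R (u j t - w t))"
    for J u v and c :: "real \<times> 'a \<Rightarrow> real"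
  proof -
    have "gain (\<Psi> i) v = (\<Sum>j\<in>J. c j * gain (\<Psi> i) (u j))" for i
      by (rule gain_comb[OF \<Psi>(1)]) (use that in auto)
    then have "V v = (\<Sum>i\<in>Basis. \<Sum>j\<in>J. c j *\<^sub>R gain (\<Psi> i) (u j) *\<^sub>R i)"
      by (simp add: V_def scaleR_sum_left)
    also have "\<dots> = (\<Sum>j\<in>J. c j *\<^sub>R V (u j))"
      unfolding V_def scaleR_sum_right by (rule sum.swap)
    finally show ?thesis .
  qed
  have control_comb: "control (\<lambda>t. w t + (\<Sum>j\<in>J. c j *\<^sub>R (u j t - w t)))"
    if "finite J" "\<And>j. j \<in> J \<Longrightarrow> control (u j)" "\<And>j. j \<in> J \<Longrightarrow> 0 \<le> c j" "sum c J \<le> 1"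
    for J u and c :: "real \<times> 'a \<Rightarrow> real"
    unfolding control_def
  proof
    show "(\<lambda>t. w t + (\<Sum>j\<in>J. c j *\<^sub>R (u j t - w t))) \<in> borel_measurable (lebesgue_on {0..T})"
      using that(2) w(1) unfolding control_def
      by (intro borel_measurable_add borel_measurable_sum borel_measurable_scaleR borel_measurable_diff) auto
    show "\<forall>t\<in>{0..T}. w t + (\<Sum>j\<in>J. c j *\<^sub>R (u j t - w t)) \<in> U"
      using that w(2) U(1) unfolding control_def by (intro ballI convex_perturbation) auto
  qed
  have "convex (V ` {v. control v})"
  proof (rule convexI)
    fix p q and \<alpha> \<beta> :: real
    assume "p \<in> V ` {v. control v}" "q \<in> V ` {v. control v}" and ab: "0 \<le> \<alpha>" "0 \<le> \<beta>" "\<alpha> + \<beta> = 1"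
    then obtain v1 v2 where v: "control v1" "p = V v1" "control v2" "q = V v2" by blast
    \<comment> \<open>Since \<open>\<alpha> + \<beta> = 1\<close>, the combination of
      \<open>v1\<close> and \<open>v2\<close> is also a perturbation of \<open>w\<close> with two
      indices; the pairs \<open>(0, 0)\<close> and \<open>(1, 0)\<close> are arbitrary labels for
      them.\<close>
    define c :: "real \<times> 'a \<Rightarrow> real" where "c j = (if fst j = 0 then \<alpha> else \<beta>)" for j
    define u :: "real \<times> 'a \<Rightarrow> real \<Rightarrow> 'b" where "u j = (if fst j = 0 then v1 else v2)" for j
    let ?J = "{(0, 0), (1, 0)} :: (real \<times> 'a) set"
    let ?v = "\<lambda>t. w t + (\<Sum>j\<in>?J. c j *\<^sub>R (u j t - w t))"
    have "control ?v"
      by (rule control_comb) (use v ab in \<open>auto simp: c_def u_def\<close>)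
    have "V ?v = (\<Sum>j\<in>?J. c j *\<^sub>R V (u j))"
      by (rule V_comb) (use v in \<open>auto simp: u_def\<close>)
    then have "V ?v = \<alpha> *\<^sub>R p + \<beta> *\<^sub>R q"
      by (simp add: c_def u_def v)
    then show "\<alpha> *\<^sub>R p + \<beta> *\<^sub>R q \<in> V ` {v. control v}"
      using \<open>control ?v\<close> by (intro image_eqI[of _ V ?v]) simp_all
  qed
  moreover have "0 \<in> V ` {v. control v}"
  proof (rule image_eqI)
    show "0 = V w" by (simp add: V_def gain_def linear_0[OF bounded_linear.linear[OF B]])
  qed (use control_w in simp)
  ultimately consider r where "r > 0" "cball 0 r \<subseteq> V ` {v. control v}"
    | a where "a \<noteq> 0" "\<And>p. p \<in> V ` {v. control v} \<Longrightarrow> a \<bullet> p \<le> 0"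
    using convex_zero_interior_or_supported by metis
  then show ?thesis
  proof cases
    case 2
    \<comment> \<open>By linearity this is the adjoint curve ending at the supporting vector
      \<open>a\<close>, and its gain is \<open>a \<bullet> V v\<close>.\<close>
    define \<psi> where "\<psi> t = (\<Sum>i\<in>Basis. (a \<bullet> i) *\<^sub>R \<Psi> i t)" for t
    have "adjoint_solution \<psi>"
      unfolding adjoint_solution_def
    proof
      fix t assume t: "t \<in> {0..T}"
      have "(\<psi> has_vector_derivative (\<Sum>i\<in>Basis. (a \<bullet> i) *\<^sub>R (- A t (\<Psi> i t)))) (at t within {0..T})"
        unfolding \<psi>_def using \<Psi>(1) t unfolding adjoint_solution_def
        by (intro has_vector_derivative_sum bounded_linear.has_vector_derivative[OF bounded_linear_scaleR_right]) auto
      also have "(\<Sum>i\<in>Basis. (a \<bullet> i) *\<^sub>R (- A t (\<Psi> i t))) = - A t (\<psi> t)"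
        unfolding \<psi>_def by (simp add: linear_sum[OF A(1)] linear_cmul[OF A(1)] sum_negf)
      finally show "(\<psi> has_vector_derivative - A t (\<psi> t)) (at t within {0..T})" .
    qed
    moreover have "\<psi> T \<noteq> 0"
      using 2(1) by (simp add: \<psi>_def \<Psi>(2) euclidean_representation)
    moreover have "gain \<psi> v \<le> 0" if v: "control v" for v
    proof -
      have "gain \<psi> v = integral {0..T} (\<lambda>s. \<Sum>i\<in>Basis. (a \<bullet> i) * (\<Psi> i s \<bullet> B (v s - w s)))"
        by (simp add: gain_def \<psi>_def inner_sum_left)
      also have "\<dots> = (\<Sum>i\<in>Basis. (a \<bullet> i) * gain (\<Psi> i) v)"
        unfolding gain_def
        by (subst integral_sum) (use gain_integrable[OF \<Psi>(1) v] in \<open>auto intro!: integrable_on_mult_right\<close>)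
      also have "\<dots> = a \<bullet> V v"
        by (simp add: V_def inner_sum_right mult.commute)
      finally show ?thesis using 2(2)[of "V v"] v by simp
    qed
    ultimately show ?thesis by (rule that)
  next
    case 1
    \<comment> \<open>Perturbation weights must be nonnegative. Hence every basis vector occurs with
      both signs, and the weights \<open>c z j\<close> are the positive and negative parts of the
      coordinates of \<open>z\<close>, scaled by \<open>1 / r\<close>.\<close>
    define J where "J = {1, -1::real} \<times> (Basis :: 'a set)"
    have J: "finite J" by (simp add: J_def)
    have "\<exists>v. control v \<and> V v = r *\<^sub>R (fst j *\<^sub>R snd j)" if "j \<in> J" for j
    proof -
      have "r *\<^sub>R (fst j *\<^sub>R snd j) \<in> cball 0 r" using that 1(1) by (auto simp: J_def)
      with 1(2) have "r *\<^sub>R (fst j *\<^sub>R snd j) \<in> V ` {v. control v}" by (rule subsetD)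
      then show ?thesis by (elim imageE) (intro exI conjI, simp_all)
    qed
    then obtain u where u: "\<And>j. j \<in> J \<Longrightarrow> control (u j)" "\<And>j. j \<in> J \<Longrightarrow> V (u j) = r *\<^sub>R (fst j *\<^sub>R snd j)"
      by metis
    define c where "c z j = max 0 (fst j * (z \<bullet> snd j)) / r" for z :: 'a and j
    define W where "W z t = w t + (\<Sum>j\<in>J. c z j *\<^sub>R (u j t - w t))" for z t
    have VW: "V (W z) = z" for z
    proof -
      have "V (W z) = (\<Sum>j\<in>J. c z j *\<^sub>R V (u j))"
        by (rule V_comb[OF J u(1)]) (simp_all add: W_def)
      also have "\<dots> = (\<Sum>j\<in>J. (max 0 (fst j * (z \<bullet> snd j)) * fst j) *\<^sub>R snd j)"
        using 1(1) by (intro sum.cong) (auto simp: u(2) c_def)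
      also have "\<dots> = (\<Sum>s\<in>{1, -1}. \<Sum>i\<in>Basis. (max 0 (s * (z \<bullet> i)) * s) *\<^sub>R i)"
        unfolding J_def by (subst sum.cartesian_product) (simp add: case_prod_beta)
      also have "\<dots> = (\<Sum>i\<in>Basis. (max 0 (z \<bullet> i) - max 0 (- (z \<bullet> i))) *\<^sub>R i)"
        by (simp add: scaleR_diff_left sum_subtractf sum_negf)
      also have "\<dots> = (\<Sum>i\<in>Basis. (z \<bullet> i) *\<^sub>R i)"
        by (intro sum.cong) (auto simp: max_def)
      finally show ?thesis by (simp add: euclidean_representation)
    qed
    have c_lip: "\<bar>c z j - c z' j\<bar> \<le> norm (z - z') / r" if "j \<in> J" for z z' j
    proof -
      have "\<bar>max 0 (fst j * (z \<bullet> snd j)) - max 0 (fst j * (z' \<bullet> snd j))\<bar> \<le> \<bar>fst j * (z \<bullet> snd j) - fst j * (z' \<bullet> snd j)\<bar>"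
        by (auto simp: max_def abs_if)
      also have "\<dots> = \<bar>(z - z') \<bullet> snd j\<bar>"
        using that by (auto simp: J_def inner_diff_left abs_minus_commute)
      also have "\<dots> \<le> norm (z - z')"
        using that by (auto simp: J_def intro: Basis_le_norm)
      finally show ?thesis
        using 1(1) by (simp add: c_def divide_right_mono flip: diff_divide_distrib)
    qed
    obtain d where d: "0 \<le> d" "\<And>p. p \<in> U \<Longrightarrow> norm p \<le> d" using U_bound by blast
    define K1 where "K1 = card J * ((1 / r) * (d + d))"
    have K1: "0 \<le> K1" using d 1(1) by (simp add: K1_def)
    have W_lip: "norm (W z t - W z' t) \<le> K1 * norm (z - z')" if t: "t \<in> {0..T}" for z z' t
    proof -
      have "W z t - W z' t = (\<Sum>j\<in>J. (c z j - c z' j) *\<^sub>R (u j t - w t))"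
        by (simp add: W_def scaleR_diff_left sum_subtractf)
      also have "norm \<dots> \<le> (\<Sum>j\<in>J. norm (z - z') / r * (d + d))"
      proof (rule order_trans[OF norm_sum], rule sum_mono)
        fix j assume j: "j \<in> J"
        have "norm (u j t - w t) \<le> d + d"
          using d(2)[of "u j t"] d(2)[of "w t"] u(1)[OF j] w(2)[OF t] t norm_triangle_ineq4[of "u j t" "w t"]
          unfolding control_def by fastforce
        then show "norm ((c z j - c z' j) *\<^sub>R (u j t - w t)) \<le> norm (z - z') / r * (d + d)"
          unfolding norm_scaleR using c_lip[OF j, of z z'] 1(1) by (intro mult_mono) (auto simp: real_norm_def)
      qed
      also have "\<dots> = K1 * norm (z - z')" by (simp add: K1_def)
      finally show ?thesis .
    qed
    have W0: "W 0 = w" by (simp add: W_def c_def fun_eq_iff)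
    \<comment> \<open>Each of the \<open>card J\<close> weights is at most
      \<open>\<rho>0 / r\<close>, so their sum does not exceed \<open>1\<close>.\<close>
    define \<rho>0 where "\<rho>0 = r / (card J + 1)"
    have \<rho>0: "\<rho>0 > 0" using 1(1) by (auto simp: \<rho>0_def intro!: divide_pos_pos add_nonneg_pos)
    have W_control: "control (W z)" if "norm z \<le> \<rho>0" for z
      unfolding W_def
    proof (rule control_comb[OF J u(1)])
      have "sum (c z) J \<le> (\<Sum>j\<in>J. \<rho>0 / r)"
      proof (rule sum_mono)
        fix j assume "j \<in> J"
        from c_lip[OF this, of z 0] show "c z j \<le> \<rho>0 / r"
          using that 1(1) divide_right_mono[of "norm z" \<rho>0 r] by (auto simp: c_def abs_if split: if_splits)
      qed
      also have "\<dots> \<le> 1" using 1(1) by (simp add: \<rho>0_def)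
      finally show "sum (c z) J \<le> 1" .
    qed (use 1(1) in \<open>auto simp: c_def\<close>)
    \<comment> \<open>An arbitrary choice suffices: the Lipschitz estimate for responses makes
      \<open>Y z t\<close> continuous in \<open>z\<close> whichever response is chosen.\<close>
    define Y where "Y z = (SOME y. response (W z) y)" for z
    have Y: "response (W z) (Y z)" if z: "norm z \<le> \<rho>0" for z
    proof -
      obtain y where "response (W z) y" using response_exists[OF W_control[OF z]] .
      then show ?thesis unfolding Y_def by (rule someI[where P = "response (W z)"])
    qed
    obtain K where K: "0 \<le> K" "\<And>v1 v2 y1 y2 \<epsilon> t. response v1 y1 \<Longrightarrow> response v2 y2 \<Longrightarrow>
        (\<And>s. s \<in> {0..T} \<Longrightarrow> norm (v1 s - v2 s) \<le> \<epsilon>) \<Longrightarrow> t \<in> {0..T} \<Longrightarrow> norm (y1 t - y2 t) \<le> K * \<epsilon>"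
      using response_lipschitz by blast
    define K2 where "K2 = K * K1"
    have K2: "0 \<le> K2" using K K1 by (simp add: K2_def)
    have Y_lip: "norm (Y z t - Y z' t) \<le> K2 * norm (z - z')" if "norm z \<le> \<rho>0" "norm z' \<le> \<rho>0" "t \<in> {0..T}" for z z' t
      using K(2)[OF Y[OF that(1)] Y[OF that(2)] W_lip that(3)] by (simp add: K2_def mult.assoc)
    have Y_near: "norm (Y z t - x t) \<le> K2 * norm z" if "norm z \<le> \<rho>0" "t \<in> {0..T}" for z t
      using K(2)[OF Y[OF that(1)] response_x _ that(2), of "K1 * norm z"] W_lip[of _ z 0] by (simp add: K2_def mult.assoc W0)
    have "\<exists>P. 0 \<le> P \<and> (\<forall>i\<in>Basis. \<forall>t\<in>{0..T}. norm (\<Psi> i t) \<le> P)"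
    proof -
      have "\<forall>i. \<exists>P. 0 \<le> P \<and> (\<forall>t\<in>{0..T}. norm (\<Psi> i t) \<le> P)"
        using continuous_on_Icc_norm_bound[OF adjoint_continuous[OF \<Psi>(1)]] by metis
      then obtain Q where Q: "\<And>i. 0 \<le> Q i" "\<And>i t. t \<in> {0..T} \<Longrightarrow> norm (\<Psi> i t) \<le> Q i" by metis
      have "norm (\<Psi> i t) \<le> sum Q Basis" if i: "i \<in> Basis" and t: "t \<in> {0..T}" for i t
        using Q(2)[OF t, of i] member_le_sum[OF i, of Q] Q(1) by force
      then show ?thesis
        using sum_nonneg[of Basis Q] Q(1) by (intro exI[of _ "sum Q Basis"]) simp
    qed
    then obtain P where P: "0 \<le> P" "\<And>i t. i \<in> Basis \<Longrightarrow> t \<in> {0..T} \<Longrightarrow> norm (\<Psi> i t) \<le> P" by blast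
    \<comment> \<open>The expansion is applied to each adjoint curve \<open>\<Psi> i\<close>, that
      is, coordinatewise; \<open>DIM('a)\<close> comes from summing the coordinates.\<close>
    define K3 where "K3 = DIM('a) * (C * P * K2\<^sup>2 * T)"
    have K3: "0 \<le> K3" using C P T by (simp add: K3_def)
    have expand: "norm (Y z T - x T - z) \<le> K3 * (norm z)\<^sup>2" if z: "norm z \<le> \<rho>0" "K2 * norm z \<le> 1" for z
    proof -
      have "\<bar>(Y z T - x T - z) \<bullet> i\<bar> \<le> C * P * (K2 * norm z)\<^sup>2 * T" if i: "i \<in> Basis" for i
      proof -
        have "gain (\<Psi> i) (W z) = z \<bullet> i"
          using arg_cong[OF VW[of z], of "\<lambda>p. p \<bullet> i"] i by (simp add: V_def inner_sum_left_Basis)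
        with gain_expansion[OF \<Psi>(1) P(2)[OF i] W_control[OF z(1)] Y[OF z(1)] Y_near[OF z(1)] z(2)]
        show ?thesis by (simp add: \<Psi>(2) inner_commute inner_diff_right inner_diff_left)
      qed
      then have "(\<Sum>i\<in>Basis. \<bar>(Y z T - x T - z) \<bullet> i\<bar>) \<le> DIM('a) * (C * P * (K2 * norm z)\<^sup>2 * T)"
        by (rule sum_bounded_above)
      with norm_le_l1[of "Y z T - x T - z"] show ?thesis
        by (simp add: K3_def power_mult_distrib mult_ac)
    qed
    obtain b where b: "0 \<le> b" "\<And>p. norm (B p) \<le> b * norm p" using B_bound by blast
    obtain F where F: "0 \<le> F" "\<And>t. t \<in> {0..T} \<Longrightarrow> norm (f (x t)) \<le> F"
      using continuous_on_Icc_norm_bound[OF continuous_on_compose2[OF f_continuous[of UNIV] response_continuous[OF response_x]]] by auto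
    \<comment> \<open>A bound for the speed of \<open>Y z\<close>: \<open>F\<close> on the reference
      trajectory, \<open>L\<close> for moving away from it by at most \<open>1\<close>, and
      \<open>b * d\<close> for the control term.\<close>
    define K4 where "K4 = F + L + b * d"
    have K4: "0 \<le> K4" using F L b d by (simp add: K4_def)
    have speed: "norm (Y z T - Y z T') \<le> K4 * (T - T')"
      if z: "norm z \<le> \<rho>0" "K2 * norm z \<le> 1" and T': "T' \<in> {0..T}" for z T'
    proof -
      have h: "((\<lambda>s. f (Y z s) + B (W z s)) has_integral (Y z t - x 0)) {0..t}" if "t \<in> {0..T}" for t
        using Y[OF z(1)] that unfolding response_def by blast
      have "(\<lambda>s. f (Y z s) + B (W z s)) integrable_on {T'..T}"
        by (rule integrable_subinterval_real[OF has_integral_integrable[OF h[of T]]]) (use T T' in auto)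
      then obtain i where i: "((\<lambda>s. f (Y z s) + B (W z s)) has_integral i) {T'..T}" by blast
      have "i = Y z T - Y z T'"
        using has_integral_unique[OF has_integral_combine[OF _ _ h[OF T'] i] h[of T]] T' T by (simp add: algebra_simps)
      have "norm i \<le> K4 * measure lborel {T'..T}"
      proof (rule has_integral_bound_real[OF K4 _ i, of "{}"])
        fix t assume "t \<in> {T'..T} - {}"
        then have t: "t \<in> {0..T}" using T' by auto
        have "norm (f (Y z t)) \<le> norm (f (x t)) + norm (f (Y z t) - f (x t))"
          by (rule norm_triangle_sub)
        also have "\<dots> \<le> F + L * 1"
          using Y_near[OF z(1) t] z(2) L
          by (intro add_mono F t order_trans[OF f_lip] mult_left_mono) auto
        finally have "norm (f (Y z t)) \<le> F + L" by simp
        moreover have "norm (B (W z t)) \<le> b * d"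
          using W_control[OF z(1)] t b d(2) unfolding control_def by (meson mult_left_mono order_trans)
        ultimately show "norm (f (Y z t) + B (W z t)) \<le> K4"
          unfolding K4_def by (intro order_trans[OF norm_triangle_ineq] add_mono)
      qed simp
      then show ?thesis using T' \<open>i = _\<close> by simp
    qed
    \<comment> \<open>The three terms keep \<open>W z\<close> a control, keep its response within
      distance \<open>1\<close> of \<open>x\<close>, and bound the quadratic error by
      \<open>\<rho> / 2\<close>. The choice of \<open>T'\<close> below leaves the other
      \<open>\<rho> / 2\<close> for the error of stopping early.\<close>
    define \<rho> where "\<rho> = min \<rho>0 (min (1 / (K2 + 1)) (1 / (2 * (K3 + 1))))"
    have \<rho>: "\<rho> > 0" "\<rho> \<le> \<rho>0" "K2 * \<rho> \<le> 1" "K3 * \<rho> \<le> 1/2"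
    proof -
      show "\<rho> > 0" using \<rho>0 K2 K3 by (simp add: \<rho>_def)
      show "\<rho> \<le> \<rho>0" by (simp add: \<rho>_def)
      have "K2 * \<rho> \<le> K2 * (1 / (K2 + 1))" using K2 by (intro mult_left_mono) (auto simp: \<rho>_def)
      also have "\<dots> \<le> 1" using K2 by (simp add: field_simps)
      finally show "K2 * \<rho> \<le> 1" .
      have "K3 * \<rho> \<le> K3 * (1 / (2 * (K3 + 1)))" using K3 by (intro mult_left_mono) (auto simp: \<rho>_def)
      also have "\<dots> \<le> 1/2" using K3 by (simp add: field_simps)
      finally show "K3 * \<rho> \<le> 1/2" .
    qed
    define T' where "T' = T - min T (\<rho> / (2 * (K4 + 1)))"
    have T'1: "0 \<le> T'" "T' < T" using T \<rho>(1) K4 by (auto simp: T'_def)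
    have T'2: "K4 * (T - T') \<le> \<rho> / 2"
    proof -
      have "K4 * (T - T') \<le> K4 * (\<rho> / (2 * (K4 + 1)))" using K4 by (intro mult_left_mono) (auto simp: T'_def)
      also have "\<dots> \<le> \<rho> / 2" using K4 \<rho>(1) by (simp add: field_simps)
      finally show ?thesis .
    qed
    have small: "norm z \<le> \<rho>0" "K2 * norm z \<le> 1" if "norm z \<le> \<rho>" for z :: 'a
      using that \<rho> mult_left_mono[OF that K2] by auto
    \<comment> \<open>A fixed point of this map is exactly a \<open>z\<close> with
      \<open>Y z T' = x T\<close>. The map is a sum of the two errors just bounded, because
      \<open>Y z T\<close> equals \<open>x T + z\<close> up to second order.\<close>
    obtain z where z: "z \<in> cball 0 \<rho>" "z - (Y z T' - x T) = z"
    proof (rule brouwer_ball[of \<rho> "0::'a" "\<lambda>z. z - (Y z T' - x T)"])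
      have "continuous_on (cball 0 \<rho>) (\<lambda>z. Y z T')"
      proof (rule lipschitz_on_continuous_on)
        show "K2-lipschitz_on (cball 0 \<rho>) (\<lambda>z. Y z T')"
          using Y_lip small T'1 K2 by (intro lipschitz_onI) (auto simp: dist_norm)
      qed
      then show "continuous_on (cball 0 \<rho>) (\<lambda>z. z - (Y z T' - x T))"
        by (intro continuous_intros)
      have "norm (z - (Y z T' - x T)) \<le> \<rho>" if "norm z \<le> \<rho>" for z
      proof -
        have "z - (Y z T' - x T) = (Y z T - Y z T') - (Y z T - x T - z)" by simp
        also have "norm \<dots> \<le> K4 * (T - T') + K3 * (norm z)\<^sup>2"
          using T'1 by (intro order_trans[OF norm_triangle_ineq4] add_mono speed expand small[OF that]) auto
        also have "K3 * (norm z)\<^sup>2 \<le> K3 * \<rho>\<^sup>2"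
          using that K3 by (intro mult_left_mono power_mono) auto
        also have "K3 * \<rho>\<^sup>2 \<le> \<rho> / 2"
          using mult_right_mono[OF \<rho>(4), of \<rho>] \<rho>(1) by (simp add: power2_eq_square)
        finally show ?thesis using T'2 by linarith
      qed
      then show "(\<lambda>z. z - (Y z T' - x T)) \<in> cball 0 \<rho> \<rightarrow> cball 0 \<rho>" by auto
    qed (use \<rho> that in auto)
    have "Y z T' \<noteq> x T"
    proof (rule optimal[OF T'1])
      have nz: "norm z \<le> \<rho>" using z by simp
      show "control (W z)" "response (W z) (Y z)" using W_control Y small[OF nz] by blast+
      show "norm (Y z t - x t) \<le> 1" if "t \<in> {0..T}" for t
        using Y_near[OF small(1)[OF nz] that] small(2)[OF nz] by linarith
    qed
    then show ?thesis using z by simp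
  qed
qed

end

section \<open>Bang-bang controls and the particle chain\<close>

text \<open>Induction on the number of points of \<open>Z\<close> inside \<open>{0<..<T}\<close>,
  with \<open>T\<close> varying: the interval is cut at the last such point.\<close>

lemma piecewise_vertex_approx:
  assumes Z: "finite Z" and T: "0 < T"
    and const: "\<And>a b. 0 \<le> a \<Longrightarrow> a < b \<Longrightarrow> b \<le> T \<Longrightarrow> {a<..<b} \<inter> Z = {} \<Longrightarrow> \<exists>c\<in>vertices \<omega>. \<forall>t\<in>{a<..<b}. w t = c"
  shows "\<exists>w' m. m \<le> card (Z \<inter> {0<..<T}) \<and> piecewise_vertex \<omega> T m w' \<and> finite {t\<in>{0..T}. w' t \<noteq> w t}"
  using T const
proof (induction "card (Z \<inter> {0<..<T})" arbitrary: T rule: less_induct)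
  case less
  show ?case
  proof (cases "Z \<inter> {0<..<T} = {}")
    case True
    then obtain c where c: "c \<in> vertices \<omega>" "\<forall>t\<in>{0<..<T}. w t = c"
      using less.prems(2)[of 0 T] less.prems(1) by (auto simp: Int_commute)
    have "piecewise_vertex \<omega> T 0 (\<lambda>_. c)"
      unfolding piecewise_vertex_def
      by (intro exI[of _ "\<lambda>i. if i = 0 then 0 else T"] exI[of _ "\<lambda>_. c"]) (use c less.prems in auto)
    moreover have "finite {t\<in>{0..T}. c \<noteq> w t}"
      by (rule finite_subset[of _ "{0, T}"]) (use c in force)+
    ultimately show ?thesis by (intro exI[of _ "\<lambda>_. c"] exI[of _ 0]) simp
  next
    case False
    define z where "z = Max (Z \<inter> {0<..<T})"
    have fin: "finite (Z \<inter> {0<..<T})" using Z by simp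
    have z: "z \<in> Z" "0 < z" "z < T" using Max_in[OF fin False] by (auto simp: z_def)
    have empty: "{z<..<T} \<inter> Z = {}"
    proof -
      have "t \<le> z" if "t \<in> Z" "z < t" "t < T" for t
        unfolding z_def by (rule Max_ge[OF fin]) (use that z in auto)
      then show ?thesis by force
    qed
    have less_card: "card (Z \<inter> {0<..<z}) < card (Z \<inter> {0<..<T})"
      by (rule psubset_card_mono[OF fin]) (use z in auto)
    obtain w1 m1 where IH: "m1 \<le> card (Z \<inter> {0<..<z})" "piecewise_vertex \<omega> z m1 w1" "finite {t\<in>{0..z}. w1 t \<noteq> w t}"
      using less.hyps[OF less_card z(2)] less.prems(2) z by (meson less_imp_le order_trans)
    obtain c where c: "c \<in> vertices \<omega>" "\<forall>t\<in>{z<..<T}. w t = c"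
      using less.prems(2)[OF _ z(3) _ empty] z by auto
    obtain \<tau> cc where \<tau>: "\<tau> 0 = 0" "\<tau> (Suc m1) = z" "\<And>i. i \<le> m1 \<Longrightarrow> \<tau> i < \<tau> (Suc i)"
      and cc: "\<And>i. i \<le> m1 \<Longrightarrow> cc i \<in> vertices \<omega>" "\<And>i. i < m1 \<Longrightarrow> cc i \<noteq> cc (Suc i)"
      and w1: "\<And>i t. i \<le> m1 \<Longrightarrow> t \<in> {\<tau> i..<\<tau> (Suc i)} \<Longrightarrow> w1 t = cc i"
      using IH(2) unfolding piecewise_vertex_def by metis
    have \<tau>z: "\<tau> (Suc i) \<le> z" if "i \<le> m1" for i
      using that
    proof (induction rule: inc_induct)
      case (step i)
      then show ?case using \<tau>(3)[of "Suc i"] by simp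
    qed (simp add: \<tau>)
    \<comment> \<open>Pieces are closed on the left, so the value at \<open>z\<close> belongs to the
      last one. There and at \<open>T\<close> it may differ from \<open>w\<close>, whence the finite
      exceptional set.\<close>
    define w' where "w' t = (if t < z then w1 t else c)" for t
    have "finite {t\<in>{0..T}. w' t \<noteq> w t}"
    proof (rule finite_subset)
      show "{t\<in>{0..T}. w' t \<noteq> w t} \<subseteq> {t\<in>{0..z}. w1 t \<noteq> w t} \<union> {z, T}"
      proof
        fix t assume t: "t \<in> {t\<in>{0..T}. w' t \<noteq> w t}"
        then show "t \<in> {t\<in>{0..z}. w1 t \<noteq> w t} \<union> {z, T}"
          using c(2) by (cases "t < z") (auto simp: w'_def)
      qed
    qed (use IH(3) in simp)
    moreover have "\<exists>m\<le>Suc m1. piecewise_vertex \<omega> T m w'"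
    proof (cases "c = cc m1")
      \<comment> \<open>Consecutive values of a piecewise constant control must differ. If the value
        does not change at \<open>z\<close>, the last piece is prolonged instead of adding a
        switching.\<close>
      case True
      have "piecewise_vertex \<omega> T m1 w'"
        unfolding piecewise_vertex_def
      proof (intro exI[of _ "\<tau>(Suc m1 := T)"] exI[of _ cc] conjI allI impI ballI)
        show "(\<tau>(Suc m1 := T)) i < (\<tau>(Suc m1 := T)) (Suc i)" if "i \<le> m1" for i
          using that \<tau>(2) \<tau>(3)[of i] z by (cases "i = m1") auto
        show "w' t = cc i" if "i \<le> m1" "t \<in> {(\<tau>(Suc m1 := T)) i..<(\<tau>(Suc m1 := T)) (Suc i)}" for i t
          using that w1[of i t] \<tau>z[of i] \<tau>(2) True by (cases "i = m1") (auto simp: w'_def)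
        show "w' T = cc m1" using z True by (simp add: w'_def)
      qed (use \<tau> cc in auto)
      then show ?thesis by (intro exI[of _ m1]) simp
    next
      case False
      have "piecewise_vertex \<omega> T (Suc m1) w'"
        unfolding piecewise_vertex_def
      proof (intro exI[of _ "\<tau>(Suc (Suc m1) := T)"] exI[of _ "cc(Suc m1 := c)"] conjI allI impI ballI)
        show "(\<tau>(Suc (Suc m1) := T)) i < (\<tau>(Suc (Suc m1) := T)) (Suc i)" if "i \<le> Suc m1" for i
          using that \<tau>(2) \<tau>(3)[of i] z by (cases "i = Suc m1") auto
        show "w' t = (cc(Suc m1 := c)) i"
          if "i \<le> Suc m1" "t \<in> {(\<tau>(Suc (Suc m1) := T)) i..<(\<tau>(Suc (Suc m1) := T)) (Suc i)}" for i t
          using that w1[of i t] \<tau>z[of i] \<tau>(2) by (cases "i = Suc m1") (auto simp: w'_def)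
        show "(cc(Suc m1 := c)) i \<noteq> (cc(Suc m1 := c)) (Suc i)" if "i < Suc m1" for i
          using that cc(2)[of i] False by (cases "i = m1") auto
      qed (use \<tau> cc c z in \<open>auto simp: w'_def\<close>)
      then show ?thesis by blast
    qed
    moreover have "Suc m1 \<le> card (Z \<inter> {0<..<T})" using IH(1) less_card by simp
    ultimately show ?thesis by (meson order_trans)
  qed
qed

text \<open>Reflection sends particle \<open>k\<close> to \<open>n + 1 - k\<close>, but bond
  \<open>k\<close>, which joins \<open>k\<close> and \<open>k + 1\<close>, to \<open>n - k\<close>.
  The two force terms are exchanged and both change sign, so their difference is preserved.\<close>

lemma adjoint_chain_reverse:
  assumes "adjoint_chain n S a \<eta> \<xi>"
  shows "adjoint_chain n S (\<lambda>k. a (n - k)) (\<lambda>k. \<eta> (n + 1 - k)) (\<lambda>k. \<xi> (n + 1 - k))"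
  unfolding adjoint_chain_def
proof (intro ballI conjI)
  fix k t assume k: "k \<in> {1..n}" and t: "t \<in> S"
  define k' where "k' = n + 1 - k"
  have k': "k' \<in> {1..n}" using k by (auto simp: k'_def)
  have D: "(\<eta> k' has_real_derivative - \<xi> k' t) (at t within S)"
    "(\<xi> k' has_real_derivative (if k' < n then a k' t * (\<eta> k' t - \<eta> (k' + 1) t) else 0)
        - (if 1 < k' then a (k' - 1) t * (\<eta> (k' - 1) t - \<eta> k' t) else 0)) (at t within S)"
    using assms k' t unfolding adjoint_chain_def by blast+
  show "(\<eta> (n + 1 - k) has_real_derivative - \<xi> (n + 1 - k) t) (at t within S)"
    using D(1) by (simp add: k'_def)
  have 1: "(if k < n then a (n - k) t * (\<eta> (n + 1 - k) t - \<eta> (n + 1 - (k + 1)) t) else 0)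
      = - (if 1 < k' then a (k' - 1) t * (\<eta> (k' - 1) t - \<eta> k' t) else 0)"
    using k by (auto simp: k'_def algebra_simps)
  have 2: "(if 1 < k then a (n - (k - 1)) t * (\<eta> (n + 1 - (k - 1)) t - \<eta> (n + 1 - k) t) else 0)
      = - (if k' < n then a k' t * (\<eta> k' t - \<eta> (k' + 1) t) else 0)"
  proof (cases "1 < k")
    case True
    then have "n - (k - 1) = k'" "n + 1 - (k - 1) = k' + 1" "k' < n" using k by (auto simp: k'_def)
    then show ?thesis using True by (simp add: k'_def[symmetric] algebra_simps)
  qed (use k in \<open>auto simp: k'_def\<close>)
  show "(\<xi> (n + 1 - k) has_real_derivative
        (if k < n then a (n - k) t * (\<eta> (n + 1 - k) t - \<eta> (n + 1 - (k + 1)) t) else 0)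
        - (if 1 < k then a (n - (k - 1)) t * (\<eta> (n + 1 - (k - 1)) t - \<eta> (n + 1 - k) t) else 0)) (at t within S)"
    unfolding 1 2 using D(2) by (simp add: k'_def)
qed

section \<open>The drift as a sum over bonds\<close>

definition bond :: "(nat \<Rightarrow> 'n::finite) \<Rightarrow> nat \<Rightarrow> real ^ 'n" where
  "bond e k = axis (e k) 1 - axis (e (k + 1)) 1"

lemma inner_bond: "q \<bullet> bond e k = q $ e k - q $ e (k + 1)"
  by (simp add: bond_def inner_diff_right inner_axis)

lemma norm_bond: "norm (bond e k) \<le> 2"
  unfolding bond_def using norm_triangle_ineq4[of "axis (e k) (1::real)" "axis (e (k + 1)) 1"] by simp

text \<open>Abel summation, which regroups forces sorted by particle into forces sorted by
  bond.\<close>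

lemma sum_by_parts:
  fixes E :: "nat \<Rightarrow> 'v::real_vector"
  assumes "2 \<le> n"
  shows "- a 1 *\<^sub>R E 1 + (\<Sum>k=2..n-1. (a (k - 1) - a k) *\<^sub>R E k) + a (n - 1) *\<^sub>R E n
    = - (\<Sum>k=1..n-1. a k *\<^sub>R (E k - E (k + 1)))"
  using assms
proof (induction n rule: nat_induct_at_least)
  case base
  show ?case by (simp add: numeral_2_eq_2 algebra_simps)
next
  case (Suc n)
  then obtain m where m: "n = Suc m" "1 \<le> m" by (cases n) auto
  then show ?case using Suc by (simp add: algebra_simps)
qed

text \<open>In this form each bond contributes one function of \<open>q \<bullet> bond e k\<close>
  in the direction \<open>bond e k\<close>. The linearised force is therefore symmetric, and all
  estimates reduce to one real variable.\<close>

lemma drift_eq_bonds: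
  fixes e :: "nat \<Rightarrow> 'n::finite"
  assumes n: "2 \<le> CARD('n)" and e: "bij_betw e {1..CARD('n)} UNIV"
  shows "drift e \<phi> (q, p) = (p, - (\<Sum>k=1..CARD('n)-1. \<phi> (q \<bullet> bond e k) *\<^sub>R bond e k))"
proof -
  let ?n = "CARD('n)"
  have "(\<Sum>k=1..?n. (p $ e k) *\<^sub>R axis (e k) (1::real)) = (\<Sum>j\<in>UNIV. (p $ j) *\<^sub>R axis j 1)"
    by (rule sum.reindex_bij_betw[OF e])
  also have "\<dots> = p"
    by (simp add: vec_eq_iff sum_component axis_def if_distrib[of "\<lambda>x. _ * x"] cong: if_cong)
  finally have 1: "(\<Sum>k=1..?n. (p $ e k) *\<^sub>R dq e k) = (p, 0)"
    by (simp add: dq_def sum_prod)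
  have 2: "- \<phi> (q $ e 1 - q $ e 2) *\<^sub>R dp e 1
      + (\<Sum>k=2..?n-1. (\<phi> (q $ e (k-1) - q $ e k) - \<phi> (q $ e k - q $ e (k+1))) *\<^sub>R dp e k)
      + \<phi> (q $ e (?n-1) - q $ e ?n) *\<^sub>R dp e ?n
    = - (\<Sum>k=1..?n-1. \<phi> (q \<bullet> bond e k) *\<^sub>R (dp e k - dp e (k + 1)))"
  proof -
    let ?a = "\<lambda>k. \<phi> (q $ e k - q $ e (k + 1))"
    have "(\<Sum>k=2..?n-1. (\<phi> (q $ e (k-1) - q $ e k) - ?a k) *\<^sub>R dp e k)
        = (\<Sum>k=2..?n-1. (?a (k - 1) - ?a k) *\<^sub>R dp e k)"
      by (rule sum.cong) auto
    moreover have "\<phi> (q $ e (?n-1) - q $ e ?n) = ?a (?n - 1)" "\<phi> (q $ e 1 - q $ e 2) = ?a 1"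
      using n by (simp_all add: numeral_2_eq_2)
    ultimately show ?thesis
      using sum_by_parts[OF n, of ?a "dp e"] by (simp only: inner_bond scaleR_minus_left)
  qed
  have 3: "(\<Sum>k=1..?n-1. \<phi> (q \<bullet> bond e k) *\<^sub>R (dp e k - dp e (k + 1)))
      = (0, \<Sum>k=1..?n-1. \<phi> (q \<bullet> bond e k) *\<^sub>R bond e k)"
    by (simp add: dp_def bond_def sum_prod)
  have "drift e \<phi> (q, p) = (p, 0) + - (0, \<Sum>k=1..?n-1. \<phi> (q \<bullet> bond e k) *\<^sub>R bond e k)"
    unfolding drift_def Let_def case_prod_conv 1 3[symmetric] 2[symmetric]
    by (simp only: scaleR_minus_left add.assoc diff_conv_add_uminus)
  then show ?thesis by simp
qed

section \<open>From the integrated maximum condition to bang-bang controls\<close>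

lemma AE_not_in_finite:
  assumes "finite F"
  shows "AE t in lebesgue_on {a..b::real}. t \<notin> F"
proof -
  have "AE t in lborel. t \<notin> F"
    by (rule AE_not_in[OF finite_imp_null_set_lborel[OF assms]])
  then have "AE t in lebesgue. t \<notin> F" by (rule AE_completion)
  then have "AE t in lebesgue. t \<in> {a..b} \<longrightarrow> t \<notin> F" by eventually_elim simp
  then show ?thesis by (subst AE_restrict_space_iff) simp_all
qed

text \<open>Applied to the gain of the pointwise maximiser, whose integrand is nonnegative while the
  maximum principle makes its integral nonpositive.\<close>

lemma integral_nonpos_imp_AE_zero:
  fixes g :: "real \<Rightarrow> real"
  assumes g: "g integrable_on {a..b}" "\<And>t. t \<in> {a..b} \<Longrightarrow> 0 \<le> g t" "integral {a..b} g \<le> 0"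
  shows "AE t in lebesgue_on {a..b}. g t = 0"
proof -
  have "g absolutely_integrable_on {a..b}"
    using g by (intro nonnegative_absolutely_integrable_1) auto
  then have i: "integrable (lebesgue_on {a..b}) g"
    by (rule absolutely_integrable_imp_integrable) simp
  have "integral {a..b} g = 0"
    using g(3) integral_nonneg[OF g(1,2)] by simp
  then have "integral\<^sup>L (lebesgue_on {a..b}) g = 0"
    using lebesgue_integral_eq_integral[OF i] by simp
  moreover have "AE t in lebesgue_on {a..b}. 0 \<le> g t"
    using g(2) by (intro AE_I2) simp
  ultimately show ?thesis
    using integral_nonneg_eq_0_iff_AE[OF i] by simp
qed

text \<open>A pointwise maximiser of \<open>g t * u + h t * v\<close> over the rectangle. The choice
  at zeros of \<open>g\<close> or \<open>h\<close> is arbitrary.\<close>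

definition bang_control :: "real \<Rightarrow> (real \<Rightarrow> real) \<Rightarrow> (real \<Rightarrow> real) \<Rightarrow> real \<Rightarrow> real \<times> real" where
  "bang_control \<omega> g h t = (if 0 < g t then \<omega> else - \<omega>, if 0 < h t then 0 else - \<omega>)"

lemma constant_sign:
  fixes g :: "real \<Rightarrow> real"
  assumes g: "continuous_on {0..T} g" and ab: "0 \<le> a" "b \<le> T" and nz: "\<And>t. t \<in> {a<..<b} \<Longrightarrow> g t \<noteq> 0"
    and st: "s \<in> {a<..<b}" "t \<in> {a<..<b}"
  shows "0 < g s \<longleftrightarrow> 0 < g t"
proof -
  have conn: "connected (g ` {a<..<b})"
    by (intro connected_continuous_image continuous_on_subset[OF g]) (use ab in auto)
  have False if "s \<in> {a<..<b}" "t \<in> {a<..<b}" "0 < g s" "\<not> 0 < g t" for s t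
  proof -
    have "0 \<in> {g t..g s}" using that by simp
    also have "\<dots> \<subseteq> g ` {a<..<b}" by (rule connected_contains_Icc[OF conn]) (use that in auto)
    finally show False using nz by force
  qed
  with st show ?thesis by blast
qed

text \<open>Between consecutive zeros of \<open>g\<close> and \<open>h\<close> both signs are
  constant, so switchings can occur only at these zeros. The zeros themselves form a null
  set.\<close>

lemma bang_control_switchings:
  assumes T: "0 < T" and g: "continuous_on {0..T} g" and h: "continuous_on {0..T} h"
    and fin: "finite {t\<in>{0..T}. g t = 0}" "finite {t\<in>{0..T}. h t = 0}"
    and w: "AE t in lebesgue_on {0..T}. g t \<noteq> 0 \<and> h t \<noteq> 0 \<longrightarrow> w t = bang_control \<omega> g h t"
    and N: "card {t\<in>{0..T}. g t = 0} + card {t\<in>{0..T}. h t = 0} \<le> N"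
  shows "bang_bang \<omega> T w \<and> at_most_switchings \<omega> T N w"
proof
  define Z where "Z = {t\<in>{0..T}. g t = 0} \<union> {t\<in>{0..T}. h t = 0}"
  let ?b = "bang_control \<omega> g h"
  have Z: "finite Z" using fin by (simp add: Z_def)
  have wb: "AE t in lebesgue_on {0..T}. w t = ?b t"
    using w AE_not_in_finite[OF Z] AE_space
    by eventually_elim (auto simp: Z_def)
  then show "bang_bang \<omega> T w"
    unfolding bang_bang_def by eventually_elim (auto simp: vertices_def bang_control_def)
  obtain w' m where w': "m \<le> card (Z \<inter> {0<..<T})" "piecewise_vertex \<omega> T m w'" "finite {t\<in>{0..T}. w' t \<noteq> ?b t}"
  proof (rule exE[OF piecewise_vertex_approx[OF Z T, of \<omega> ?b]])
    fix a b :: real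
    assume ab: "0 \<le> a" "a < b" "b \<le> T" "{a<..<b} \<inter> Z = {}"
    then have nz: "g t \<noteq> 0" "h t \<noteq> 0" if "t \<in> {a<..<b}" for t
      using that by (auto simp: Z_def disjoint_iff)
    have mid: "(a + b) / 2 \<in> {a<..<b}" using ab by auto
    show "\<exists>c\<in>vertices \<omega>. \<forall>t\<in>{a<..<b}. ?b t = c"
    proof (intro bexI[of _ "?b ((a + b) / 2)"] ballI)
      fix t assume t: "t \<in> {a<..<b}"
      show "?b t = ?b ((a + b) / 2)"
        unfolding bang_control_def
        using constant_sign[OF g ab(1,3) nz(1) t mid] constant_sign[OF h ab(1,3) nz(2) t mid] by simp
    qed (auto simp: vertices_def bang_control_def)
  qed blast
  have "AE t in lebesgue_on {0..T}. w' t = w t"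
    using wb AE_not_in_finite[OF w'(3)] AE_space
    by eventually_elim auto
  moreover have "m \<le> N"
  proof -
    have "card (Z \<inter> {0<..<T}) \<le> card Z" by (rule card_mono[OF Z]) auto
    also have "\<dots> \<le> card {t\<in>{0..T}. g t = 0} + card {t\<in>{0..T}. h t = 0}"
      unfolding Z_def by (rule card_Un_le)
    finally show ?thesis using w'(1) N by linarith
  qed
  ultimately show "at_most_switchings \<omega> T N w"
    unfolding at_most_switchings_def using w'(2) by blast
qed

text \<open>Only the bonds \<open>k - 1\<close> and \<open>k\<close> touch particle
  \<open>k\<close>. The end particles lose a term because \<open>0\<close> and \<open>n\<close> lie
  outside the range of summation.\<close>

lemma bond_chain:
  fixes e :: "nat \<Rightarrow> 'n::finite" and \<eta> :: "real ^ 'n"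
  assumes e: "bij_betw e {1..n} UNIV" and k: "k \<in> {1..n}"
  shows "(\<Sum>j=1..n-1. (a j * (\<eta> \<bullet> bond e j)) *\<^sub>R bond e j) $ e k
    = (if k < n then a k * (\<eta> $ e k - \<eta> $ e (k + 1)) else 0)
      - (if 1 < k then a (k - 1) * (\<eta> $ e (k - 1) - \<eta> $ e k) else 0)"
proof -
  have inj: "e i = e j \<longleftrightarrow> i = j" if "i \<in> {1..n}" "j \<in> {1..n}" for i j
    using inj_on_eq_iff[OF bij_betw_imp_inj_on[OF e]] that by simp
  have "(\<Sum>j=1..n-1. (a j * (\<eta> \<bullet> bond e j)) *\<^sub>R bond e j) $ e k
      = (\<Sum>j=1..n-1. (if j = k then a k * (\<eta> $ e k - \<eta> $ e (k + 1)) else 0)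
        - (if j = k - 1 then a (k - 1) * (\<eta> $ e (k - 1) - \<eta> $ e k) else 0))"
    unfolding sum_component
  proof (rule sum.cong)
    fix j assume j: "j \<in> {1..n-1}"
    have "e k = e j \<longleftrightarrow> j = k" by (subst inj) (use j k in auto)
    moreover have "e k = e (j + 1) \<longleftrightarrow> j = k - 1" by (subst inj) (use j k in auto)
    ultimately have "bond e j $ e k = (if j = k then 1 else 0) - (if j = k - 1 then 1 else 0)"
      unfolding bond_def axis_def by simp
    moreover have "k - 1 + 1 = k" using k by auto
    ultimately show "((a j * (\<eta> \<bullet> bond e j)) *\<^sub>R bond e j) $ e k
      = (if j = k then a k * (\<eta> $ e k - \<eta> $ e (k + 1)) else 0)
        - (if j = k - 1 then a (k - 1) * (\<eta> $ e (k - 1) - \<eta> $ e k) else 0)"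
      by (cases "j = k"; cases "j = k - 1") (simp_all add: inner_bond)
  qed simp
  also have "\<dots> = (if k \<in> {1..n-1} then a k * (\<eta> $ e k - \<eta> $ e (k + 1)) else 0)
      - (if k - 1 \<in> {1..n-1} then a (k - 1) * (\<eta> $ e (k - 1) - \<eta> $ e k) else 0)"
    unfolding sum_subtractf by simp
  also have "k \<in> {1..n-1} \<longleftrightarrow> k < n" using k by auto
  also have "k - 1 \<in> {1..n-1} \<longleftrightarrow> 1 < k" using k by auto
  finally show ?thesis .
qed

section \<open>Clamped forces, linearisation and extremals\<close>

lemma linear_remainder_bound:
  fixes \<phi> \<phi>' \<phi>'' :: "real \<Rightarrow> real"
  assumes \<phi>: "\<And>y. (\<phi> has_real_derivative \<phi>' y) (at y)" "\<And>y. (\<phi>' has_real_derivative \<phi>'' y) (at y)"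
    and C: "\<And>y. y \<in> {-R..R} \<Longrightarrow> \<bar>\<phi>'' y\<bar> \<le> C" and ab: "a \<in> {-R..R}" "b \<in> {-R..R}"
  shows "\<bar>\<phi> b - \<phi> a - \<phi>' a * (b - a)\<bar> \<le> C * (b - a)\<^sup>2"
proof -
  have \<phi>'_lip: "\<bar>\<phi>' c - \<phi>' a\<bar> \<le> C * \<bar>c - a\<bar>" if "c \<in> {-R..R}" for c
    using field_differentiable_bound[of "{-R..R}" \<phi>' \<phi>'' C c a] that ab \<phi>(2) C
    by (auto intro: has_field_derivative_at_within)
  have C0: "0 \<le> C" using C[OF ab(1)] by linarith
  have cl: "closed_segment a b \<subseteq> {-R..R}" using ab by (intro closed_segment_subset) auto
  have "norm ((\<phi> b - \<phi>' a * b) - (\<phi> a - \<phi>' a * a)) \<le> (C * \<bar>b - a\<bar>) * norm (b - a)"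
  proof (rule field_differentiable_bound[of "closed_segment a b" _ "\<lambda>y. \<phi>' y - \<phi>' a"])
    show "((\<lambda>y. \<phi> y - \<phi>' a * y) has_real_derivative \<phi>' y - \<phi>' a) (at y within closed_segment a b)" for y
      by (auto intro!: derivative_eq_intros has_field_derivative_at_within[OF \<phi>(1)])
    fix y assume y: "y \<in> closed_segment a b"
    have "\<bar>y - a\<bar> \<le> \<bar>b - a\<bar>" using y by (auto simp: closed_segment_eq_real_ivl split: if_splits)
    then have "C * \<bar>y - a\<bar> \<le> C * \<bar>b - a\<bar>" using C0 by (rule mult_left_mono)
    moreover have "\<bar>\<phi>' y - \<phi>' a\<bar> \<le> C * \<bar>y - a\<bar>" using y cl by (intro \<phi>'_lip) auto
    ultimately show "norm (\<phi>' y - \<phi>' a) \<le> C * \<bar>b - a\<bar>"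
      unfolding real_norm_def by (rule order_trans[rotated])
  qed auto
  also have "(C * \<bar>b - a\<bar>) * norm (b - a) = C * (b - a)\<^sup>2"
    by (simp add: power2_eq_square mult.assoc)
  also have "(\<phi> b - \<phi>' a * b) - (\<phi> a - \<phi>' a * a) = \<phi> b - \<phi> a - \<phi>' a * (b - a)"
    by (simp add: algebra_simps)
  finally show ?thesis by simp
qed

text \<open>Clamping to \<open>{-R..R}\<close> does not increase distances, so the bound on the
  derivative there becomes a global Lipschitz constant.\<close>

lemma clamped_lipschitz:
  fixes \<phi> \<phi>' :: "real \<Rightarrow> real"
  assumes \<phi>: "\<And>y. (\<phi> has_real_derivative \<phi>' y) (at y)" and C: "\<And>y. y \<in> {-R..R} \<Longrightarrow> \<bar>\<phi>' y\<bar> \<le> C" and R: "0 \<le> R"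
  shows "\<bar>\<phi> (max (-R) (min R b)) - \<phi> (max (-R) (min R a))\<bar> \<le> C * \<bar>b - a\<bar>"
proof -
  have C0: "0 \<le> C" using C[of 0] R by auto
  have "\<bar>\<phi> (max (-R) (min R b)) - \<phi> (max (-R) (min R a))\<bar> \<le> C * \<bar>max (-R) (min R b) - max (-R) (min R a)\<bar>"
    using field_differentiable_bound[of "{-R..R}" \<phi> \<phi>' C "max (-R) (min R b)" "max (-R) (min R a)"] R \<phi> C
    by (auto intro: has_field_derivative_at_within)
  also have "\<dots> \<le> C * \<bar>b - a\<bar>"
    using C0 R by (intro mult_left_mono) auto
  finally show ?thesis .
qed

text \<open>The maximum principle is applied to the clamped system. In the bound on
  \<open>x\<close>, the \<open>1\<close> is the radius of the tube and the factor \<open>2\<close>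
  bounds a bond vector, so all bond elongations in the tube stay in \<open>{-R..R}\<close>.\<close>

lemma extremal_adjoint:
  fixes e :: "nat \<Rightarrow> 'n::finite" and \<phi> \<phi>' \<phi>'' :: "real \<Rightarrow> real" and x :: "real \<Rightarrow> 'n state"
  assumes n: "2 \<le> CARD('n)" and e: "bij_betw e {1..CARD('n)} UNIV"
    and \<phi>: "\<And>y. (\<phi> has_real_derivative \<phi>' y) (at y)" "\<And>y. (\<phi>' has_real_derivative \<phi>'' y) (at y)"
    and C1: "\<And>y. y \<in> {-R..R} \<Longrightarrow> \<bar>\<phi>' y\<bar> \<le> C1" and C2: "\<And>y. y \<in> {-R..R} \<Longrightarrow> \<bar>\<phi>'' y\<bar> \<le> C2"
    and xR: "\<And>t. t \<in> {0..T} \<Longrightarrow> norm (x t) + 1 \<le> R / 2"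
    and T: "0 < T" and \<omega>: "0 < \<omega>" and opt: "time_optimal e \<phi> \<omega> T x w"
  obtains \<eta> \<xi> where "adjoint_chain CARD('n) {0..T} (\<lambda>k t. \<phi>' (fst (x t) \<bullet> bond e k)) \<eta> \<xi>"
    "\<forall>t\<in>{0..T}. \<exists>k\<in>{1..CARD('n)}. \<eta> k t \<noteq> 0 \<or> \<xi> k t \<noteq> 0"
    "AE t in lebesgue_on {0..T}. \<eta> 1 t \<noteq> 0 \<and> \<eta> CARD('n) t \<noteq> 0 \<longrightarrow>
       w t = bang_control \<omega> (\<eta> 1) (\<eta> CARD('n)) t"
proof -
  let ?n = "CARD('n)"
  let ?I = "{1..?n-1}"
  \<comment> \<open>Clamping makes the drift globally Lipschitz without changing it near the trajectory.\<close>
  define \<phi>c where "\<phi>c y = \<phi> (max (-R) (min R y))" for y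
  define f where "f = drift e \<phi>c"
  define B where "B u = fst u *\<^sub>R dp e 1 + snd u *\<^sub>R dp e ?n" for u :: "real \<times> real"
  define U where "U = {-\<omega>..\<omega>} \<times> {-\<omega>..(0::real)}"
  define a where "a k t = \<phi>' (fst (x t) \<bullet> bond e k)" for k t
  \<comment> \<open>The Jacobian of the drift maps \<open>(dq, dp)\<close> to \<open>dp\<close> and
    minus the sum of \<open>a k t * (dq \<bullet> bond e k)\<close> times \<open>bond e k\<close>.
    Its force block is symmetric, so transposition merely exchanges the roles of the two
    components.\<close>
  define A :: "real \<Rightarrow> 'n state \<Rightarrow> 'n state"
    where "A t z = (- (\<Sum>k\<in>?I. (a k t * (snd z \<bullet> bond e k)) *\<^sub>R bond e k), fst z)" for t z
  have R: "0 \<le> R" using order_trans[OF add_increasing[OF norm_ge_zero, of 0 1] xR[of 0]] T by simp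
  have C10: "0 \<le> C1" and C20: "0 \<le> C2" using order_trans[OF abs_ge_zero C1[of 0]] order_trans[OF abs_ge_zero C2[of 0]] R by auto
  have traj: "trajectory e \<phi> \<omega> T x w" using opt by (simp add: time_optimal_def)
  have f_eq: "f z = (snd z, - (\<Sum>k\<in>?I. \<phi>c (fst z \<bullet> bond e k) *\<^sub>R bond e k))" for z
    unfolding f_def using drift_eq_bonds[OF n e, of \<phi>c "fst z" "snd z"] by simp
  have drift_eq: "drift e \<phi> z = (snd z, - (\<Sum>k\<in>?I. \<phi> (fst z \<bullet> bond e k) *\<^sub>R bond e k))" for z
    using drift_eq_bonds[OF n e, of \<phi> "fst z" "snd z"] by simp
  have bond_le: "\<bar>v \<bullet> bond e k\<bar> \<le> 2 * norm v" for v :: "real ^ 'n" and k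
    using Cauchy_Schwarz_ineq2[of v "bond e k"] mult_left_mono[OF norm_bond[of e k] norm_ge_zero[of v]] by linarith
  have norm_fst: "norm (fst z) \<le> norm z" and norm_snd: "norm (snd z) \<le> norm z" for z :: "'n state"
    using norm_fst_le[of "fst z" "snd z"] norm_snd_le[of "snd z" "fst z"] by simp_all
  have in_range: "fst z \<bullet> bond e k \<in> {-R..R}" if "norm z \<le> R / 2" for z :: "'n state" and k
    using bond_le[of "fst z" k] norm_fst[of z] that by (simp add: abs_le_iff)
  have \<phi>c_eq: "\<phi>c y = \<phi> y" if "y \<in> {-R..R}" for y
    using that by (simp add: \<phi>c_def min_absorb2 max_absorb2)
  have f_drift: "f z = drift e \<phi> z" if "norm z \<le> R / 2" for z
    unfolding f_eq drift_eq using in_range[OF that] \<phi>c_eq by simp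
  have x_norm: "norm (x t) \<le> R / 2" if "t \<in> {0..T}" for t using xR[OF that] by simp
  have a_bound: "\<bar>a k t\<bar> \<le> C1" if "t \<in> {0..T}" for k t
    unfolding a_def by (intro C1 in_range x_norm that)
  \<comment> \<open>The summand \<open>1\<close> stems from \<open>q' = p\<close>. Each bond adds
    \<open>4 * C1\<close>, as its vector, of norm at most \<open>2\<close>, enters both the
    elongation and the direction of the force. The transposed Jacobian obeys the same bound.\<close>
  define L where "L = 1 + real (?n - 1) * (4 * C1)"
  have bond_sum: "norm (\<Sum>k\<in>?I. c k *\<^sub>R bond e k) \<le> real (?n - 1) * (4 * C1) * norm v"
    if "\<And>k. \<bar>c k\<bar> \<le> C1 * (2 * norm v)" for c and v :: "real ^ 'n"
  proof -
    have "norm (\<Sum>k\<in>?I. c k *\<^sub>R bond e k) \<le> (\<Sum>k\<in>?I. C1 * (2 * norm v) * 2)"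
    proof (rule order_trans[OF norm_sum], rule sum_mono)
      show "norm (c k *\<^sub>R bond e k) \<le> C1 * (2 * norm v) * 2" for k
        unfolding norm_scaleR using that C10 by (intro mult_mono norm_bond) auto
    qed
    then show ?thesis by (simp add: mult_ac)
  qed
  have x_int: "((\<lambda>s. drift e \<phi> (x s) + fst (w s) *\<^sub>R dp e 1 + snd (w s) *\<^sub>R dp e ?n) has_integral (x t - x 0)) {0..t}"
    if "t \<in> {0..T}" for t using traj that by (simp add: trajectory_def)
  have contx: "continuous_on {0..T} x" by (rule primitive_continuous[OF x_int])
  have cont_a: "continuous_on {0..T} (a k)" for k
  proof -
    have "continuous_on UNIV \<phi>'" using \<phi>(2) by (meson DERIV_isCont continuous_at_imp_continuous_on)
    then show ?thesis
      unfolding a_def by (rule continuous_on_compose2) (auto intro!: continuous_intros contx)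
  qed
  have L0: "0 \<le> L" using C10 by (simp add: L_def)
  have pair_bound: "norm (u, - s) \<le> L * r" "norm (- s, u) \<le> L * r"
    if "norm u \<le> r" "norm s \<le> real (?n - 1) * (4 * C1) * r" for u s :: "real ^ 'n" and r
  proof -
    have "L * r = r + real (?n - 1) * (4 * C1) * r" by (simp add: L_def distrib_right)
    then show "norm (u, - s) \<le> L * r" "norm (- s, u) \<le> L * r"
      using norm_Pair_le[of u "- s"] norm_Pair_le[of "- s" u] that unfolding norm_minus_cancel by linarith+
  qed
  have f_lip: "norm (f y - f z) \<le> L * norm (y - z)" for y z
  proof -
    have eq: "f y - f z = (snd (y - z), - (\<Sum>k\<in>?I. (\<phi>c (fst y \<bullet> bond e k) - \<phi>c (fst z \<bullet> bond e k)) *\<^sub>R bond e k))"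
      unfolding f_eq by (simp add: scaleR_diff_left sum_subtractf)
    have "norm (\<Sum>k\<in>?I. (\<phi>c (fst y \<bullet> bond e k) - \<phi>c (fst z \<bullet> bond e k)) *\<^sub>R bond e k)
        \<le> real (?n - 1) * (4 * C1) * norm (fst (y - z))"
    proof (rule bond_sum)
      fix k
      have "\<bar>\<phi>c (fst y \<bullet> bond e k) - \<phi>c (fst z \<bullet> bond e k)\<bar> \<le> C1 * \<bar>fst y \<bullet> bond e k - fst z \<bullet> bond e k\<bar>"
        unfolding \<phi>c_def by (rule clamped_lipschitz[OF \<phi>(1) C1 R])
      also have "\<dots> \<le> C1 * (2 * norm (fst (y - z)))"
        using bond_le[of "fst (y - z)" k] C10 by (intro mult_left_mono) (simp_all add: inner_diff_left)
      finally show "\<bar>\<phi>c (fst y \<bullet> bond e k) - \<phi>c (fst z \<bullet> bond e k)\<bar> \<le> C1 * (2 * norm (fst (y - z)))" .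
    qed
    also have "\<dots> \<le> real (?n - 1) * (4 * C1) * norm (y - z)"
      using C10 by (intro mult_left_mono norm_fst) auto
    finally show ?thesis
      unfolding eq by (intro pair_bound(1) norm_snd)
  qed
  have B_lin: "bounded_linear B"
    unfolding B_def by (intro bounded_linear_add bounded_linear_compose[OF bounded_linear_scaleR_left] bounded_linear_fst bounded_linear_snd)
  have U_props: "convex U" "bounded U"
    unfolding U_def by (auto intro!: convex_Times bounded_Times)
  have w_adm: "w \<in> borel_measurable (lebesgue_on {0..T})" "\<And>t. t \<in> {0..T} \<Longrightarrow> w t \<in> U"
    using traj by (auto simp: trajectory_def admissible_control_def U_def)
  have x_sol: "((\<lambda>s. f (x s) + B (w s)) has_integral (x t - x 0)) {0..t}" if t: "t \<in> {0..T}" for t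
  proof (rule has_integral_eq[OF _ x_int[OF t]])
    show "drift e \<phi> (x s) + fst (w s) *\<^sub>R dp e 1 + snd (w s) *\<^sub>R dp e ?n = f (x s) + B (w s)" if "s \<in> {0..t}" for s
      using f_drift[OF x_norm[of s]] that t by (simp add: B_def)
  qed
  have A_lin: "linear (A t)" for t
    by (rule linearI) (simp_all add: A_def inner_add_left algebra_simps scaleR_sum_right sum.distrib)
  have A_cont: "continuous_on ({0..T} \<times> UNIV) (\<lambda>(t, z). A t z)"
    unfolding A_def case_prod_beta
    by (intro continuous_intros continuous_on_compose2[OF cont_a]) auto
  have A_bound: "norm (A t z) \<le> L * norm z" if t: "t \<in> {0..T}" for t z
  proof -
    have "norm (\<Sum>k\<in>?I. (a k t * (snd z \<bullet> bond e k)) *\<^sub>R bond e k) \<le> real (?n - 1) * (4 * C1) * norm (snd z)"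
      unfolding abs_mult by (rule bond_sum) (use a_bound[OF t] bond_le C10 in \<open>auto simp: abs_mult intro!: mult_mono\<close>)
    also have "\<dots> \<le> real (?n - 1) * (4 * C1) * norm z"
      using C10 by (intro mult_left_mono norm_snd) auto
    finally show ?thesis
      unfolding A_def by (intro pair_bound(2) norm_fst)
  qed
  \<comment> \<open>The factor \<open>8\<close> is \<open>2 * 2 * 2\<close>: the bond vector enters
    twice through the squared elongation and once through the pairing with
    \<open>snd z\<close>.\<close>
  have C0: "0 \<le> real (?n - 1) * (8 * C2)" using C20 by simp
  have rem: "\<bar>z \<bullet> (f y - f (x t)) - A t z \<bullet> (y - x t)\<bar> \<le> real (?n - 1) * (8 * C2) * norm z * (norm (y - x t))\<^sup>2"
    if t: "t \<in> {0..T}" and near: "norm (y - x t) \<le> 1" for t y z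
  proof -
    have y_norm: "norm y \<le> R / 2"
      using norm_triangle_sub[of y "x t"] near xR[OF t] by simp
    define \<delta> where "\<delta> k = \<phi> (fst y \<bullet> bond e k) - \<phi> (fst (x t) \<bullet> bond e k) - a k t * (fst y \<bullet> bond e k - fst (x t) \<bullet> bond e k)" for k
    have \<delta>: "\<bar>\<delta> k\<bar> \<le> C2 * (4 * (norm (y - x t))\<^sup>2)" for k
    proof -
      have "\<bar>\<delta> k\<bar> \<le> C2 * (fst y \<bullet> bond e k - fst (x t) \<bullet> bond e k)\<^sup>2"
        unfolding \<delta>_def a_def by (rule linear_remainder_bound[OF \<phi> C2 in_range[OF x_norm[OF t]] in_range[OF y_norm]])
      also have "\<dots> \<le> C2 * (2 * norm (y - x t))\<^sup>2"
      proof -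
        have "\<bar>fst y \<bullet> bond e k - fst (x t) \<bullet> bond e k\<bar> \<le> 2 * norm (y - x t)"
          using bond_le[of "fst (y - x t)" k] norm_fst[of "y - x t"] by (simp add: inner_diff_left)
        from power_mono[OF this abs_ge_zero, of 2] show ?thesis
          using C20 by (intro mult_left_mono) simp_all
      qed
      finally show ?thesis by (simp add: power_mult_distrib)
    qed
    let ?d = "y - x t"
    have "f y - f (x t) = (snd ?d, - (\<Sum>k\<in>?I. (\<phi> (fst y \<bullet> bond e k) - \<phi> (fst (x t) \<bullet> bond e k)) *\<^sub>R bond e k))"
      unfolding f_drift[OF y_norm] f_drift[OF x_norm[OF t]] drift_eq by (simp add: scaleR_diff_left sum_subtractf)
    then have 1: "z \<bullet> (f y - f (x t)) = fst z \<bullet> snd ?d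
        - (\<Sum>k\<in>?I. (\<phi> (fst y \<bullet> bond e k) - \<phi> (fst (x t) \<bullet> bond e k)) * (snd z \<bullet> bond e k))"
      by (simp add: inner_prod_def inner_sum_right)
    have 2: "A t z \<bullet> ?d = fst z \<bullet> snd ?d - (\<Sum>k\<in>?I. a k t * (snd z \<bullet> bond e k) * (bond e k \<bullet> fst ?d))"
      by (simp add: A_def inner_prod_def inner_sum_left)
    have 3: "\<delta> k * (snd z \<bullet> bond e k) = (\<phi> (fst y \<bullet> bond e k) - \<phi> (fst (x t) \<bullet> bond e k)) * (snd z \<bullet> bond e k)
        - a k t * (snd z \<bullet> bond e k) * (bond e k \<bullet> fst ?d)" for k
    proof -
      have "fst y \<bullet> bond e k - fst (x t) \<bullet> bond e k = bond e k \<bullet> fst ?d"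
        by (simp add: inner_diff_right inner_commute)
      then have "\<delta> k = \<phi> (fst y \<bullet> bond e k) - \<phi> (fst (x t) \<bullet> bond e k) - a k t * (bond e k \<bullet> fst ?d)"
        by (simp only: \<delta>_def)
      then show ?thesis by (simp only: left_diff_distrib right_diff_distrib mult_ac)
    qed
    have "z \<bullet> (f y - f (x t)) - A t z \<bullet> ?d = - (\<Sum>k\<in>?I. \<delta> k * (snd z \<bullet> bond e k))"
      unfolding 1 2 3 sum_subtractf by simp
    also have "\<bar>\<dots>\<bar> \<le> (\<Sum>k\<in>?I. C2 * (4 * (norm (y - x t))\<^sup>2) * (2 * norm z))"
      unfolding abs_minus_cancel
    proof (rule order_trans[OF sum_abs], rule sum_mono)
      fix k
      have "\<bar>snd z \<bullet> bond e k\<bar> \<le> 2 * norm z"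
        using bond_le[of "snd z" k] norm_snd[of z] by simp
      then show "\<bar>\<delta> k * (snd z \<bullet> bond e k)\<bar> \<le> C2 * (4 * (norm (y - x t))\<^sup>2) * (2 * norm z)"
        unfolding abs_mult using \<delta>[of k] C20 by (intro mult_mono) auto
    qed
    also have "\<dots> = real (?n - 1) * (C2 * (4 * (norm ?d)\<^sup>2) * (2 * norm z))"
      by (simp only: sum_constant card_atLeastAtMost diff_Suc_1 One_nat_def Suc_diff_Suc) simp
    also have "C2 * (4 * (norm ?d)\<^sup>2) * (2 * norm z) = 8 * C2 * norm z * (norm ?d)\<^sup>2" by simp
    finally show ?thesis by (simp only: mult.assoc)
  qed
  interpret controlled_tube f B U T L L "real (?n - 1) * (8 * C2)" x w A
  proof (rule controlled_tube.intro)
  qed (fact T L0 f_lip B_lin U_props w_adm x_sol A_lin A_cont A_bound C0 rem)+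
  have control_iff: "control v \<longleftrightarrow> admissible_control \<omega> T v" for v
    unfolding control_def admissible_control_def by (simp only: U_def)
  \<comment> \<open>Within the tube the clamped and the original drift agree. A clamped response
    staying there is thus a genuine trajectory, and its early arrival would contradict time
    optimality.\<close>
  have no_faster: "y T' \<noteq> x T"
    if T': "0 \<le> T'" "T' < T" and v: "control v" and y: "response v y"
      and near: "\<And>t. t \<in> {0..T} \<Longrightarrow> norm (y t - x t) \<le> 1" for T' v y
  proof
    assume hit: "y T' = x T"
    have "trajectory e \<phi> \<omega> T' y v"
      unfolding trajectory_def
    proof
      have "v \<in> borel_measurable (lebesgue_on {0..T'})"
        using v T' unfolding control_def by (auto intro: measurable_restrict_mono)
      then show "admissible_control \<omega> T' v"
        using v T' by (auto simp: control_iff admissible_control_def)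
      show "\<forall>t\<in>{0..T'}. ((\<lambda>s. drift e \<phi> (y s) + fst (v s) *\<^sub>R dp e 1 + snd (v s) *\<^sub>R dp e ?n) has_integral (y t - y 0)) {0..t}"
      proof
        fix t assume t: "t \<in> {0..T'}"
        have I: "((\<lambda>s. f (y s) + B (v s)) has_integral (y t - y 0)) {0..t}"
        proof -
          have "t \<in> {0..T}" using t T' by simp
          from bspec[OF y[unfolded response_def] this] show ?thesis
            by (simp only: response_0[OF y])
        qed
        show "((\<lambda>s. drift e \<phi> (y s) + fst (v s) *\<^sub>R dp e 1 + snd (v s) *\<^sub>R dp e ?n) has_integral (y t - y 0)) {0..t}"
        proof (rule has_integral_eq[OF _ I])
          fix s assume "s \<in> {0..t}"
          then have s: "s \<in> {0..T}" using t T' by auto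
          have "norm (y s) \<le> R / 2"
            using norm_triangle_sub[of "y s" "x s"] near[OF s] xR[OF s] by simp
          then show "f (y s) + B (v s) = drift e \<phi> (y s) + fst (v s) *\<^sub>R dp e 1 + snd (v s) *\<^sub>R dp e ?n"
            by (simp add: f_drift B_def)
        qed
      qed
    qed
    then have "\<exists>T' y w'. 0 \<le> T' \<and> T' < T \<and> trajectory e \<phi> \<omega> T' y w' \<and> y 0 = x 0 \<and> y T' = x T"
      using hit T' response_0[OF y] by (intro exI conjI)
    with opt show False
      unfolding time_optimal_def by (elim conjE notE)
  qed
  obtain \<psi> where \<psi>: "adjoint_solution \<psi>" "\<psi> T \<noteq> 0" "\<And>v. control v \<Longrightarrow> gain \<psi> v \<le> 0"
  proof (rule maximum_principle)
    show "y T' \<noteq> x T" if "0 \<le> T'" "T' < T" "control v" "response v y"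
      "\<And>t. t \<in> {0..T} \<Longrightarrow> norm (y t - x t) \<le> 1" for T' v y
      using that by (rule no_faster)
  qed blast
  define \<eta> where "\<eta> k t = snd (\<psi> t) $ e k" for k t
  define \<xi> where "\<xi> k t = fst (\<psi> t) $ e k" for k t
  show ?thesis
  proof
    show "adjoint_chain ?n {0..T} (\<lambda>k t. \<phi>' (fst (x t) \<bullet> bond e k)) \<eta> \<xi>"
      unfolding adjoint_chain_def
    proof (intro ballI conjI)
      fix k t assume k: "k \<in> {1..?n}" and t: "t \<in> {0..T}"
      have D: "(\<psi> has_vector_derivative - A t (\<psi> t)) (at t within {0..T})"
        using \<psi>(1) t by (simp add: adjoint_solution_def)
      have "((\<lambda>t. snd (\<psi> t) $ e k) has_vector_derivative snd (- A t (\<psi> t)) $ e k) (at t within {0..T})"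
        by (intro bounded_linear.has_vector_derivative[OF bounded_linear_vec_nth]
            bounded_linear.has_vector_derivative[OF bounded_linear_snd] D)
      then show "(\<eta> k has_real_derivative - \<xi> k t) (at t within {0..T})"
        by (simp add: has_real_derivative_iff_has_vector_derivative \<eta>_def[abs_def] \<xi>_def A_def)
      have "((\<lambda>t. fst (\<psi> t) $ e k) has_vector_derivative fst (- A t (\<psi> t)) $ e k) (at t within {0..T})"
        by (intro bounded_linear.has_vector_derivative[OF bounded_linear_vec_nth]
            bounded_linear.has_vector_derivative[OF bounded_linear_fst] D)
      also have "fst (- A t (\<psi> t)) $ e k = (\<Sum>j=1..?n-1. (a j t * (snd (\<psi> t) \<bullet> bond e j)) *\<^sub>R bond e j) $ e k"
        by (simp add: A_def)
      also note bond_chain[OF e k]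
      finally show "(\<xi> k has_real_derivative
          (if k < ?n then \<phi>' (fst (x t) \<bullet> bond e k) * (\<eta> k t - \<eta> (k + 1) t) else 0)
          - (if 1 < k then \<phi>' (fst (x t) \<bullet> bond e (k - 1)) * (\<eta> (k - 1) t - \<eta> k t) else 0)) (at t within {0..T})"
        by (simp only: has_real_derivative_iff_has_vector_derivative \<eta>_def[abs_def] \<xi>_def[abs_def] a_def)
    qed
    show "\<forall>t\<in>{0..T}. \<exists>k\<in>{1..?n}. \<eta> k t \<noteq> 0 \<or> \<xi> k t \<noteq> 0"
    proof (intro ballI, rule ccontr)
      fix t assume t: "t \<in> {0..T}" and "\<not> (\<exists>k\<in>{1..?n}. \<eta> k t \<noteq> 0 \<or> \<xi> k t \<noteq> 0)"
      then have "snd (\<psi> t) $ j = 0 \<and> fst (\<psi> t) $ j = 0" for j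
        using e by (auto simp: bij_betw_def \<eta>_def \<xi>_def dest!: equalityD2 subsetD[of UNIV _ j])
      then have "\<psi> t = 0" by (simp add: prod_eq_iff vec_eq_iff)
      with adjoint_nonzero[OF \<psi>(1,2) t] show False by simp
    qed
    \<comment> \<open>The pointwise maximiser is used as competitor. Both summands of the integrand
      are nonnegative and the gain is nonpositive, so each summand vanishes almost
      everywhere.\<close>
    define v where "v = bang_control \<omega> (\<eta> 1) (\<eta> ?n)"
    have \<eta>_cont: "continuous_on {0..T} (\<eta> k)" for k
      unfolding \<eta>_def by (intro continuous_intros adjoint_continuous[OF \<psi>(1)])
    have \<eta>_meas: "\<eta> k \<in> borel_measurable (lebesgue_on {0..T})" for k
      using \<eta>_cont by (rule continuous_imp_measurable_on_sets_lebesgue) simp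
    have v: "control v"
      unfolding control_def
    proof
      show "v \<in> borel_measurable (lebesgue_on {0..T})"
        unfolding v_def bang_control_def using \<eta>_meas by measurable
      show "\<forall>t\<in>{0..T}. v t \<in> U" using \<omega> by (simp add: v_def bang_control_def U_def)
    qed
    have integrand: "\<psi> s \<bullet> B (v s - w s) = \<eta> 1 s * (fst (v s) - fst (w s)) + \<eta> ?n s * (snd (v s) - snd (w s))" for s
      by (simp add: B_def dp_def inner_prod_def inner_axis \<eta>_def algebra_simps)
    have pos: "0 \<le> \<eta> 1 s * (fst (v s) - fst (w s))" "0 \<le> \<eta> ?n s * (snd (v s) - snd (w s))" if "s \<in> {0..T}" for s
      using w(2)[OF that] by (auto simp: v_def bang_control_def U_def mult_nonneg_nonneg mult_nonpos_nonpos mult_nonneg_nonpos)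
    have "AE s in lebesgue_on {0..T}. \<psi> s \<bullet> B (v s - w s) = 0"
    proof (rule integral_nonpos_imp_AE_zero)
      show "0 \<le> \<psi> s \<bullet> B (v s - w s)" if "s \<in> {0..T}" for s
        unfolding integrand using pos[OF that] by simp
    qed (use gain_integrable[OF \<psi>(1) v] \<psi>(3)[OF v] in \<open>auto simp: gain_def\<close>)
    then show "AE t in lebesgue_on {0..T}. \<eta> 1 t \<noteq> 0 \<and> \<eta> ?n t \<noteq> 0 \<longrightarrow> w t = bang_control \<omega> (\<eta> 1) (\<eta> ?n) t"
      using AE_space
    proof eventually_elim
      case (elim t)
      then have "t \<in> {0..T}" by simp
      with elim(1) pos[of t] have "\<eta> 1 t * (fst (v t) - fst (w t)) = 0" "\<eta> ?n t * (snd (v t) - snd (w t)) = 0"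
        unfolding integrand by linarith+
      then show ?case unfolding v_def[symmetric] by (auto simp: prod_eq_iff)
    qed
  qed
qed

theorem theorem5p3:
  fixes e :: "nat \<Rightarrow> 'n::finite" and \<Phi> \<phi> :: "real \<Rightarrow> real" and \<omega> :: real
  assumes "CARD('n) \<ge> 2"
    and "bij_betw e {1..CARD('n)} UNIV"
    and "real_analytic \<Phi>"
    and "bdd_below (range \<Phi>)"
    and "filterlim \<Phi> at_top at_top"
    and "\<phi> = deriv \<Phi>"
    and "\<forall>y. deriv \<phi> y \<noteq> 0"
    and "\<omega> > 0"
  shows "\<forall>K :: 'n state set. \<forall>T :: real. compact K \<and> T > 0 \<longrightarrow>
           (\<exists>N :: nat. \<forall>x w. time_optimal e \<phi> \<omega> T x w \<and> (\<forall>t\<in>{0..T}. x t \<in> K) \<longrightarrow>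
              bang_bang \<omega> T w \<and> at_most_switchings \<omega> T N w)"
proof (intro allI impI, elim conjE)
  fix K :: "'n state set" and T :: real
  assume K: "compact K" and T: "T > 0"
  let ?n = "CARD('n)"
  define \<phi>' where "\<phi>' = deriv \<phi>"
  define \<phi>'' where "\<phi>'' = deriv \<phi>'"
  have ana: "real_analytic \<phi>" "real_analytic \<phi>'" "real_analytic \<phi>''"
    unfolding \<phi>''_def \<phi>'_def assms(6) using assms(3) by (intro real_analytic_deriv; assumption)+
  have D: "(\<phi> has_real_derivative \<phi>' y) (at y)" "(\<phi>' has_real_derivative \<phi>'' y) (at y)" for y
    using real_analytic_has_deriv[OF ana(1)] real_analytic_has_deriv[OF ana(2)]
    unfolding \<phi>''_def by (simp_all add: \<phi>'_def)
  obtain b where b: "0 < b" "\<And>z. z \<in> K \<Longrightarrow> norm z \<le> b"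
    using compact_imp_bounded[OF K] unfolding bounded_pos by blast
  \<comment> \<open>Chosen so that \<open>norm z + 1 \<le> R / 2\<close> on
    \<open>K\<close>.\<close>
  define R where "R = 2 * (b + 1)"
  obtain C1 where C1: "0 \<le> C1" "\<And>y. y \<in> {-R..R} \<Longrightarrow> \<bar>\<phi>' y\<bar> \<le> C1"
    using continuous_on_Icc_norm_bound[OF real_analytic_continuous[OF ana(2)]] unfolding real_norm_def by metis
  obtain C2 where C2: "0 \<le> C2" "\<And>y. y \<in> {-R..R} \<Longrightarrow> \<bar>\<phi>'' y\<bar> \<le> C2"
    using continuous_on_Icc_norm_bound[OF real_analytic_continuous[OF ana(3)]] unfolding real_norm_def by metis
  \<comment> \<open>The bound is fixed before any trajectory is considered, since only
    \<open>C1\<close> and \<open>T\<close> enter. The type \<open>'n + 'n\<close> has the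
    \<open>2 * n\<close> elements needed for the pairs of adjoint components.\<close>
  have "\<exists>Z::nat. \<forall>a \<eta> \<xi>. adjoint_chain ?n {0..T} a \<eta> \<xi> \<and>
      (\<forall>k\<in>{1..<?n}. continuous_on {0..T} (a k) \<and> (\<forall>t\<in>{0..T}. a k t \<noteq> 0 \<and> \<bar>a k t\<bar> \<le> C1)) \<and>
      (\<forall>t\<in>{0..T}. \<exists>k\<in>{1..?n}. \<eta> k t \<noteq> 0 \<or> \<xi> k t \<noteq> 0) \<longrightarrow>
      finite {t\<in>{0..T}. \<eta> 1 t = 0} \<and> card {t\<in>{0..T}. \<eta> 1 t = 0} \<le> Z"
    by (rule adjoint_chain_zeros[where 'm = "'n + 'n"]) (use C1 T in \<open>simp_all add: card_UNIV_sum mult_2\<close>)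
  then obtain Z :: nat where Z: "\<And>a \<eta> \<xi>. adjoint_chain ?n {0..T} a \<eta> \<xi> \<Longrightarrow>
      (\<forall>k\<in>{1..<?n}. continuous_on {0..T} (a k) \<and> (\<forall>t\<in>{0..T}. a k t \<noteq> 0 \<and> \<bar>a k t\<bar> \<le> C1)) \<Longrightarrow>
      (\<forall>t\<in>{0..T}. \<exists>k\<in>{1..?n}. \<eta> k t \<noteq> 0 \<or> \<xi> k t \<noteq> 0) \<Longrightarrow>
      finite {t\<in>{0..T}. \<eta> 1 t = 0} \<and> card {t\<in>{0..T}. \<eta> 1 t = 0} \<le> Z"
    by blast
  have "bang_bang \<omega> T w \<and> at_most_switchings \<omega> T (Z + Z) w"
    if opt: "time_optimal e \<phi> \<omega> T x w" and xK: "\<And>t. t \<in> {0..T} \<Longrightarrow> x t \<in> K" for x w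
  proof -
    let ?a = "\<lambda>k t. \<phi>' (fst (x t) \<bullet> bond e k)"
    have xR: "norm (x t) + 1 \<le> R / 2" if "t \<in> {0..T}" for t
      using b(2)[OF xK[OF that]] by (simp add: R_def)
    obtain \<eta> \<xi> where chain: "adjoint_chain ?n {0..T} ?a \<eta> \<xi>"
      and nz: "\<forall>t\<in>{0..T}. \<exists>k\<in>{1..?n}. \<eta> k t \<noteq> 0 \<or> \<xi> k t \<noteq> 0"
      and w: "AE t in lebesgue_on {0..T}. \<eta> 1 t \<noteq> 0 \<and> \<eta> ?n t \<noteq> 0 \<longrightarrow> w t = bang_control \<omega> (\<eta> 1) (\<eta> ?n) t"
      by (rule extremal_adjoint[OF assms(1,2) D C1(2) C2(2) xR T assms(8) opt])
         (assumption | (rule that; assumption))+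
    have contx: "continuous_on {0..T} x"
      using opt unfolding time_optimal_def trajectory_def by (intro primitive_continuous) blast
    have cont_a: "continuous_on {0..T} (?a k)" for k
      by (rule continuous_on_compose2[OF real_analytic_continuous[OF ana(2), of UNIV]])
         (auto intro!: continuous_intros contx)
    have a_bound: "\<bar>?a k t\<bar> \<le> C1" if t: "t \<in> {0..T}" for k t
    proof -
      have "\<bar>fst (x t) \<bullet> bond e k\<bar> \<le> norm (fst (x t)) * norm (bond e k)"
        by (rule Cauchy_Schwarz_ineq2)
      also have "\<dots> \<le> norm (x t) * 2"
        using norm_fst_le[of "fst (x t)" "snd (x t)"] by (intro mult_mono norm_bond) auto
      also have "\<dots> \<le> R" using xR[OF t] by simp
      finally show ?thesis by (intro C1) (simp add: abs_le_iff)
    qed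
    have a_nz: "?a k t \<noteq> 0" for k t using assms(7) by (simp add: \<phi>'_def)
    have z1: "finite {t\<in>{0..T}. \<eta> 1 t = 0} \<and> card {t\<in>{0..T}. \<eta> 1 t = 0} \<le> Z"
      by (rule Z[OF chain]) (use cont_a a_bound a_nz nz in auto)
    \<comment> \<open>The component \<open>\<eta> (?n + 1 - 1)\<close> is the first one of the
      reflected chain, whose coefficients satisfy the same bounds.\<close>
    have "finite {t\<in>{0..T}. \<eta> (?n + 1 - 1) t = 0} \<and> card {t\<in>{0..T}. \<eta> (?n + 1 - 1) t = 0} \<le> Z"
    proof (rule Z[OF adjoint_chain_reverse[OF chain]])
      show "\<forall>t\<in>{0..T}. \<exists>k\<in>{1..?n}. \<eta> (?n + 1 - k) t \<noteq> 0 \<or> \<xi> (?n + 1 - k) t \<noteq> 0"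
      proof
        fix t assume "t \<in> {0..T}"
        then obtain k where "k \<in> {1..?n}" "\<eta> k t \<noteq> 0 \<or> \<xi> k t \<noteq> 0" using nz by blast
        then show "\<exists>k\<in>{1..?n}. \<eta> (?n + 1 - k) t \<noteq> 0 \<or> \<xi> (?n + 1 - k) t \<noteq> 0"
          by (intro bexI[of _ "?n + 1 - k"]) auto
      qed
    qed (use cont_a a_bound a_nz in auto)
    then have zn: "finite {t\<in>{0..T}. \<eta> ?n t = 0} \<and> card {t\<in>{0..T}. \<eta> ?n t = 0} \<le> Z" by simp
    have \<eta>_cont: "continuous_on {0..T} (\<eta> k)" if "k \<in> {1..?n}" for k
      using chain that unfolding adjoint_chain_def by (intro DERIV_continuous_on) blast
    show ?thesis
      by (rule bang_control_switchings[OF T \<eta>_cont \<eta>_cont _ _ w]) (use z1 zn assms(1) in auto)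
  qed
  then show "\<exists>N :: nat. \<forall>x w. time_optimal e \<phi> \<omega> T x w \<and> (\<forall>t\<in>{0..T}. x t \<in> K) \<longrightarrow>
      bang_bang \<omega> T w \<and> at_most_switchings \<omega> T N w"
    by blast
qed

end
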